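(* Let $\alpha,\delta\in\mathbb{R}$, $\beta>0$, $s\in\mathbb{R}$ and $y_0\in H^s_x(\mathbb{R})$. The unique solution $y=S[y_0;0]$ of the Cauchy problem $$iy_t+i\beta y_{xxx}+\alpha y_{xx}+i\delta y_x=0,\quad (x,t)\in\mathbb{R}\times\mathbb{R},\qquad y(x,0)=y_0(x),\quad x\in\mathbb{R},$$ belongs to $C(\mathbb{R}_t;H^s_x(\mathbb{R}))$ and satisfies the conservation law $$\|y(\cdot,t)\|_{H^s_x(\mathbb{R})}=\|y_0\|_{H^s_x(\mathbb{R})},\qquad t\in\mathbb{R}.$$ Moreover, if $\alpha^2+3\beta\delta\ge0$, then $y\in C(\mathbb{R}_x;H_t^{\frac{s+1}{3}}(-T,T))$ for $T>0$ and there exists a constant $c=c(s,\alpha,\beta,\delta)\ge0$ such that $$\sup_{x\in\mathbb{R}}\|y(x,\cdot)\|_{H_t^{\frac{s+1}{3}}(-T,T)}\le c\,(1+T^{\frac12})\,\|y_0\|_{H^s_x(\mathbb{R})},$$ while if $\alpha^2+3\beta\delta<0$, then $y\in C(\mathbb{R}_x;H_t^{\frac{s+1}{3}}(\mathbb{R}))$ and there is a constant $c=c(s,\alpha,\beta,\delta)\ge0$ such that $$\sup_{x\in\mathbb{R}}\|y(x,\cdot)\|_{H_t^{\frac{s+1}{3}}(\mathbb{R})}\le c\,\|y_0\|_{H^s_x(\mathbb{R})}.$$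
   Context: The solution is given by $y(x,t)=S[y_0;0](x,t)=\frac{1}{2\pi}\int_{\mathbb{R}}e^{ikx-\omega(k)t}\,\widehat y_0(k)\,dk$ with $\omega(k)=-i\beta k^3+i\alpha k^2+i\delta k$ and $\widehat y_0(k)=\int_{\mathbb{R}} e^{-ikx}y_0(x)\,dx$ (extended to $H^s$ by the usual distributional definition). $H^s(\mathbb{R})$ has norm $\|(1+k^2)^{s/2}\widehat f\|_{L^2}$ (up to a fixed normalizing constant), and $H^\sigma(-T,T)$ is the corresponding Sobolev space on the interval. *)

theory Defs
  imports "HOL-Analysis.Analysis"
begin

section \<open>Test functions, Schwartz functions and tempered distributions\<close>

definition dir_deriv :: "'a::real_normed_vector \<Rightarrow> ('a \<Rightarrow> complex) \<Rightarrow> 'a \<Rightarrow> complex" where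
  "dir_deriv v f = (\<lambda>p. frechet_derivative f (at p) v)"

fun Ck :: "nat \<Rightarrow> ('a::real_normed_vector \<Rightarrow> complex) \<Rightarrow> bool" where
  "Ck 0 f \<longleftrightarrow> continuous_on UNIV f"
| "Ck (Suc n) f \<longleftrightarrow> (\<forall>p. f differentiable (at p)) \<and> (\<forall>v. Ck n (dir_deriv v f))"

definition smooth :: "('a::real_normed_vector \<Rightarrow> complex) \<Rightarrow> bool" where
  "smooth f \<longleftrightarrow> (\<forall>n. Ck n f)"

definition test_functions :: "'a::euclidean_space set \<Rightarrow> ('a \<Rightarrow> complex) set" where
  "test_functions U =
     {\<phi>. smooth \<phi> \<and> (\<exists>K. compact K \<and> K \<subseteq> U \<and> (\<forall>x. x \<notin> K \<longrightarrow> \<phi> x = 0))}"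

definition schwartz :: "(real \<Rightarrow> complex) set" where
  "schwartz = {\<phi>. smooth \<phi> \<and>
     (\<forall>j m. bounded (range (\<lambda>x. complex_of_real x ^ j * (dir_deriv 1 ^^ m) \<phi> x)))}"

definition schwartz_seminorm :: "nat \<Rightarrow> (real \<Rightarrow> complex) \<Rightarrow> real" where
  "schwartz_seminorm N \<phi> =
     (\<Sum>j\<le>N. \<Sum>m\<le>N. SUP x. norm (complex_of_real x ^ j * (dir_deriv 1 ^^ m) \<phi> x))"

text \<open>A distribution is represented by a functional on all functions, of which only the values on
  Schwartz functions (respectively test functions) are meaningful; equality of distributions is
  therefore always stated on those functions.\<close>

type_synonym functional = "(real \<Rightarrow> complex) \<Rightarrow> complex"

definition tempered :: "functional \<Rightarrow> bool" where
  "tempered u \<longleftrightarrow>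
     (\<forall>\<phi>\<in>schwartz. \<forall>\<psi>\<in>schwartz. u (\<lambda>x. \<phi> x + \<psi> x) = u \<phi> + u \<psi>) \<and>
     (\<forall>c. \<forall>\<phi>\<in>schwartz. u (\<lambda>x. c * \<phi> x) = c * u \<phi>) \<and>
     (\<exists>C N. \<forall>\<phi>\<in>schwartz. norm (u \<phi>) \<le> C * schwartz_seminorm N \<phi>)"


section \<open>Fourier transform and Sobolev spaces\<close>

definition fourier :: "(real \<Rightarrow> complex) \<Rightarrow> real \<Rightarrow> complex" where
  "fourier \<phi> k = (LBINT x. exp (- \<i> * complex_of_real (k * x)) * \<phi> x)"

text \<open>The Fourier transform of the distribution \<open>u\<close>, given by \<open>\<phi> \<mapsto> u (fourier \<phi>)\<close>, is the
  function \<open>g\<close>. Such a \<open>g\<close> is locally integrable and unique up to null sets, so the choice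
  in \<open>dist_fourier\<close> is immaterial.\<close>

definition has_fourier :: "functional \<Rightarrow> (real \<Rightarrow> complex) \<Rightarrow> bool" where
  "has_fourier u g \<longleftrightarrow> g \<in> borel_measurable lborel \<and>
     (\<forall>\<phi>\<in>schwartz. integrable lborel (\<lambda>k. g k * \<phi> k) \<and> u (fourier \<phi>) = (LBINT k. g k * \<phi> k))"

definition dist_fourier :: "functional \<Rightarrow> real \<Rightarrow> complex" where
  "dist_fourier u = (SOME g. has_fourier u g)"

definition sobolev :: "real \<Rightarrow> functional set" where
  "sobolev s = {u. tempered u \<and>
     (\<exists>g. has_fourier u g \<and> integrable lborel (\<lambda>k. (1 + k\<^sup>2) powr s * (norm (g k))\<^sup>2))}"

definition sobolev_norm :: "real \<Rightarrow> functional \<Rightarrow> real" where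
  "sobolev_norm s u = sqrt (LBINT k. (1 + k\<^sup>2) powr s * (norm (dist_fourier u k))\<^sup>2)"

text \<open>The Sobolev space on an open set \<open>U\<close> consists of the restrictions to \<open>U\<close> of elements of the
  Sobolev space on the line, with the quotient norm.\<close>

definition sobolev_extensions :: "real set \<Rightarrow> real \<Rightarrow> functional \<Rightarrow> functional set" where
  "sobolev_extensions U s f = {F \<in> sobolev s. \<forall>\<psi>\<in>test_functions U. F \<psi> = f \<psi>}"

definition sobolev_on :: "real set \<Rightarrow> real \<Rightarrow> functional set" where
  "sobolev_on U s = {f. sobolev_extensions U s f \<noteq> {}}"

definition sobolev_on_norm :: "real set \<Rightarrow> real \<Rightarrow> functional \<Rightarrow> real" where
  "sobolev_on_norm U s f = (INF F\<in>sobolev_extensions U s f. sobolev_norm s F)"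

definition continuous_into ::
    "functional set \<Rightarrow> (functional \<Rightarrow> real) \<Rightarrow> (real \<Rightarrow> functional) \<Rightarrow> bool" where
  "continuous_into X nrm u \<longleftrightarrow> (\<forall>a. u a \<in> X) \<and>
     (\<forall>a. ((\<lambda>b. nrm (\<lambda>\<phi>. u b \<phi> - u a \<phi>)) \<longlongrightarrow> 0) (at a))"


section \<open>The Cauchy problem\<close>

text \<open>Points of space-time are pairs \<open>(x, t)\<close>. A family \<open>y\<close> of distributions in \<open>x\<close>, indexed by
  \<open>t\<close>, defines the space-time distribution \<open>\<Phi> \<mapsto> \<integral> y t (\<Phi>(\<cdot>, t)) dt\<close>. The operator below is the
  formal transpose of \<open>i \<partial>\<^sub>t + i \<beta> \<partial>\<^sub>x\<^sup>3 + \<alpha> \<partial>\<^sub>x\<^sup>2 + i \<delta> \<partial>\<^sub>x\<close>.\<close>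

definition transpose_op ::
    "real \<Rightarrow> real \<Rightarrow> real \<Rightarrow> (real \<times> real \<Rightarrow> complex) \<Rightarrow> real \<times> real \<Rightarrow> complex" where
  "transpose_op \<alpha> \<beta> \<delta> \<Phi> p =
     - \<i> * dir_deriv (0, 1) \<Phi> p
     - \<i> * complex_of_real \<beta> * (dir_deriv (1, 0) ^^ 3) \<Phi> p
     + complex_of_real \<alpha> * (dir_deriv (1, 0) ^^ 2) \<Phi> p
     - \<i> * complex_of_real \<delta> * dir_deriv (1, 0) \<Phi> p"

definition solves_equation :: "real \<Rightarrow> real \<Rightarrow> real \<Rightarrow> (real \<Rightarrow> functional) \<Rightarrow> bool" where
  "solves_equation \<alpha> \<beta> \<delta> y \<longleftrightarrow> (\<forall>\<Phi>\<in>test_functions UNIV.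
     integrable lborel (\<lambda>t. y t (\<lambda>x. transpose_op \<alpha> \<beta> \<delta> \<Phi> (x, t))) \<and>
     (LBINT t. y t (\<lambda>x. transpose_op \<alpha> \<beta> \<delta> \<Phi> (x, t))) = 0)"

text \<open>The initial condition is meaningful because a solution is required to be continuous in time
  with values in a Sobolev space of some order, which is not prescribed.\<close>

definition cauchy_solution ::
    "real \<Rightarrow> real \<Rightarrow> real \<Rightarrow> functional \<Rightarrow> (real \<Rightarrow> functional) \<Rightarrow> bool" where
  "cauchy_solution \<alpha> \<beta> \<delta> y0 y \<longleftrightarrow>
     (\<exists>r. continuous_into (sobolev r) (sobolev_norm r) y) \<and>
     solves_equation \<alpha> \<beta> \<delta> y \<and>
     (\<forall>\<phi>\<in>schwartz. y 0 \<phi> = y0 \<phi>)"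

definition omega :: "real \<Rightarrow> real \<Rightarrow> real \<Rightarrow> real \<Rightarrow> complex" where
  "omega \<alpha> \<beta> \<delta> k = - \<i> * complex_of_real \<beta> * complex_of_real k ^ 3
     + \<i> * complex_of_real \<alpha> * complex_of_real k ^ 2 + \<i> * complex_of_real \<delta> * complex_of_real k"

text \<open>The distribution \<open>y(\<cdot>, t)\<close> with
  \<open>y(x, t) = (1 / 2\<pi>) \<integral> exp (ikx - \<omega>(k) t) Fy\<^sub>0(k) dk\<close>, \<open>Fy\<^sub>0\<close> being the Fourier transform of \<open>y\<^sub>0\<close>: the integration in \<open>x\<close> against the
  Schwartz function \<open>\<phi>\<close> is carried out first, so that the integral in \<open>k\<close> converges absolutely
  for initial data in a Sobolev space of any order.\<close>

definition solution_op ::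
    "real \<Rightarrow> real \<Rightarrow> real \<Rightarrow> functional \<Rightarrow> real \<Rightarrow> functional" where
  "solution_op \<alpha> \<beta> \<delta> y0 t \<phi> = 1 / (2 * complex_of_real pi) *
     (LBINT k. exp (- omega \<alpha> \<beta> \<delta> k * complex_of_real t) * dist_fourier y0 k *
       (LBINT x. exp (\<i> * complex_of_real (k * x)) * \<phi> x))"

text \<open>\<open>Y x\<close> is the distribution \<open>y(x, \<cdot>)\<close>: the families \<open>y\<close> (indexed by time) and \<open>Y\<close> (indexed by
  space) define the same space-time distribution. A family \<open>Y\<close> that is continuous in \<open>x\<close> is
  determined by this, up to its values outside the test functions.\<close>

definition time_traces :: "(real \<Rightarrow> functional) \<Rightarrow> (real \<Rightarrow> functional) \<Rightarrow> bool" where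
  "time_traces y Y \<longleftrightarrow> (\<forall>\<Phi>\<in>test_functions UNIV.
     integrable lborel (\<lambda>t. y t (\<lambda>x. \<Phi> (x, t))) \<and>
     integrable lborel (\<lambda>x. Y x (\<lambda>t. \<Phi> (x, t))) \<and>
     (LBINT x. Y x (\<lambda>t. \<Phi> (x, t))) = (LBINT t. y t (\<lambda>x. \<Phi> (x, t))))"

end

(*
On the Fourier side the equation is g' = i p(k) g with the real phase
p(k) = beta k^3 - alpha k^2 - delta k, so the evolution multiplies the transform by a unimodular
factor; this gives the conservation law, and dominated convergence gives the continuity in time.
For uniqueness, testing with tensor products theta(t) f(x) and passing from compactly supported f
to Fourier transforms of test functions shows that the pairing of exp(-i p t) g(t) with a fixed test
function has zero derivative in t.

For the traces, substituting tau = p(k) identifies the transform of y(x, .) in t with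
exp(i k x) g(k) / p'(k). Since 1 + p^2 is comparable to (1 + k^2)^3 and p' to 1 + k^2, this is bounded from
H^s to H^((s+1)/3) wherever p' >= d (1 + k^2) with d > 0: everywhere if alpha^2 + 3 beta delta < 0, and for
|k| >= R in general. The frequencies |k| <= R are multiplied in time by a smooth function equal to 1
on (-T, T), whose transform has weighted L^2 norm O((1 + T)^(1/2)).
*)

theory Submission
  imports Defs "HOL-Probability.Characteristic_Functions" "HOL-Probability.Sinc_Integral"
    "HOL-Real_Asymp.Real_Asymp"
begin

section \<open>Smooth functions\<close>

text \<open>All statements are reduced to weighted square integrable functions of the frequency.
  This loses nothing because the Fourier transform maps the Schwartz functions onto themselves,
  which is why inversion comes early. For uniqueness, a competing solution lies in a space of
  arbitrary order \<open>r\<close>, so its transform is accessible only through pairings with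
  rapidly decaying functions. A nonzero test function never has a compactly supported transform,
  which forces the approximation by dilated cutoffs. In the pairing of g(t) with exp(-i p t), the
  first factor is differentiable only after testing, the second in norm, so the product rule has to
  be done by hand. For the traces, the quotient norm on (-T, T) is bounded by exhibiting one
  extension. The extension may depend on T, while the trace is a single family for all T. The growth
  T^(1/2) is the square root of the length of the interval: the time cutoff is an indicator
  convolved with a bump of fixed width, so the bump pays for the weights and only the indicator sees
  T.\<close>

lemma dir_deriv_eq:
  assumes "(f has_derivative f') (at p)"
  shows "dir_deriv v f p = f' v"
  unfolding dir_deriv_def using frechet_derivative_at[OF assms] by simp

lemma dir_deriv_add:
  assumes "\<And>p. f differentiable (at p)" "\<And>p. g differentiable (at p)"
  shows "dir_deriv v (\<lambda>p. f p + g p) = (\<lambda>p. dir_deriv v f p + dir_deriv v g p)"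
proof
  fix p
  obtain f' g' where "(f has_derivative f') (at p)" "(g has_derivative g') (at p)"
    using assms unfolding differentiable_def by blast
  then show "dir_deriv v (\<lambda>p. f p + g p) p = dir_deriv v f p + dir_deriv v g p"
    using dir_deriv_eq[OF has_derivative_add] by (simp add: dir_deriv_eq)
qed

lemma dir_deriv_mult:
  assumes "\<And>p. f differentiable (at p)" "\<And>p. g differentiable (at p)"
  shows "dir_deriv v (\<lambda>p. f p * g p) = (\<lambda>p. f p * dir_deriv v g p + dir_deriv v f p * g p)"
proof
  fix p
  obtain f' g' where "(f has_derivative f') (at p)" "(g has_derivative g') (at p)"
    using assms unfolding differentiable_def by blast
  then show "dir_deriv v (\<lambda>p. f p * g p) p = f p * dir_deriv v g p + dir_deriv v f p * g p"
    using dir_deriv_eq[OF has_derivative_mult] by (simp add: dir_deriv_eq)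
qed

lemma dir_deriv_const: "dir_deriv v (\<lambda>p. c) = (\<lambda>p. 0)"
  using dir_deriv_eq[OF has_derivative_const] by fastforce

lemma dir_deriv_cmult:
  assumes "\<And>p. f differentiable (at p)"
  shows "dir_deriv v (\<lambda>p. c * f p) = (\<lambda>p. c * dir_deriv v f p)"
  using dir_deriv_mult[of "\<lambda>p. c" f v] assms by (simp add: dir_deriv_const)

lemma dir_deriv_exp:
  assumes "\<And>p. f differentiable (at p)"
  shows "dir_deriv v (\<lambda>p. exp (f p)) = (\<lambda>p. dir_deriv v f p * exp (f p))"
proof
  fix p
  obtain f' where f': "(f has_derivative f') (at p)"
    using assms unfolding differentiable_def by blast
  have "((\<lambda>p. exp (f p)) has_derivative (\<lambda>y. f' y * exp (f p))) (at p)"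
    using has_derivative_compose[OF f' DERIV_exp[unfolded has_field_derivative_def]]
    by (simp add: mult.commute)
  from dir_deriv_eq[OF this] show "dir_deriv v (\<lambda>p. exp (f p)) p = dir_deriv v f p * exp (f p)"
    by (simp add: dir_deriv_eq[OF f'])
qed

text \<open>\<open>L\<close> may act between different spaces: scalings, slices of functions on the
  plane, the swap of two coordinates and the factors of a tensor product are all instances.\<close>

lemma dir_deriv_affine:
  assumes "\<And>p. f differentiable (at p)" "bounded_linear L"
  shows "dir_deriv v (\<lambda>p. f (L p + d)) = (\<lambda>p. dir_deriv (L v) f (L p + d))"
proof
  fix p
  obtain f' where f': "(f has_derivative f') (at (L p + d))"
    using assms unfolding differentiable_def by blast
  have "((\<lambda>p. L p + d) has_derivative L) (at p)"
    using bounded_linear_imp_has_derivative[OF assms(2)] by (auto intro!: derivative_eq_intros)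
  then have "((\<lambda>p. f (L p + d)) has_derivative (\<lambda>y. f' (L y))) (at p)"
    using has_derivative_compose f' by blast
  from dir_deriv_eq[OF this] show "dir_deriv v (\<lambda>p. f (L p + d)) p = dir_deriv (L v) f (L p + d)"
    by (simp add: dir_deriv_eq[OF f'])
qed

lemma differentiable_affine:
  assumes "\<And>p. f differentiable (at p)" "bounded_linear L"
  shows "(\<lambda>p. f (L p + d)) differentiable (at p)"
proof -
  obtain f' where f': "(f has_derivative f') (at (L p + d))"
    using assms unfolding differentiable_def by blast
  have "((\<lambda>p. L p + d) has_derivative L) (at p)"
    using bounded_linear_imp_has_derivative[OF assms(2)] by (auto intro!: derivative_eq_intros)
  then have "((\<lambda>p. f (L p + d)) has_derivative (\<lambda>y. f' (L y))) (at p)"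
    using has_derivative_compose f' by blast
  then show ?thesis unfolding differentiable_def by blast
qed

section \<open>The classes \<open>Ck\<close> and their closure properties\<close>

lemma Ck_differentiable: "Ck (Suc n) f \<Longrightarrow> f differentiable (at p)"
  by simp

lemma Ck_Suc_imp: "Ck (Suc n) f \<Longrightarrow> Ck n f"
proof (induction n arbitrary: f)
  case 0
  then show ?case
    by (simp add: continuous_at_imp_continuous_on differentiable_imp_continuous_within)
next
  case (Suc n)
  then show ?case by (subst Ck.simps(2)) (metis Ck.simps(2))
qed

lemma Ck_const: "Ck n (\<lambda>p. c)"
  by (induction n arbitrary: c) (auto simp: dir_deriv_const)

lemma Ck_add: "Ck n f \<Longrightarrow> Ck n g \<Longrightarrow> Ck n (\<lambda>p. f p + g p)"
  by (induction n arbitrary: f g) (auto simp: dir_deriv_add intro!: continuous_intros)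

lemma Ck_mult: "Ck n f \<Longrightarrow> Ck n g \<Longrightarrow> Ck n (\<lambda>p. f p * g p)"
proof (induction n arbitrary: f g)
  case (Suc n)
  \<comment> \<open>The product rule keeps one factor undifferentiated in each summand, so the
    hypotheses are used at the lower order too.\<close>
  have "Ck n f" "Ck n g" using Suc.prems Ck_Suc_imp by blast+
  with Suc show ?case
    by (auto simp: dir_deriv_mult intro!: Ck_add)
qed (auto intro!: continuous_intros)

lemma Ck_exp: "Ck n f \<Longrightarrow> Ck n (\<lambda>p. exp (f p))"
proof (induction n arbitrary: f)
  case (Suc n)
  have f: "Ck n f" using Suc.prems Ck_Suc_imp by blast
  have "(\<lambda>p. exp (f p)) differentiable (at p)" for p
  proof -
    obtain f' where f': "(f has_derivative f') (at p)"
      using Suc.prems unfolding differentiable_def Ck.simps by blast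
    have "((\<lambda>p. exp (f p)) has_derivative (\<lambda>y. f' y * exp (f p))) (at p)"
      using has_derivative_compose[OF f' DERIV_exp[unfolded has_field_derivative_def]]
      by (simp add: mult.commute)
    then show ?thesis unfolding differentiable_def by blast
  qed
  with Suc f show ?case
    by (auto simp: dir_deriv_exp intro!: Ck_mult)
qed (auto intro!: continuous_intros)

lemma Ck_affine: "Ck n f \<Longrightarrow> bounded_linear L \<Longrightarrow> Ck n (\<lambda>p. f (L p + d))"
proof (induction n arbitrary: f)
  case 0
  then show ?case
    using continuous_on_compose2[of UNIV f UNIV "\<lambda>p. L p + d"]
    by (simp add: continuous_on_add linear_continuous_on)
next
  case (Suc n)
  then show ?case
    by (auto simp: dir_deriv_affine differentiable_affine)
qed

lemma smooth_differentiable: "smooth f \<Longrightarrow> f differentiable (at p)"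
  unfolding smooth_def using Ck_differentiable by blast

lemma smooth_dir_deriv: "smooth f \<Longrightarrow> smooth (dir_deriv v f)"
  unfolding smooth_def using Ck.simps(2) by blast

lemma smooth_dir_deriv_funpow: "smooth f \<Longrightarrow> smooth ((dir_deriv v ^^ n) f)"
  by (induction n) (auto simp: smooth_dir_deriv)

lemma smooth_continuous: "smooth f \<Longrightarrow> continuous_on S f"
  by (meson continuous_at_imp_continuous_on differentiable_imp_continuous_within
      smooth_differentiable)

lemma smooth_const: "smooth (\<lambda>p. c)"
  and smooth_add: "smooth f \<Longrightarrow> smooth g \<Longrightarrow> smooth (\<lambda>p. f p + g p)"
  and smooth_mult: "smooth f \<Longrightarrow> smooth g \<Longrightarrow> smooth (\<lambda>p. f p * g p)"
  and smooth_exp: "smooth f \<Longrightarrow> smooth (\<lambda>p. exp (f p))"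
  and smooth_affine: "smooth f \<Longrightarrow> bounded_linear L \<Longrightarrow> smooth (\<lambda>p. f (L p + d))"
  by (auto simp: smooth_def Ck_const Ck_add Ck_mult Ck_exp Ck_affine)

text \<open>\<open>Ck\<close> only asks about iterated derivatives, so a property that implies
  differentiability and passes to all directional derivatives is an invariant of that recursion.
  This handles functions whose derivatives are known by formula.\<close>

lemma smooth_coinduct:
  assumes "X f" "\<And>f p. X f \<Longrightarrow> f differentiable (at p)" "\<And>f v. X f \<Longrightarrow> X (dir_deriv v f)"
  shows "smooth f"
proof -
  have "Ck n f" if "X f" for n f
    using that
    by (induction n arbitrary: f)
      (auto intro!: continuous_at_imp_continuous_on differentiable_imp_continuous_within assms)
  with assms(1) show ?thesis unfolding smooth_def by blast
qed

lemma smooth_of_real: "smooth complex_of_real"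
proof (rule smooth_coinduct[where X = "\<lambda>f. (\<exists>c. f = (\<lambda>p. c)) \<or> f = complex_of_real"])
  have der: "(complex_of_real has_derivative complex_of_real) (at p)" for p
    by (rule bounded_linear_imp_has_derivative) (rule bounded_linear_of_real)
  show "f differentiable (at p)" if "(\<exists>c. f = (\<lambda>p. c)) \<or> f = complex_of_real"
    for f :: "real \<Rightarrow> complex" and p
    using that der[of p] unfolding differentiable_def by (metis has_derivative_const)
  have "dir_deriv v complex_of_real = (\<lambda>p. of_real v)" for v
    using dir_deriv_eq[OF der] by blast
  then show "(\<exists>c. dir_deriv v f = (\<lambda>p. c)) \<or> dir_deriv v f = complex_of_real"
    if "(\<exists>c. f = (\<lambda>p. c)) \<or> f = complex_of_real" for f :: "real \<Rightarrow> complex" and v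
    using that by (auto simp: dir_deriv_const)
qed simp

abbreviation Dn :: "nat \<Rightarrow> (real \<Rightarrow> complex) \<Rightarrow> real \<Rightarrow> complex" where
  "Dn m \<phi> \<equiv> (dir_deriv 1 ^^ m) \<phi>"

lemma has_vector_derivative_dir_deriv:
  assumes "(f has_vector_derivative f') (at (x::real))"
  shows "dir_deriv v f x = of_real v * f'"
  using dir_deriv_eq[OF assms[unfolded has_vector_derivative_def]] by (simp add: scaleR_conv_of_real)

lemma smooth_has_vector_derivative:
  assumes "smooth f"
  shows "(f has_vector_derivative dir_deriv 1 f x) (at x)"
proof -
  have "f differentiable (at x)" using smooth_differentiable assms by blast
  then show ?thesis
    by (metis has_vector_derivative_dir_deriv mult_1 of_real_1 vector_derivative_works)
qed

lemma smooth_derivative_sequence: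
  assumes F: "\<And>n x. (F n has_vector_derivative F (Suc n) x) (at x)"
  shows "smooth (F m)" "Dn n (F m) = F (m + n)"
proof -
  have d: "((\<lambda>x. c * F n x) has_vector_derivative c * F (Suc n) x) (at x)" for c n x
    using F by (auto intro!: derivative_eq_intros)
  show "smooth (F m)"
  proof (rule smooth_coinduct[where X = "\<lambda>f. \<exists>c n. f = (\<lambda>x. c * F n x)"])
    show "\<exists>c n. F m = (\<lambda>x. c * F n x)"
      by (rule exI[of _ 1]) auto
    show "f differentiable (at p)" if "\<exists>c n. f = (\<lambda>x. c * F n x)" for f and p :: real
      using that d by (auto intro: differentiableI_vector)
    show "\<exists>c n. dir_deriv v f = (\<lambda>x. c * F n x)" if fX: "\<exists>c n. f = (\<lambda>x. c * F n x)" for f v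
    proof -
      from fX obtain c n where f: "f = (\<lambda>x. c * F n x)" by auto
      show ?thesis
        unfolding f using has_vector_derivative_dir_deriv[OF d]
        by (intro exI[of _ "of_real v * c"] exI[of _ "Suc n"]) (auto simp: mult.assoc)
    qed
  qed
  show "Dn n (F m) = F (m + n)"
    by (induction n) (auto simp: has_vector_derivative_dir_deriv[OF F])
qed

lemma Dn_Suc': "Dn (Suc m) \<phi> = Dn m (dir_deriv 1 \<phi>)"
  by (simp add: funpow_swap1)

lemma Dn_has_vector_derivative:
  "smooth f \<Longrightarrow> (Dn n f has_vector_derivative Dn (Suc n) f x) (at x)"
  using smooth_has_vector_derivative smooth_dir_deriv_funpow by fastforce

lemma Dn_add: "smooth f \<Longrightarrow> smooth g \<Longrightarrow> Dn n (\<lambda>x. f x + g x) = (\<lambda>x. Dn n f x + Dn n g x)"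
  by (induction n) (simp_all add: dir_deriv_add smooth_differentiable smooth_dir_deriv_funpow)

lemma Dn_cmult: "smooth f \<Longrightarrow> Dn n (\<lambda>x. c * f x) = (\<lambda>x. c * Dn n f x)"
  by (induction n) (simp_all add: dir_deriv_cmult smooth_differentiable smooth_dir_deriv_funpow)

section \<open>Flat functions and bumps\<close>

definition flat :: "real \<Rightarrow> real" where
  "flat x = (if x > 0 then exp (- inverse x) else 0)"

text \<open>The functions P(1/x) exp(-1/x), extended by 0: a family that contains
  \<open>flat\<close> (with P = 1) and is closed under differentiation.\<close>

definition flat_poly :: "real poly \<Rightarrow> real \<Rightarrow> real" where
  "flat_poly P x = (if x > 0 then poly P (inverse x) * exp (- inverse x) else 0)"

lemma poly_times_exp_tendsto_0: "((\<lambda>y::real. poly P y * exp (- y)) \<longlongrightarrow> 0) at_top"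
proof -
  have "((\<lambda>y. \<Sum>i\<le>degree P. coeff P i * (y ^ i / exp y)) \<longlongrightarrow> (\<Sum>i\<le>degree P. coeff P i * 0)) at_top"
    by (intro tendsto_intros tendsto_power_div_exp_0)
  also have "(\<lambda>y. \<Sum>i\<le>degree P. coeff P i * (y ^ i / exp y)) = (\<lambda>y. poly P y * exp (- y))"
    by (simp add: poly_altdef sum_divide_distrib exp_minus divide_inverse[symmetric])
  finally show ?thesis by simp
qed

text \<open>In the variable u = 1/x the derivative of P(u) exp(-u) is u^2 (P - P')(u) exp(-u), which
  explains the polynomial. At 0 the difference quotient from the right is again a polynomial in u
  times exp(-u), with u tending to infinity.\<close>

lemma flat_poly_has_derivative:
  "(flat_poly P has_real_derivative flat_poly ([:0, 0, 1:] * (P - pderiv P)) x) (at x)"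
proof -
  consider "x < 0" | "x = 0" | "x > 0" by linarith
  then show ?thesis
  proof cases
    case 1
    have "((\<lambda>_. 0) has_real_derivative 0) (at x)" by simp
    then have "(flat_poly P has_real_derivative 0) (at x)"
      by (rule has_field_derivative_transform_within_open[of _ _ _ "{..<0}"])
        (use 1 in \<open>auto simp: flat_poly_def\<close>)
    with 1 show ?thesis by (simp add: flat_poly_def)
  next
    case 2
    have "((\<lambda>y. poly ([:0, 1:] * P) (inverse y) * exp (- inverse y)) \<longlongrightarrow> 0) (at_right 0)"
      using filterlim_compose[OF poly_times_exp_tendsto_0 filterlim_inverse_at_top_right] .
    then have r: "((\<lambda>y. (flat_poly P y - flat_poly P 0) / (y - 0)) \<longlongrightarrow> 0) (at_right 0)"
      by (rule Lim_transform_eventually)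
        (auto simp: eventually_at_filter flat_poly_def field_simps)
    have l: "((\<lambda>y. (flat_poly P y - flat_poly P 0) / (y - 0)) \<longlongrightarrow> 0) (at_left 0)"
      by (rule tendsto_eventually) (auto simp: eventually_at_filter flat_poly_def)
    show ?thesis
      unfolding 2 has_field_derivative_iff using filterlim_split_at_real[OF l r]
      by (simp add: flat_poly_def)
  next
    case 3
    have "((\<lambda>y. poly P (inverse y) * exp (- inverse y)) has_real_derivative
        (poly P (inverse x) * (exp (- inverse x) * (inverse x * inverse x)) +
         poly (pderiv P) (inverse x) * (- (inverse x * inverse x)) * exp (- inverse x))) (at x)"
      using 3 by (auto intro!: derivative_eq_intros)
    then have "(flat_poly P has_real_derivative
        (poly P (inverse x) * (exp (- inverse x) * (inverse x * inverse x)) +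
         poly (pderiv P) (inverse x) * (- (inverse x * inverse x)) * exp (- inverse x))) (at x)"
      by (rule has_field_derivative_transform_within_open[of _ _ _ "{0<..}"])
        (use 3 in \<open>auto simp: flat_poly_def\<close>)
    then show ?thesis
      by (rule back_subst[where P = "\<lambda>D. (flat_poly P has_real_derivative D) (at x)"])
        (use 3 in \<open>simp add: flat_poly_def algebra_simps\<close>)
  qed
qed

lemma smooth_flat: "smooth (\<lambda>x. complex_of_real (flat x))"
proof -
  \<comment> \<open>The n-th derivative of \<open>flat\<close>: its polynomial arises from 1 by n
    applications of the map in \<open>flat_poly_has_derivative\<close>.\<close>
  define F where "F n x = complex_of_real (flat_poly (((\<lambda>P. [:0, 0, 1:] * (P - pderiv P)) ^^ n) 1) x)"
    for n x
  have "(F n has_vector_derivative F (Suc n) x) (at x)" for n x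
  proof -
    note bounded_linear.has_vector_derivative[OF bounded_linear_of_real[where 'a = complex]
      flat_poly_has_derivative[of "((\<lambda>P. [:0, 0, 1:] * (P - pderiv P)) ^^ n) 1" x,
        unfolded has_real_derivative_iff_has_vector_derivative]]
    then show ?thesis
      by (simp add: F_def[abs_def])
  qed
  from smooth_derivative_sequence(1)[where F = F, OF this] have "smooth (F 0)" .
  also have "F 0 = (\<lambda>x. complex_of_real (flat x))"
    by (auto simp: F_def flat_def flat_poly_def)
  finally show ?thesis .
qed

lemma flat_nonneg: "0 \<le> flat x"
  and flat_le_1: "flat x \<le> 1"
  and flat_eq_0: "x \<le> 0 \<Longrightarrow> flat x = 0"
  and flat_pos: "x > 0 \<Longrightarrow> flat x > 0"
  by (auto simp: flat_def)

text \<open>The factor \<open>c\<close> steepens both edges: as c tends to infinity the bumps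
  converge pointwise to the indicator of the open interval, without ever exceeding it.\<close>

definition bump :: "real \<Rightarrow> real \<Rightarrow> real \<Rightarrow> real \<Rightarrow> real" where
  "bump c a b x = flat (c * (x - a)) * flat (c * (b - x))"

lemma bump_nonneg: "0 \<le> bump c a b x"
  and bump_le_1: "bump c a b x \<le> 1"
  by (auto simp: bump_def flat_nonneg flat_le_1 mult_le_one)

lemma bump_eq_0: "c > 0 \<Longrightarrow> x \<notin> {a<..<b} \<Longrightarrow> bump c a b x = 0"
  by (auto simp: bump_def flat_eq_0 mult_le_0_iff not_less)

lemma bump_pos: "c > 0 \<Longrightarrow> x \<in> {a<..<b} \<Longrightarrow> bump c a b x > 0"
  by (auto simp: bump_def flat_pos)

lemma smooth_bump: "smooth (\<lambda>x. complex_of_real (bump c a b x))"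
proof -
  have "smooth (\<lambda>x. complex_of_real (flat (c * x + (- c * a))))"
    "smooth (\<lambda>x. complex_of_real (flat (- c * x + c * b)))"
    using smooth_affine[OF smooth_flat bounded_linear_mult_right] by blast+
  from smooth_mult[OF this] show ?thesis
    by (simp add: bump_def algebra_simps)
qed

lemma bump_tendsto_indicator: "(\<lambda>n. bump (Suc n) a b x) \<longlonglongrightarrow> indicator {a<..<b} x"
proof -
  have flat: "(\<lambda>n. flat (real (Suc n) * y)) \<longlonglongrightarrow> 1" if "y > 0" for y :: real
  proof -
    have "(\<lambda>n. exp (- (inverse (real (Suc n)) * inverse y))) \<longlonglongrightarrow> exp (- (0 * inverse y))"
      by (intro tendsto_intros LIMSEQ_inverse_real_of_nat)
    then show ?thesis
      using that by (simp add: flat_def inverse_mult_distrib del: of_nat_Suc)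
  qed
  show ?thesis
  proof (cases "x \<in> {a<..<b}")
    case True
    then have "(\<lambda>n. bump (Suc n) a b x) \<longlonglongrightarrow> 1 * 1"
      unfolding bump_def by (intro tendsto_mult flat) auto
    with True show ?thesis by simp
  next
    case False
    then show ?thesis by (simp add: bump_eq_0)
  qed
qed

section \<open>Test functions and Schwartz functions\<close>

lemma test_functionsD:
  assumes "\<phi> \<in> test_functions U"
  shows "smooth \<phi>" "\<exists>K. compact K \<and> K \<subseteq> U \<and> (\<forall>x. x \<notin> K \<longrightarrow> \<phi> x = 0)"
  using assms by (auto simp: test_functions_def)

lemma test_functions_mult:
  "\<phi> \<in> test_functions U \<Longrightarrow> smooth f \<Longrightarrow> (\<lambda>x. f x * \<phi> x) \<in> test_functions U"
  by (simp add: test_functions_def smooth_mult) (metis mult_zero_right)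

lemma test_functions_add:
  assumes "\<phi> \<in> test_functions U" "\<psi> \<in> test_functions U"
  shows "(\<lambda>x. \<phi> x + \<psi> x) \<in> test_functions U"
proof -
  obtain K L where "compact K" "K \<subseteq> U" "\<And>x. x \<notin> K \<Longrightarrow> \<phi> x = 0"
    "compact L" "L \<subseteq> U" "\<And>x. x \<notin> L \<Longrightarrow> \<psi> x = 0"
    using assms[THEN test_functionsD(2)] by blast
  then show ?thesis
    unfolding test_functions_def using assms[THEN test_functionsD(1)]
    by (auto intro!: smooth_add exI[of _ "K \<union> L"] compact_Un) (metis add.right_neutral)
qed

lemma test_functions_dir_deriv:
  assumes "\<phi> \<in> test_functions U"
  shows "dir_deriv v \<phi> \<in> test_functions U"
proof -
  obtain K where K: "compact K" "K \<subseteq> U" "\<And>x. x \<notin> K \<Longrightarrow> \<phi> x = 0"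
    using test_functionsD(2)[OF assms] by blast
  have "dir_deriv v \<phi> x = 0" if "x \<notin> K" for x
  proof -
    have "((\<lambda>_. 0::complex) has_derivative (\<lambda>_. 0)) (at x)" by simp
    then have "(\<phi> has_derivative (\<lambda>_. 0)) (at x)"
      by (rule has_derivative_transform_within_open[of _ _ _ _ "- K"])
        (use that K compact_imp_closed in auto)
    from dir_deriv_eq[OF this] show ?thesis .
  qed
  then show ?thesis
    unfolding test_functions_def using assms[THEN test_functionsD(1)] K(1,2)
    by (auto simp: smooth_dir_deriv)
qed

lemma test_functions_dir_deriv_funpow:
  "\<phi> \<in> test_functions U \<Longrightarrow> (dir_deriv v ^^ n) \<phi> \<in> test_functions U"
  by (induction n) (auto simp: test_functions_dir_deriv)

lemma test_functions_bounded:
  assumes "\<phi> \<in> test_functions U"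
  obtains C where "C \<ge> 0" "\<And>x. norm (\<phi> x) \<le> C"
proof -
  obtain K where K: "compact K" "\<And>x. x \<notin> K \<Longrightarrow> \<phi> x = 0"
    using test_functionsD(2)[OF assms] by blast
  have "compact (\<phi> ` K)"
    using K(1) assms by (intro compact_continuous_image smooth_continuous test_functionsD)
  then obtain C where "\<And>x. x \<in> K \<Longrightarrow> norm (\<phi> x) \<le> C"
    using compact_imp_bounded bounded_iff by (metis image_eqI)
  with K have "norm (\<phi> x) \<le> max C 0" for x
    by (cases "x \<in> K") (auto simp: le_max_iff_disj)
  then show ?thesis using that[of "max C 0"] by simp
qed

lemma test_functions_support:
  assumes "\<phi> \<in> test_functions U"
  obtains M where "M > 0" "\<And>x. norm x > M \<Longrightarrow> \<phi> x = 0"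
proof -
  obtain K where K: "compact K" "\<And>x. x \<notin> K \<Longrightarrow> \<phi> x = 0"
    using test_functionsD(2)[OF assms] by blast
  from K(1) obtain M where "M > 0" "\<And>x. x \<in> K \<Longrightarrow> norm x \<le> M"
    by (meson bounded_pos compact_imp_bounded)
  with K that show ?thesis by (meson not_le)
qed

lemma test_functions_integrable:
  assumes "\<phi> \<in> test_functions U"
  shows "integrable lborel \<phi>"
proof -
  obtain K where K: "compact K" "\<And>x. x \<notin> K \<Longrightarrow> \<phi> x = 0"
    using test_functionsD(2)[OF assms] by blast
  have "integrable lborel (\<lambda>x. indicator K x *\<^sub>R \<phi> x)"
    using assms K by (intro borel_integrable_compact smooth_continuous test_functionsD)
  also have "(\<lambda>x. indicator K x *\<^sub>R \<phi> x) = \<phi>"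
    using K(2) by (auto simp: indicator_def)
  finally show ?thesis .
qed

lemma bump_test_function:
  assumes "{a..b} \<subseteq> U" "c > 0"
  shows "(\<lambda>x. complex_of_real (bump c a b x)) \<in> test_functions U"
  unfolding test_functions_def using assms
  by (auto intro!: smooth_bump exI[of _ "{a..b}"] simp: bump_eq_0)

lemma smooth_of_real_power: "smooth (\<lambda>x. complex_of_real x ^ n)"
  by (induction n) (auto intro: smooth_const smooth_mult[OF smooth_of_real])

section \<open>Schwartz functions: seminorm bounds and closure properties\<close>

lemma schwartzI:
  assumes "smooth \<phi>" "\<And>j m. \<exists>C. \<forall>x. \<bar>x\<bar> ^ j * cmod (Dn m \<phi> x) \<le> C"
  shows "\<phi> \<in> schwartz"
  using assms unfolding schwartz_def bounded_iff by (simp add: norm_mult norm_power)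

lemma schwartz_smooth: "\<phi> \<in> schwartz \<Longrightarrow> smooth \<phi>"
  by (simp add: schwartz_def)

lemma schwartz_bound:
  assumes "\<phi> \<in> schwartz" "j \<le> N" "m \<le> N"
  shows "\<bar>x\<bar> ^ j * cmod (Dn m \<phi> x) \<le> schwartz_seminorm N \<phi>"
proof -
  define h where "h j m x = norm (complex_of_real x ^ j * Dn m \<phi> x)" for j m x
  \<comment> \<open>A supremum of reals bounds its family only if the family is bounded above; this
    is where membership in \<open>schwartz\<close> enters.\<close>
  have bdd: "bdd_above (range (h j m))" for j m
    using assms(1) unfolding schwartz_def h_def bdd_above_norm[symmetric]
    by (auto simp: image_image)
  have le: "h j m x \<le> (SUP x. h j m x)" for j m x
    using bdd by (intro cSUP_upper) auto
  have nn: "0 \<le> (SUP x. h j m x)" for j m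
    using order_trans[OF _ le[of j m 0]] by (simp add: h_def)
  have "h j m x \<le> (SUP x. h j m x)" by (rule le)
  also have "\<dots> \<le> (\<Sum>m\<le>N. SUP x. h j m x)"
    using assms(3) nn by (intro member_le_sum) auto
  also have "\<dots> \<le> (\<Sum>j\<le>N. \<Sum>m\<le>N. SUP x. h j m x)"
    using assms(2) nn by (intro member_le_sum[of j _ "\<lambda>j. \<Sum>m\<le>N. SUP x. h j m x"] sum_nonneg) auto
  finally show ?thesis
    by (simp add: schwartz_seminorm_def h_def norm_mult norm_power)
qed

lemma schwartz_seminorm_nonneg: "\<phi> \<in> schwartz \<Longrightarrow> 0 \<le> schwartz_seminorm N \<phi>"
  using schwartz_bound[of \<phi> 0 N 0 0] norm_ge_zero[of "\<phi> 0"]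
  by (simp del: norm_ge_zero)

text \<open>The sum of the bounds for the powers j and j + 2. The factor 1 + x^2 turns seminorm
  bounds into integrable majorants.\<close>

lemma schwartz_bound_inverse_square:
  assumes "\<phi> \<in> schwartz" "j + 2 \<le> N" "m \<le> N"
  shows "(1 + x\<^sup>2) * (\<bar>x\<bar> ^ j * cmod (Dn m \<phi> x)) \<le> 2 * schwartz_seminorm N \<phi>"
  using schwartz_bound[OF assms(1), of j N m x] schwartz_bound[OF assms(1), of "j + 2" N m x] assms
  by (simp add: algebra_simps power_add power2_eq_square flip: abs_mult)

lemma test_functions_schwartz:
  assumes "\<phi> \<in> test_functions U"
  shows "\<phi> \<in> schwartz"
proof (rule schwartzI)
  show "smooth \<phi>" using assms by (rule test_functionsD)
  show "\<exists>C. \<forall>x. \<bar>x\<bar> ^ j * cmod (Dn m \<phi> x) \<le> C" for j m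
  proof -
    have "(\<lambda>x. complex_of_real x ^ j * Dn m \<phi> x) \<in> test_functions U"
      by (intro test_functions_mult test_functions_dir_deriv_funpow assms smooth_of_real_power)
    from test_functions_bounded[OF this] show ?thesis
      by (metis norm_mult norm_of_real norm_power)
  qed
qed

lemma schwartz_dir_deriv:
  assumes "\<phi> \<in> schwartz"
  shows "dir_deriv 1 \<phi> \<in> schwartz"
proof (rule schwartzI)
  show "\<exists>C. \<forall>x. \<bar>x\<bar> ^ j * cmod (Dn m (dir_deriv 1 \<phi>) x) \<le> C" for j m
    using schwartz_bound[OF assms, of j "j + Suc m" "Suc m"]
    unfolding Dn_Suc' by auto
qed (simp add: assms schwartz_smooth smooth_dir_deriv)

lemma schwartz_Dn: "\<phi> \<in> schwartz \<Longrightarrow> Dn m \<phi> \<in> schwartz"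
  by (induction m) (auto simp: schwartz_dir_deriv)

lemma schwartz_cmult:
  assumes "\<phi> \<in> schwartz"
  shows "(\<lambda>x. c * \<phi> x) \<in> schwartz"
proof (rule schwartzI)
  show "smooth (\<lambda>x. c * \<phi> x)"
    by (intro smooth_mult smooth_const schwartz_smooth assms)
  show "\<exists>C. \<forall>x. \<bar>x\<bar> ^ j * cmod (Dn m (\<lambda>x. c * \<phi> x) x) \<le> C" for j m
  proof (intro exI allI)
    fix x
    have "\<bar>x\<bar> ^ j * cmod (Dn m (\<lambda>x. c * \<phi> x) x) = cmod c * (\<bar>x\<bar> ^ j * cmod (Dn m \<phi> x))"
      using assms by (simp add: Dn_cmult schwartz_smooth norm_mult)
    also have "\<dots> \<le> cmod c * schwartz_seminorm (j + m) \<phi>"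
      using schwartz_bound[OF assms] by (intro mult_left_mono) auto
    finally show "\<bar>x\<bar> ^ j * cmod (Dn m (\<lambda>x. c * \<phi> x) x) \<le> cmod c * schwartz_seminorm (j + m) \<phi>" .
  qed
qed

lemma schwartz_add:
  assumes "\<phi> \<in> schwartz" "\<psi> \<in> schwartz"
  shows "(\<lambda>x. \<phi> x + \<psi> x) \<in> schwartz"
proof (rule schwartzI)
  show "smooth (\<lambda>x. \<phi> x + \<psi> x)"
    by (intro smooth_add schwartz_smooth assms)
  show "\<exists>C. \<forall>x. \<bar>x\<bar> ^ j * cmod (Dn m (\<lambda>x. \<phi> x + \<psi> x) x) \<le> C" for j m
  proof (intro exI allI)
    fix x
    have "\<bar>x\<bar> ^ j * cmod (Dn m (\<lambda>x. \<phi> x + \<psi> x) x) \<le> \<bar>x\<bar> ^ j * (cmod (Dn m \<phi> x) + cmod (Dn m \<psi> x))"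
      using assms by (intro mult_left_mono) (auto simp: Dn_add schwartz_smooth norm_triangle_ineq)
    also have "\<dots> \<le> schwartz_seminorm (j + m) \<phi> + schwartz_seminorm (j + m) \<psi>"
      using schwartz_bound[OF assms(1), of j "j + m" m x] schwartz_bound[OF assms(2), of j "j + m" m x]
      by (simp add: algebra_simps)
    finally show "\<bar>x\<bar> ^ j * cmod (Dn m (\<lambda>x. \<phi> x + \<psi> x) x)
      \<le> schwartz_seminorm (j + m) \<phi> + schwartz_seminorm (j + m) \<psi>" .
  qed
qed

text \<open>Leibniz' rule with a linear factor, so only two terms survive. For m = 0 the truncated
  index m - 1 is harmless because its coefficient is 0.\<close>

lemma Dn_times_of_real:
  assumes "smooth \<phi>"
  shows "Dn m (\<lambda>x. of_real x * \<phi> x) = (\<lambda>x. of_real x * Dn m \<phi> x + of_nat m * Dn (m - 1) \<phi> x)"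
proof -
  define F where "F n x = of_real x * Dn n \<phi> x + of_nat n * Dn (n - 1) \<phi> x" for n x
  have "(F n has_vector_derivative F (Suc n) x) (at x)" for n x
  proof -
    have "((\<lambda>x. complex_of_real x * Dn n \<phi> x) has_vector_derivative
        (of_real x * Dn (Suc n) \<phi> x + 1 * Dn n \<phi> x)) (at x)"
      using has_vector_derivative_mult[OF
        bounded_linear.has_vector_derivative[OF bounded_linear_of_real has_vector_derivative_id]
        Dn_has_vector_derivative[OF assms]]
      by simp
    moreover have "((\<lambda>x. of_nat n * Dn (n - 1) \<phi> x) has_vector_derivative of_nat n * Dn n \<phi> x) (at x)"
      using has_vector_derivative_mult_right[OF Dn_has_vector_derivative[OF assms, of "n - 1"]]
      by (cases n) auto
    ultimately show ?thesis
      unfolding F_def by (auto dest: has_vector_derivative_add simp: algebra_simps)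
  qed
  from smooth_derivative_sequence(2)[where F = F, OF this, of m 0] show ?thesis
    by (simp add: F_def[abs_def])
qed

lemma schwartz_times_of_real:
  assumes "\<phi> \<in> schwartz"
  shows "(\<lambda>x. of_real x * \<phi> x) \<in> schwartz"
proof (rule schwartzI)
  show "smooth (\<lambda>x. of_real x * \<phi> x)"
    by (intro smooth_mult smooth_of_real schwartz_smooth assms)
  show "\<exists>C. \<forall>x. \<bar>x\<bar> ^ j * cmod (Dn m (\<lambda>x. of_real x * \<phi> x) x) \<le> C" for j m
  proof (intro exI allI)
    fix x
    have "\<bar>x\<bar> ^ j * cmod (Dn m (\<lambda>x. of_real x * \<phi> x) x)
      \<le> \<bar>x\<bar> ^ j * (\<bar>x\<bar> * cmod (Dn m \<phi> x) + m * cmod (Dn (m - 1) \<phi> x))"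
      unfolding Dn_times_of_real[OF schwartz_smooth[OF assms]]
      by (intro mult_left_mono norm_triangle_le) (auto simp: norm_mult)
    also have "\<dots> \<le> schwartz_seminorm (Suc j + m) \<phi> + m * schwartz_seminorm (Suc j + m) \<phi>"
      using schwartz_bound[OF assms, of "Suc j" "Suc j + m" m x]
        mult_left_mono[OF schwartz_bound[OF assms, of j "Suc j + m" "m - 1" x], of m] le_SucI[OF diff_le_self]
      by (simp add: algebra_simps diff_le_self le_SucI trans_le_add2)
    finally show "\<bar>x\<bar> ^ j * cmod (Dn m (\<lambda>x. of_real x * \<phi> x) x)
      \<le> schwartz_seminorm (Suc j + m) \<phi> + m * schwartz_seminorm (Suc j + m) \<phi>" .
  qed
qed

lemma schwartz_times_power:
  "\<phi> \<in> schwartz \<Longrightarrow> (\<lambda>x. of_real x ^ n * \<phi> x) \<in> schwartz"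
proof (induction n)
  case (Suc n)
  then show ?case
    using schwartz_times_of_real[of "\<lambda>x. of_real x ^ n * \<phi> x"] by (simp add: mult.assoc)
qed simp

section \<open>Integration on the line\<close>

lemma iexp_add: "iexp (a + b) = iexp a * iexp b"
  by (simp add: exp_add distrib_left)

lemma iexp_has_vector_derivative:
  "((\<lambda>x. iexp (- x * k)) has_vector_derivative - (\<i> * of_real k) * iexp (- x * k)) (at x)"
proof -
  have "((\<lambda>z. exp (- (\<i> * of_real k) * z)) has_field_derivative
      - (\<i> * of_real k) * exp (- (\<i> * of_real k) * of_real x)) (at (of_real x))"
    by (auto intro!: derivative_eq_intros)
  from has_vector_derivative_real_field[OF this] show ?thesis
    by (simp add: mult.assoc mult.left_commute mult.commute)
qed

lemma norm_iexp: "cmod (iexp a) = 1"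
  by (rule norm_exp_i_times)

lemma
  shows integrable_inverse_1_plus_square_UNIV: "integrable lborel (\<lambda>x::real. C / (1 + x\<^sup>2))"
    and integral_inverse_1_plus_square_UNIV: "(LBINT x. C / (1 + x\<^sup>2)) = C * pi"
proof -
  have "integrable lborel (\<lambda>x::real. inverse (1 + x\<^sup>2))"
    using integrable_inverse_1_plus_square by (simp add: set_integrable_def)
  then show "integrable lborel (\<lambda>x::real. C / (1 + x\<^sup>2))"
    unfolding divide_inverse by (rule integrable_mult_right)
  have "(LBINT x::real. inverse (1 + x\<^sup>2)) = pi"
    using LBINT_inverse_1_plus_square
    by (simp add: interval_lebesgue_integral_def set_lebesgue_integral_def)
  then show "(LBINT x. C / (1 + x\<^sup>2)) = C * pi"
    unfolding divide_inverse by simp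
qed

lemma
  fixes f :: "real \<Rightarrow> 'a::{banach, second_countable_topology}"
  assumes [measurable]: "f \<in> borel_measurable lborel" and bound: "\<And>x. (1 + x\<^sup>2) * norm (f x) \<le> C"
  shows integrable_of_square_decay: "integrable lborel f"
    and integral_norm_of_square_decay: "(LBINT x. norm (f x)) \<le> C * pi"
proof -
  have le: "norm (f x) \<le> C / (1 + x\<^sup>2)" for x
    using bound[of x] by (simp add: field_simps add_pos_nonneg)
  show i: "integrable lborel f"
    by (rule Bochner_Integration.integrable_bound[OF integrable_inverse_1_plus_square_UNIV[of C]])
      (use order_trans[OF le abs_ge_self] in \<open>simp_all add: abs_divide\<close>)
  show "(LBINT x. norm (f x)) \<le> C * pi"
    unfolding integral_inverse_1_plus_square_UNIV[symmetric]
    using i le by (intro integral_mono integrable_inverse_1_plus_square_UNIV) auto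
qed

text \<open>A majorant that factorises reduces the condition for interchanging two integrals to two
  one-dimensional integrals. Most uses of Fubini's theorem below have this form.\<close>

lemma
  fixes f :: "real \<Rightarrow> real \<Rightarrow> 'a::{banach, second_countable_topology}"
  assumes [measurable]: "case_prod f \<in> borel_measurable (lborel \<Otimes>\<^sub>M lborel)"
    and u: "integrable lborel u" and v: "integrable lborel v"
    and bound: "\<And>x y. norm (f x y) \<le> u x * v y"
  shows integrable_pair_of_product_bound: "integrable (lborel \<Otimes>\<^sub>M lborel) (case_prod f)"
    and Fubini_of_product_bound: "(LBINT y. LBINT x. f x y) = (LBINT x. LBINT y. f x y)"
proof -
  have [measurable]: "u \<in> borel_measurable lborel" "v \<in> borel_measurable lborel"
    using u v by auto
  \<comment> \<open>Only the product of \<open>u\<close> and \<open>v\<close> is known to be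
    nonnegative, hence the absolute values.\<close>
  have bound': "norm (f x y) \<le> \<bar>u x\<bar> * \<bar>v y\<bar>" for x y
    using bound[of x y] by (simp add: order_trans[OF _ abs_ge_self] flip: abs_mult)
  have i: "integrable lborel (\<lambda>y. f x y)" for x
    by (rule Bochner_Integration.integrable_bound[of _ "\<lambda>y. u x * v y"]) (use v bound' in \<open>auto simp: abs_mult\<close>)
  show "integrable (lborel \<Otimes>\<^sub>M lborel) (case_prod f)"
  proof (rule lborel_pair.Fubini_integrable)
    show "integrable lborel (\<lambda>x. LBINT y. norm (case (x, y) of (x, y) \<Rightarrow> f x y))"
    proof (rule Bochner_Integration.integrable_bound[of _ "\<lambda>x. u x * (LBINT y. \<bar>v y\<bar>)"])
      show "AE x in lborel. norm (LBINT y. norm (case (x, y) of (x, y) \<Rightarrow> f x y))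
          \<le> norm (u x * (LBINT y. \<bar>v y\<bar>))"
      proof (rule AE_I2)
        fix x
        have "(LBINT y. norm (f x y)) \<le> (LBINT y. \<bar>u x\<bar> * \<bar>v y\<bar>)"
          using i v bound' by (intro integral_mono) auto
        then show "norm (LBINT y. norm (case (x, y) of (x, y) \<Rightarrow> f x y))
          \<le> norm (u x * (LBINT y. \<bar>v y\<bar>))"
          by (simp add: abs_mult)
      qed
    qed (use u in auto)
  qed (use i in auto)
  then show "(LBINT y. LBINT x. f x y) = (LBINT x. LBINT y. f x y)"
    by (rule lborel_pair.Fubini_integral)
qed

text \<open>Integration by parts without boundary terms: the decay of \<open>F\<close> kills both
  ends, and that of \<open>F'\<close> makes the fundamental theorem available on the whole
  line.\<close>

lemma integral_derivative_eq_0: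
  fixes F F' :: "real \<Rightarrow> complex"
  assumes F: "\<And>x. (F has_vector_derivative F' x) (at x)"
    and cont: "continuous_on UNIV F'"
    and bF: "\<And>x. (1 + x\<^sup>2) * cmod (F x) \<le> C" and bF': "\<And>x. (1 + x\<^sup>2) * cmod (F' x) \<le> C'"
  shows "(LBINT x. F' x) = 0"
proof -
  have le: "cmod (F x) \<le> C / (1 + x\<^sup>2)" for x
    using bF[of x] by (simp add: field_simps add_pos_nonneg)
  have lim: "(F \<longlongrightarrow> 0) at_top" "(F \<longlongrightarrow> 0) at_bot"
    by (rule Lim_null_comparison[of _ "\<lambda>x. C / (1 + x\<^sup>2)"]; (simp add: le)?; real_asymp)+
  have "integrable lborel F'"
    by (rule integrable_of_square_decay[of _ C']) (use cont bF' in \<open>auto intro: borel_measurable_continuous_onI\<close>)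
  then have "(LBINT x=-\<infinity>..\<infinity>. F' x) = 0 - 0"
    using F cont lim
    by (intro interval_integral_FTC_integrable[where F = F])
      (auto simp: set_integrable_def ereal_tendsto_simps continuous_on_eq_continuous_at)
  then show ?thesis
    by (simp add: interval_lebesgue_integral_def set_lebesgue_integral_def)
qed

text \<open>The first-order expansion of exp(i q h) has an error of at most (q h)^2 / 2, so the
  second moment of \<open>f\<close> bounds the error of the difference quotient by a multiple of
  |h|.\<close>

lemma oscillatory_integral_has_vector_derivative:
  fixes q :: "real \<Rightarrow> real" and f :: "real \<Rightarrow> complex"
  assumes [measurable]: "q \<in> borel_measurable lborel"
    and f: "integrable lborel f" and f2: "integrable lborel (\<lambda>x. of_real ((q x)\<^sup>2) * f x)"
  shows "((\<lambda>t. LBINT x. iexp (q x * t) * f x) has_vector_derivative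
    (LBINT x. iexp (q x * t) * (\<i> * of_real (q x) * f x))) (at t)"
proof -
  have [measurable]: "f \<in> borel_measurable lborel" using f by auto
  have f1: "integrable lborel (\<lambda>x. \<i> * of_real (q x) * f x)"
  proof (rule Bochner_Integration.integrable_bound[OF Bochner_Integration.integrable_add[OF
        integrable_norm[OF f] integrable_norm[OF f2]]])
    \<comment> \<open>The first moment is finite because it is dominated by the zeroth and the
      second.\<close>
    have "\<bar>a\<bar> \<le> 1 + a\<^sup>2" for a :: real
      using zero_le_power2[of "\<bar>a\<bar> - 1"] zero_le_power2[of a] by (simp add: power2_diff)
    then have "\<bar>q x\<bar> * cmod (f x) \<le> (1 + (q x)\<^sup>2) * cmod (f x)" for x
      by (intro mult_right_mono) auto
    then show "AE x in lborel. norm (\<i> * of_real (q x) * f x) \<le> norm (norm (f x) + norm (of_real ((q x)\<^sup>2) * f x))"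
      by (auto simp: norm_mult norm_power algebra_simps)
  qed simp
  have i: "integrable lborel (\<lambda>x. iexp (r x) * g x)"
    if "r \<in> borel_measurable lborel" "integrable lborel g" for r and g :: "real \<Rightarrow> complex"
    by (rule Bochner_Integration.integrable_bound[OF that(2)]) (use that in \<open>auto simp: norm_mult\<close>)
  have i0: "integrable lborel (\<lambda>x. iexp (q x * s) * f x)" for s
    by (rule i) (use f in measurable)
  have i1: "integrable lborel (\<lambda>x. iexp (q x * t) * (\<i> * of_real (q x) * f x))"
    by (rule i) (use f1 in measurable)
  define I where "I t = (LBINT x. iexp (q x * t) * f x)" for t
  define D where "D = (LBINT x. iexp (q x * t) * (\<i> * of_real (q x) * f x))"
  define C where "C = (LBINT x. cmod (of_real ((q x)\<^sup>2) * f x)) / 2"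
  have bound: "cmod (I (t + h) - I t - h *\<^sub>R D) \<le> C * h\<^sup>2" for h
  proof -
    have 1: "I (t + h) - I t - h *\<^sub>R D =
      (LBINT x. iexp (q x * (t + h)) * f x - iexp (q x * t) * f x
         - h *\<^sub>R (iexp (q x * t) * (\<i> * of_real (q x) * f x)))"
      unfolding I_def D_def
      by (simp only: Bochner_Integration.integral_diff Bochner_Integration.integrable_diff
          integral_scaleR_right integrable_scaleR_right i0 i1 simp_thms)
    have 2: "cmod (LBINT x. iexp (q x * (t + h)) * f x - iexp (q x * t) * f x
         - h *\<^sub>R (iexp (q x * t) * (\<i> * of_real (q x) * f x))) \<le> (LBINT x. h\<^sup>2 / 2 * cmod (of_real ((q x)\<^sup>2) * f x))"
    proof (rule order_trans[OF integral_norm_bound integral_mono])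
      fix x
      have "cmod (iexp (q x * h) - (1 + \<i> * of_real (q x * h))) \<le> (q x * h)\<^sup>2 / 2"
        using iexp_approx1[of "q x * h" 1] by (simp add: power2_eq_square)
      moreover have "iexp (q x * (t + h)) * f x - iexp (q x * t) * f x
         - h *\<^sub>R (iexp (q x * t) * (\<i> * of_real (q x) * f x)) =
         iexp (q x * t) * (iexp (q x * h) - (1 + \<i> * of_real (q x * h))) * f x"
        by (simp add: algebra_simps exp_add scaleR_conv_of_real)
      ultimately show "cmod (iexp (q x * (t + h)) * f x - iexp (q x * t) * f x
         - h *\<^sub>R (iexp (q x * t) * (\<i> * of_real (q x) * f x)))
         \<le> h\<^sup>2 / 2 * cmod (of_real ((q x)\<^sup>2) * f x)"
        using mult_right_mono[of _ _ "cmod (f x)"]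
        by (fastforce simp: norm_mult norm_power power_mult_distrib mult_ac)
    next
      show "integrable lborel (\<lambda>x. cmod (iexp (q x * (t + h)) * f x - iexp (q x * t) * f x
         - h *\<^sub>R (iexp (q x * t) * (\<i> * of_real (q x) * f x))))"
        by (intro integrable_norm Bochner_Integration.integrable_diff integrable_scaleR_right i0 i1)
      show "integrable lborel (\<lambda>x. h\<^sup>2 / 2 * cmod (of_real ((q x)\<^sup>2) * f x))"
        by (intro integrable_mult_right integrable_norm f2)
    qed
    have 3: "(LBINT x. h\<^sup>2 / 2 * cmod (of_real ((q x)\<^sup>2) * f x)) = C * h\<^sup>2"
      by (simp add: C_def)
    show ?thesis unfolding 1 3[symmetric] by (rule 2)
  qed
  have "((\<lambda>h. cmod (I (t + h) - I t - h *\<^sub>R D) / \<bar>h\<bar>) \<longlongrightarrow> 0) (at 0)"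
  proof (rule Lim_null_comparison[of _ "\<lambda>h. C * \<bar>h\<bar>"])
    show "\<forall>\<^sub>F h in at 0. norm (cmod (I (t + h) - I t - h *\<^sub>R D) / \<bar>h\<bar>) \<le> C * \<bar>h\<bar>"
      using bound by (auto simp: eventually_at_filter divide_le_eq power2_eq_square mult.assoc)
    show "((\<lambda>h. C * \<bar>h\<bar>) \<longlongrightarrow> 0) (at 0)"
      by (auto intro!: tendsto_eq_intros)
  qed
  then show ?thesis
    unfolding has_vector_derivative_def has_derivative_at
    by (simp add: I_def D_def bounded_linear_scaleR_left)
qed

section \<open>The Fourier transform on Schwartz functions\<close>

lemma fourier_iexp: "fourier \<phi> k = (LBINT x. iexp (- x * k) * \<phi> x)"
  by (simp add: fourier_def mult.commute)

lemma schwartz_measurable: "\<phi> \<in> schwartz \<Longrightarrow> \<phi> \<in> borel_measurable lborel"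
  using smooth_continuous[OF schwartz_smooth, of _ UNIV]
  by (simp add: borel_measurable_continuous_onI)

lemma schwartz_integrable: "\<phi> \<in> schwartz \<Longrightarrow> integrable lborel \<phi>"
  using integrable_of_square_decay[OF schwartz_measurable] schwartz_bound_inverse_square[of \<phi> 0 2 0]
  by auto

lemma cmod_fourier_le: "integrable lborel \<phi> \<Longrightarrow> cmod (fourier \<phi> k) \<le> (LBINT x. cmod (\<phi> x))"
  unfolding fourier_iexp by (rule order_trans[OF integral_norm_bound]) (simp add: norm_mult)

lemma fourier_has_vector_derivative:
  assumes "\<phi> \<in> schwartz"
  shows "(fourier \<phi> has_vector_derivative fourier (\<lambda>x. - \<i> * (of_real x * \<phi> x)) k) (at k)"
proof -
  have "integrable lborel (\<lambda>x. of_real ((- x)\<^sup>2) * \<phi> x)"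
    using schwartz_integrable[OF schwartz_times_power[OF assms, of 2]] by simp
  from oscillatory_integral_has_vector_derivative[OF _ schwartz_integrable[OF assms] this, of k]
  show ?thesis
    by (simp add: fourier_iexp[abs_def] mult.assoc)
qed

text \<open>The transforms of (-i x)^n \<open>\<phi>\<close> form a sequence in which each member is
  the derivative of the one before, so \<open>smooth_derivative_sequence\<close> yields both claims
  at once.\<close>

lemma
  assumes "\<phi> \<in> schwartz"
  shows smooth_fourier: "smooth (fourier \<phi>)"
    and Dn_fourier: "Dn n (fourier \<phi>) = fourier (\<lambda>x. (- \<i>) ^ n * (of_real x ^ n * \<phi> x))"
proof -
  define F where "F n = fourier (\<lambda>x. (- \<i>) ^ n * (of_real x ^ n * \<phi> x))" for n
  have "(F n has_vector_derivative F (Suc n) k) (at k)" for n k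
    using fourier_has_vector_derivative[OF schwartz_cmult[OF schwartz_times_power[OF assms]], of "(-\<i>)^n" n k]
    by (simp add: F_def mult_ac)
  note * = smooth_derivative_sequence[where F = F, OF this]
  have "F 0 = fourier \<phi>" by (simp add: F_def)
  with *(1)[of 0] *(2)[of n 0] show "smooth (fourier \<phi>)"
    "Dn n (fourier \<phi>) = fourier (\<lambda>x. (- \<i>) ^ n * (of_real x ^ n * \<phi> x))"
    by (simp_all add: F_def)
qed

text \<open>Integration by parts: \<open>F'\<close> is the derivative of exp(-i k x)
  \<open>\<phi>\<close>(x), so its integral vanishes.\<close>

lemma fourier_dir_deriv:
  assumes "\<phi> \<in> schwartz"
  shows "fourier (dir_deriv 1 \<phi>) k = \<i> * of_real k * fourier \<phi> k"
proof -
  define F where "F x = iexp (- x * k) * \<phi> x" for x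
  define F' where "F' x = iexp (- x * k) * dir_deriv 1 \<phi> x - \<i> * of_real k * (iexp (- x * k) * \<phi> x)" for x
  have "(LBINT x. F' x) = 0"
  proof (rule integral_derivative_eq_0)
    show "(F has_vector_derivative F' x) (at x)" for x
      unfolding F_def[abs_def] F'_def
      using has_vector_derivative_mult[OF iexp_has_vector_derivative[of k x] smooth_has_vector_derivative[OF schwartz_smooth[OF assms], of x]]
      by (simp add: algebra_simps)
    show "continuous_on UNIV F'"
      unfolding F'_def[abs_def]
      by (intro continuous_intros smooth_continuous smooth_dir_deriv schwartz_smooth assms)
    show "(1 + x\<^sup>2) * cmod (F x) \<le> 2 * schwartz_seminorm 2 \<phi>" for x
      using schwartz_bound_inverse_square[OF assms, of 0 2 0] by (simp add: F_def norm_mult)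
    have "cmod (F' x) \<le> cmod (dir_deriv 1 \<phi> x) + \<bar>k\<bar> * cmod (\<phi> x)" for x
      unfolding F'_def by (rule order_trans[OF norm_triangle_ineq4]) (simp add: norm_mult)
    then have *: "(1 + x\<^sup>2) * cmod (F' x) \<le> (1 + x\<^sup>2) * (cmod (dir_deriv 1 \<phi> x) + \<bar>k\<bar> * cmod (\<phi> x))" for x
      by (intro mult_left_mono) auto
    show "(1 + x\<^sup>2) * cmod (F' x) \<le> 2 * schwartz_seminorm 2 \<phi> + \<bar>k\<bar> * (2 * schwartz_seminorm 2 \<phi>)" for x
      using schwartz_bound_inverse_square[OF assms, of 0 2 1 x]
        mult_left_mono[OF schwartz_bound_inverse_square[OF assms, of 0 2 0 x], of "\<bar>k\<bar>"]
      by (intro order_trans[OF *]) (simp add: algebra_simps)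
  qed
  moreover have i: "integrable lborel (\<lambda>x. iexp (- x * k) * g x)" if "g \<in> schwartz" for g
    by (rule Bochner_Integration.integrable_bound[OF schwartz_integrable[OF that]])
      (use schwartz_measurable[OF that] in \<open>auto simp: norm_mult\<close>)
  ultimately show ?thesis
    using i[OF assms] i[OF schwartz_dir_deriv[OF assms]] unfolding F'_def fourier_iexp by simp
qed

lemma fourier_Dn:
  assumes "\<phi> \<in> schwartz"
  shows "fourier (Dn n \<phi>) k = (\<i> * of_real k) ^ n * fourier \<phi> k"
  using assms by (induction n) (simp_all add: fourier_dir_deriv schwartz_Dn)

lemma fourier_power_bound:
  assumes "\<phi> \<in> schwartz"
  shows "\<bar>k\<bar> ^ n * cmod (fourier \<phi> k) \<le> (LBINT x. cmod (Dn n \<phi> x))"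
proof -
  have "\<bar>k\<bar> ^ n * cmod (fourier \<phi> k) = cmod (fourier (Dn n \<phi>) k)"
    using assms by (simp add: fourier_Dn norm_mult norm_power)
  also have "\<dots> \<le> (LBINT x. cmod (Dn n \<phi> x))"
    by (intro cmod_fourier_le schwartz_integrable schwartz_Dn assms)
  finally show ?thesis .
qed

lemma power_1_plus_square_le: "(1 + (x::real)\<^sup>2) ^ n \<le> 2 ^ n * (1 + \<bar>x\<bar> ^ (2 * n))"
proof -
  have "(1 + x\<^sup>2) ^ n \<le> (2 * max 1 (x\<^sup>2)) ^ n"
    by (intro power_mono) auto
  also have "\<dots> = 2 ^ n * max 1 (x\<^sup>2) ^ n" by (rule power_mult_distrib)
  also have "max 1 (x\<^sup>2) ^ n \<le> 1 + \<bar>x\<bar> ^ (2 * n)"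
    by (cases "x\<^sup>2 \<le> 1") (auto simp: max_def power_mult)
  finally show ?thesis by simp
qed

lemma fourier_decay:
  assumes "\<phi> \<in> schwartz"
  shows "(1 + k\<^sup>2) ^ n * cmod (fourier \<phi> k)
    \<le> 2 ^ n * ((LBINT x. cmod (\<phi> x)) + (LBINT x. cmod (Dn (2 * n) \<phi> x)))"
proof -
  have "(1 + k\<^sup>2) ^ n * cmod (fourier \<phi> k) \<le> 2 ^ n * (1 + \<bar>k\<bar> ^ (2 * n)) * cmod (fourier \<phi> k)"
    by (intro mult_right_mono power_1_plus_square_le) auto
  also have "\<dots> = 2 ^ n * (\<bar>k\<bar> ^ 0 * cmod (fourier \<phi> k) + \<bar>k\<bar> ^ (2 * n) * cmod (fourier \<phi> k))"
    by (simp add: algebra_simps)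
  also have "\<dots> \<le> 2 ^ n * ((LBINT x. cmod (Dn 0 \<phi> x)) + (LBINT x. cmod (Dn (2 * n) \<phi> x)))"
    by (intro mult_left_mono add_mono fourier_power_bound assms) auto
  finally show ?thesis by simp
qed

text \<open>2n derivatives produce the power of k, and two more powers of x make them integrable,
  whence the index 2n + 2. Each of the two L^1 norms contributes 2 pi times the seminorm.\<close>

lemma fourier_decay_seminorm:
  assumes "\<phi> \<in> schwartz"
  shows "(1 + k\<^sup>2) ^ n * cmod (fourier \<phi> k) \<le> 2 ^ n * 4 * pi * schwartz_seminorm (2 * n + 2) \<phi>"
proof -
  have *: "(LBINT x. cmod (Dn m \<phi> x)) \<le> 2 * schwartz_seminorm (2 * n + 2) \<phi> * pi" if "m \<le> 2 * n" for m
  proof (rule integral_norm_of_square_decay)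
    show "Dn m \<phi> \<in> borel_measurable lborel"
      by (intro schwartz_measurable schwartz_Dn assms)
    show "(1 + x\<^sup>2) * cmod (Dn m \<phi> x) \<le> 2 * schwartz_seminorm (2 * n + 2) \<phi>" for x
      using schwartz_bound_inverse_square[OF assms, of 0 "2 * n + 2" m x] that by simp
  qed
  note fourier_decay[OF assms, of k n]
  also have "2 ^ n * ((LBINT x. cmod (\<phi> x)) + (LBINT x. cmod (Dn (2 * n) \<phi> x))) \<le>
    2 ^ n * (2 * schwartz_seminorm (2 * n + 2) \<phi> * pi + 2 * schwartz_seminorm (2 * n + 2) \<phi> * pi)"
    using *[of 0] *[of "2 * n"] by (intro mult_left_mono add_mono) auto
  finally show ?thesis by (simp add: algebra_simps)
qed

lemma fourier_schwartz:
  assumes "\<phi> \<in> schwartz"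
  shows "fourier \<phi> \<in> schwartz"
proof (rule schwartzI)
  show "\<exists>C. \<forall>k. \<bar>k\<bar> ^ j * cmod (Dn m (fourier \<phi>) k) \<le> C" for j m
    unfolding Dn_fourier[OF assms]
    using fourier_power_bound[OF schwartz_cmult[OF schwartz_times_power[OF assms]]] by blast
qed (rule smooth_fourier[OF assms])

section \<open>Fourier inversion by Gaussian regularisation\<close>

lemma fourier_gaussian:
  assumes "e > 0"
  shows "(LBINT k. iexp (k * w) * of_real (exp (- (e * k)\<^sup>2 / 2)))
    = of_real (sqrt (2 * pi) / e * exp (- (w / e)\<^sup>2 / 2))"
proof -
  have "of_real (exp (- (w / e)\<^sup>2 / 2)) = char std_normal_distribution (w / e)"
    by (simp add: char_std_normal_distribution)
  also have "\<dots> = (LBINT x. std_normal_density x *\<^sub>R iexp (w / e * x))"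
    unfolding char_def by (subst integral_density) auto
  also have "\<dots> = e *\<^sub>R (LBINT k. std_normal_density (e * k) *\<^sub>R iexp (w / e * (e * k)))"
    using assms by (subst lborel_integral_real_affine[where c = e and t = 0]) auto
  also have "(LBINT k. std_normal_density (e * k) *\<^sub>R iexp (w / e * (e * k)))
    = (LBINT k. of_real (1 / sqrt (2 * pi)) * (iexp (k * w) * of_real (exp (- (e * k)\<^sup>2 / 2))))"
    using assms
    by (intro Bochner_Integration.integral_cong)
      (auto simp: std_normal_density_def scaleR_conv_of_real mult_ac)
  also have "\<dots> = of_real (1 / sqrt (2 * pi)) * (LBINT k. iexp (k * w) * of_real (exp (- (e * k)\<^sup>2 / 2)))"
    by simp
  finally show ?thesis
    using assms by (simp add: scaleR_conv_of_real field_simps)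
qed

lemma integrable_gaussian:
  assumes "e \<noteq> 0"
  shows "integrable lborel (\<lambda>k::real. exp (- (e * k)\<^sup>2 / 2))"
proof -
  have "integrable lborel (\<lambda>x. sqrt (2 * pi) * std_normal_density x)" by simp
  also have "(\<lambda>x. sqrt (2 * pi) * std_normal_density x) = (\<lambda>x. exp (- x\<^sup>2 / 2))"
    by (simp add: std_normal_density_def)
  finally show ?thesis
    using lborel_integrable_real_affine[of "\<lambda>x. exp (- x\<^sup>2 / 2)" e 0] assms by simp
qed

text \<open>A Gaussian factor exp(-(e k)^2 / 2) makes the double integral absolutely convergent.
  After Fubini the inner integral is a Gaussian in (x - y) / e, and the substitution y = x + e z
  turns the result into a Gaussian average of \<open>\<phi>\<close> around x. Both ways of writing
  \<open>A n\<close> converge as e tends to 0, and their limits are the two sides.\<close>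

lemma fourier_inversion:
  assumes \<phi>: "\<phi> \<in> schwartz"
  shows "(LBINT k. iexp (k * x) * fourier \<phi> k) = 2 * of_real pi * \<phi> x"
proof -
  have [measurable]: "\<phi> \<in> borel_measurable lborel" "fourier \<phi> \<in> borel_measurable lborel"
    using schwartz_measurable[OF \<phi>] schwartz_measurable[OF fourier_schwartz[OF \<phi>]] by simp_all
  define e where "e n = inverse (real (Suc n))" for n
  have e: "e n > 0" "e n \<le> 1" for n by (auto simp: e_def inverse_le_1_iff)
  have e_lim: "e \<longlonglongrightarrow> 0" unfolding e_def by (rule LIMSEQ_inverse_real_of_nat)
  define A where "A n = (LBINT k. iexp (k * x) * fourier \<phi> k * of_real (exp (- (e n * k)\<^sup>2 / 2)))" for n
  have "A \<longlonglongrightarrow> (LBINT k. iexp (k * x) * fourier \<phi> k)"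
    unfolding A_def
  proof (rule integral_dominated_convergence[where w = "\<lambda>k. cmod (fourier \<phi> k)"])
    show "AE k in lborel. (\<lambda>n. iexp (k * x) * fourier \<phi> k * of_real (exp (- (e n * k)\<^sup>2 / 2)))
      \<longlonglongrightarrow> iexp (k * x) * fourier \<phi> k"
    proof (rule AE_I2)
      fix k
      have "(\<lambda>n. iexp (k * x) * fourier \<phi> k * of_real (exp (- (e n * k)\<^sup>2 / 2)))
        \<longlonglongrightarrow> iexp (k * x) * fourier \<phi> k * of_real (exp (- (0 * k)\<^sup>2 / 2))"
        by (intro tendsto_intros e_lim) auto
      then show "(\<lambda>n. iexp (k * x) * fourier \<phi> k * of_real (exp (- (e n * k)\<^sup>2 / 2)))
        \<longlonglongrightarrow> iexp (k * x) * fourier \<phi> k" by simp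
    qed
    show "AE k in lborel. norm (iexp (k * x) * fourier \<phi> k * of_real (exp (- (e n * k)\<^sup>2 / 2)))
      \<le> cmod (fourier \<phi> k)" for n
      by (auto simp: norm_mult intro!: mult_left_le)
  qed (auto intro!: integrable_norm schwartz_integrable fourier_schwartz \<phi>)
  moreover have "A n = (LBINT z. \<phi> (x + e n * z) * of_real (sqrt (2 * pi) * exp (- z\<^sup>2 / 2)))" for n
  proof -
    have "A n = (LBINT k. LBINT y. iexp (k * (x - y)) * of_real (exp (- (e n * k)\<^sup>2 / 2)) * \<phi> y)"
      unfolding A_def
    proof (rule Bochner_Integration.integral_cong)
      fix k
      have "iexp (k * x) * fourier \<phi> k * of_real (exp (- (e n * k)\<^sup>2 / 2)) =
        (LBINT y. iexp (k * x) * of_real (exp (- (e n * k)\<^sup>2 / 2)) * (iexp (- y * k) * \<phi> y))"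
        by (simp add: fourier_iexp)
      also have "\<dots> = (LBINT y. iexp (k * (x - y)) * of_real (exp (- (e n * k)\<^sup>2 / 2)) * \<phi> y)"
      proof (rule Bochner_Integration.integral_cong)
        fix y
        have "iexp (k * (x - y)) = iexp (k * x) * iexp (- y * k)"
          unfolding iexp_add[symmetric] by (simp add: algebra_simps)
        then show "iexp (k * x) * of_real (exp (- (e n * k)\<^sup>2 / 2)) * (iexp (- y * k) * \<phi> y)
          = iexp (k * (x - y)) * of_real (exp (- (e n * k)\<^sup>2 / 2)) * \<phi> y"
          by (simp only: mult_ac)
      qed simp
      finally show "iexp (k * x) * fourier \<phi> k * of_real (exp (- (e n * k)\<^sup>2 / 2)) = \<dots>" .
    qed simp
    also have "\<dots> = (LBINT y. LBINT k. iexp (k * (x - y)) * of_real (exp (- (e n * k)\<^sup>2 / 2)) * \<phi> y)"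
    proof (rule Fubini_of_product_bound[symmetric])
      show "integrable lborel (\<lambda>k. exp (- (e n * k)\<^sup>2 / 2))"
        using e(1)[of n] by (intro integrable_gaussian) simp
      show "integrable lborel (\<lambda>y. cmod (\<phi> y))"
        by (intro integrable_norm schwartz_integrable \<phi>)
      show "norm (iexp (k * (x - y)) * of_real (exp (- (e n * k)\<^sup>2 / 2)) * \<phi> y)
        \<le> exp (- (e n * k)\<^sup>2 / 2) * cmod (\<phi> y)" for k y
        unfolding norm_mult norm_of_real norm_exp_i_times by simp
    qed measurable
    also have "\<dots> = (LBINT y. of_real (sqrt (2 * pi) / e n * exp (- ((x - y) / e n)\<^sup>2 / 2)) * \<phi> y)"
      by (simp only: integral_mult_left_zero fourier_gaussian[OF e(1)])
    also have "\<dots> = e n *\<^sub>R (LBINT z. of_real (sqrt (2 * pi) / e n * exp (- ((x - (x + e n * z)) / e n)\<^sup>2 / 2)) * \<phi> (x + e n * z))"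
      using e(1)[of n] by (subst lborel_integral_real_affine[where c = "e n" and t = x]) auto
    also have "\<dots> = (LBINT z. \<phi> (x + e n * z) * of_real (sqrt (2 * pi) * exp (- z\<^sup>2 / 2)))"
      unfolding integral_scaleR_right[symmetric] using e(1)[of n]
      by (intro Bochner_Integration.integral_cong) (auto simp: scaleR_conv_of_real field_simps)
    finally show ?thesis .
  qed
  moreover have "(\<lambda>n. LBINT z. \<phi> (x + e n * z) * of_real (sqrt (2 * pi) * exp (- z\<^sup>2 / 2)))
    \<longlonglongrightarrow> (LBINT z. \<phi> x * of_real (sqrt (2 * pi) * exp (- z\<^sup>2 / 2)))"
  proof (rule integral_dominated_convergence[where w = "\<lambda>z. schwartz_seminorm 0 \<phi> * (sqrt (2 * pi) * exp (- (1 * z)\<^sup>2 / 2))"])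
    show "AE z in lborel. (\<lambda>n. \<phi> (x + e n * z) * of_real (sqrt (2 * pi) * exp (- z\<^sup>2 / 2)))
      \<longlonglongrightarrow> \<phi> x * of_real (sqrt (2 * pi) * exp (- z\<^sup>2 / 2))"
    proof (intro AE_I2 tendsto_mult tendsto_const)
      fix z
      have "(\<lambda>n. x + e n * z) \<longlonglongrightarrow> x + 0 * z" by (intro tendsto_intros e_lim)
      moreover have "isCont \<phi> x"
        using smooth_continuous[OF schwartz_smooth[OF \<phi>], of UNIV] by (simp add: continuous_on_eq_continuous_at)
      ultimately show "(\<lambda>n. \<phi> (x + e n * z)) \<longlonglongrightarrow> \<phi> x"
        using isCont_tendsto_compose[of x \<phi> "\<lambda>n. x + e n * z" sequentially] by simp
    qed
    show "AE z in lborel. norm (\<phi> (x + e n * z) * of_real (sqrt (2 * pi) * exp (- z\<^sup>2 / 2)))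
      \<le> schwartz_seminorm 0 \<phi> * (sqrt (2 * pi) * exp (- (1 * z)\<^sup>2 / 2))" for n
      using schwartz_bound[OF \<phi>, of 0 0 0]
      by (auto simp: norm_mult intro!: mult_right_mono)
    show "integrable lborel (\<lambda>z. schwartz_seminorm 0 \<phi> * (sqrt (2 * pi) * exp (- (1 * z)\<^sup>2 / 2)))"
      by (intro integrable_mult_right integrable_gaussian) simp
  qed auto
  moreover have "(LBINT z. \<phi> x * of_real (sqrt (2 * pi) * exp (- z\<^sup>2 / 2))) = 2 * of_real pi * \<phi> x"
  proof -
    have "(LBINT z. complex_of_real (exp (- z\<^sup>2 / 2))) = of_real (sqrt (2 * pi))"
      using fourier_gaussian[of 1 0] by simp
    moreover have "complex_of_real (sqrt (2 * pi)) * of_real (sqrt (2 * pi)) = 2 * of_real pi"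
      by (subst of_real_mult[symmetric]) simp
    ultimately show ?thesis
      by (simp only: of_real_mult integral_mult_right_zero) (simp only: mult.commute)
  qed
  ultimately show ?thesis
    using LIMSEQ_unique by (metis (no_types, lifting) ext)
qed

section \<open>Weighted square integrable functions\<close>

text \<open>The Fourier side of \<open>sobolev s\<close>. The exponent is s and not s / 2 because
  the weight multiplies the square of |g|.\<close>

definition weighted_L2 :: "real \<Rightarrow> (real \<Rightarrow> complex) set" where
  "weighted_L2 s = {g \<in> borel_measurable lborel.
     integrable lborel (\<lambda>k. (1 + k\<^sup>2) powr s * (cmod (g k))\<^sup>2)}"

definition weighted_norm :: "real \<Rightarrow> (real \<Rightarrow> complex) \<Rightarrow> real" where
  "weighted_norm s g = sqrt (LBINT k. (1 + k\<^sup>2) powr s * (cmod (g k))\<^sup>2)"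

lemma weighted_norm_nonneg: "0 \<le> weighted_norm s g"
  by (simp add: weighted_norm_def)

lemma weighted_norm_square:
  "(weighted_norm s g)\<^sup>2 = (LBINT k. (1 + k\<^sup>2) powr s * (cmod (g k))\<^sup>2)"
  by (simp add: weighted_norm_def)

lemma weighted_L2_measurable: "g \<in> weighted_L2 s \<Longrightarrow> g \<in> borel_measurable lborel"
  and weighted_L2_integrable:
    "g \<in> weighted_L2 s \<Longrightarrow> integrable lborel (\<lambda>k. (1 + k\<^sup>2) powr s * (cmod (g k))\<^sup>2)"
  by (auto simp: weighted_L2_def)

lemma weighted_L2_bound:
  assumes "g \<in> weighted_L2 s" "h \<in> borel_measurable lborel" "0 \<le> C"
    and bound: "\<And>k. (1 + k\<^sup>2) powr r * (cmod (h k))\<^sup>2 \<le> C\<^sup>2 * ((1 + k\<^sup>2) powr s * (cmod (g k))\<^sup>2)"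
  shows "h \<in> weighted_L2 r" "weighted_norm r h \<le> C * weighted_norm s g"
proof -
  have [measurable]: "h \<in> borel_measurable lborel" by fact
  have i: "integrable lborel (\<lambda>k. C\<^sup>2 * ((1 + k\<^sup>2) powr s * (cmod (g k))\<^sup>2))"
    using weighted_L2_integrable[OF assms(1)] by (rule integrable_mult_right)
  have i': "integrable lborel (\<lambda>k. (1 + k\<^sup>2) powr r * (cmod (h k))\<^sup>2)"
    by (rule Bochner_Integration.integrable_bound[OF i]) (use bound in \<open>auto simp: abs_mult\<close>)
  then show "h \<in> weighted_L2 r" using assms(2) by (simp add: weighted_L2_def)
  have "(LBINT k. (1 + k\<^sup>2) powr r * (cmod (h k))\<^sup>2) \<le> (LBINT k. C\<^sup>2 * ((1 + k\<^sup>2) powr s * (cmod (g k))\<^sup>2))"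
    by (rule integral_mono[OF i' i bound])
  then have "(weighted_norm r h)\<^sup>2 \<le> (C * weighted_norm s g)\<^sup>2"
    by (simp add: weighted_norm_square power_mult_distrib)
  then show "weighted_norm r h \<le> C * weighted_norm s g"
    using assms(3) weighted_norm_nonneg by (meson mult_nonneg_nonneg power2_le_imp_le)
qed

lemma weighted_L2_dominated:
  assumes "g \<in> weighted_L2 s" "h \<in> borel_measurable lborel" "\<And>k. cmod (h k) \<le> cmod (g k)"
  shows "h \<in> weighted_L2 s" "weighted_norm s h \<le> weighted_norm s g"
proof -
  have "(1 + k\<^sup>2) powr s * (cmod (h k))\<^sup>2 \<le> 1\<^sup>2 * ((1 + k\<^sup>2) powr s * (cmod (g k))\<^sup>2)" for k
    using assms(3) by (simp add: mult_left_mono power_mono)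
  note * = weighted_L2_bound[OF assms(1,2) zero_le_one this]
  show "h \<in> weighted_L2 s" "weighted_norm s h \<le> weighted_norm s g"
    using * by simp_all
qed

lemma weighted_L2_cmult: "g \<in> weighted_L2 s \<Longrightarrow> (\<lambda>k. c * g k) \<in> weighted_L2 s"
  using weighted_L2_bound(1)[of g s "\<lambda>k. c * g k" "cmod c" s] weighted_L2_measurable[of g s]
  by (simp add: norm_mult power_mult_distrib)

lemma
  assumes "g \<in> weighted_L2 s" "q \<in> borel_measurable lborel"
  shows weighted_L2_iexp: "(\<lambda>k. iexp (q k) * g k) \<in> weighted_L2 s"
    and weighted_norm_iexp: "weighted_norm s (\<lambda>k. iexp (q k) * g k) = weighted_norm s g"
proof -
  have [measurable]: "q \<in> borel_measurable lborel" "g \<in> borel_measurable lborel"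
    using assms weighted_L2_measurable by auto
  have "(\<lambda>k. iexp (q k) * g k) \<in> borel_measurable lborel" by measurable
  with assms(1) show "(\<lambda>k. iexp (q k) * g k) \<in> weighted_L2 s"
    by (simp add: weighted_L2_def norm_mult)
  show "weighted_norm s (\<lambda>k. iexp (q k) * g k) = weighted_norm s g"
    by (simp add: weighted_norm_def norm_mult)
qed

lemma weighted_L2_add:
  assumes "g \<in> weighted_L2 s" "h \<in> weighted_L2 s"
  shows "(\<lambda>k. g k + h k) \<in> weighted_L2 s"
proof -
  have [measurable]: "h \<in> borel_measurable lborel" "g \<in> borel_measurable lborel"
    using assms weighted_L2_measurable by auto
  have sq: "(cmod (a + b))\<^sup>2 \<le> 2 * (cmod a)\<^sup>2 + 2 * (cmod b)\<^sup>2" for a b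
  proof -
    have "(cmod (a + b))\<^sup>2 \<le> (cmod a + cmod b)\<^sup>2"
      by (intro power_mono norm_triangle_ineq) auto
    then show ?thesis
      using sum_squares_bound[of "cmod a" "cmod b"] by (simp add: power2_sum)
  qed
  have "integrable lborel (\<lambda>k. (1 + k\<^sup>2) powr s * (cmod (g k + h k))\<^sup>2)"
  proof (rule Bochner_Integration.integrable_bound)
    show "integrable lborel (\<lambda>k. 2 * ((1 + k\<^sup>2) powr s * (cmod (g k))\<^sup>2) + 2 * ((1 + k\<^sup>2) powr s * (cmod (h k))\<^sup>2))"
      using assms by (intro Bochner_Integration.integrable_add integrable_mult_right weighted_L2_integrable)
    show "AE k in lborel. norm ((1 + k\<^sup>2) powr s * (cmod (g k + h k))\<^sup>2)
      \<le> norm (2 * ((1 + k\<^sup>2) powr s * (cmod (g k))\<^sup>2) + 2 * ((1 + k\<^sup>2) powr s * (cmod (h k))\<^sup>2))"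
    proof (rule AE_I2)
      fix k
      have "(1 + k\<^sup>2) powr s * (cmod (g k + h k))\<^sup>2 \<le> (1 + k\<^sup>2) powr s * (2 * (cmod (g k))\<^sup>2 + 2 * (cmod (h k))\<^sup>2)"
        by (intro mult_left_mono sq) auto
      also have "\<dots> = 2 * ((1 + k\<^sup>2) powr s * (cmod (g k))\<^sup>2) + 2 * ((1 + k\<^sup>2) powr s * (cmod (h k))\<^sup>2)"
        by (simp add: algebra_simps)
      finally show "norm ((1 + k\<^sup>2) powr s * (cmod (g k + h k))\<^sup>2)
        \<le> norm (2 * ((1 + k\<^sup>2) powr s * (cmod (g k))\<^sup>2) + 2 * ((1 + k\<^sup>2) powr s * (cmod (h k))\<^sup>2))"
        by simp
    qed
  qed measurable
  then show ?thesis by (simp add: weighted_L2_def)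
qed

lemma weighted_L2_diff:
  assumes "g \<in> weighted_L2 s" "h \<in> weighted_L2 s"
  shows "(\<lambda>k. g k - h k) \<in> weighted_L2 s"
  using weighted_L2_add[OF assms(1) weighted_L2_cmult[OF assms(2), of "-1"]] by simp

text \<open>The weights cancel in the product of \<open>u\<close> and \<open>v\<close>, so this is
  Cauchy-Schwarz. It is derived from a quadratic polynomial in t that is never negative.\<close>

lemma
  assumes "g \<in> weighted_L2 s" "\<psi> \<in> weighted_L2 (- s)"
  shows weighted_L2_pairing_integrable: "integrable lborel (\<lambda>k. g k * \<psi> k)"
    and weighted_L2_pairing_bound: "(LBINT k. cmod (g k * \<psi> k)) \<le> weighted_norm s g * weighted_norm (- s) \<psi>"
proof -
  have [measurable]: "g \<in> borel_measurable lborel" "\<psi> \<in> borel_measurable lborel"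
    using assms weighted_L2_measurable by auto
  define u where "u k = (1 + k\<^sup>2) powr (s / 2) * cmod (g k)" for k
  define v where "v k = (1 + k\<^sup>2) powr (- s / 2) * cmod (\<psi> k)" for k
  have pos: "0 < 1 + k\<^sup>2" for k :: real by (simp add: add_pos_nonneg)
  have u2: "(u k)\<^sup>2 = (1 + k\<^sup>2) powr s * (cmod (g k))\<^sup>2" for k
    using pos[of k] by (simp add: u_def power_mult_distrib power2_eq_square flip: powr_add)
  have v2: "(v k)\<^sup>2 = (1 + k\<^sup>2) powr (- s) * (cmod (\<psi> k))\<^sup>2" for k
    using pos[of k] by (simp add: v_def power_mult_distrib power2_eq_square flip: powr_add)
  have uv: "u k * v k = cmod (g k * \<psi> k)" for k
  proof -
    have "u k * v k = ((1 + k\<^sup>2) powr (s / 2) * (1 + k\<^sup>2) powr (- s / 2)) * (cmod (g k) * cmod (\<psi> k))"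
      unfolding u_def v_def by (simp only: mult_ac)
    also have "(1 + k\<^sup>2) powr (s / 2) * (1 + k\<^sup>2) powr (- s / 2) = 1"
      using pos[of k] by (simp flip: powr_add)
    finally show ?thesis by (simp add: norm_mult)
  qed
  have iu: "integrable lborel (\<lambda>k. (u k)\<^sup>2)" and iv: "integrable lborel (\<lambda>k. (v k)\<^sup>2)"
    unfolding u2 v2 using assms by (auto intro: weighted_L2_integrable)
  have nn: "0 \<le> u k" "0 \<le> v k" for k by (auto simp: u_def v_def)
  show i: "integrable lborel (\<lambda>k. g k * \<psi> k)"
  proof (rule Bochner_Integration.integrable_bound[OF Bochner_Integration.integrable_add[OF iu iv]])
    show "AE k in lborel. norm (g k * \<psi> k) \<le> norm ((u k)\<^sup>2 + (v k)\<^sup>2)"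
    proof (rule AE_I2)
      fix k
      have "u k * v k \<le> (u k)\<^sup>2 + (v k)\<^sup>2"
        using sum_squares_bound[of "u k" "v k"] nn[of k] mult_nonneg_nonneg[OF nn[of k]] by linarith
      then show "norm (g k * \<psi> k) \<le> norm ((u k)\<^sup>2 + (v k)\<^sup>2)"
        by (simp add: uv[symmetric])
    qed
  qed measurable
  define A B I where "A = (LBINT k. (u k)\<^sup>2)" and "B = (LBINT k. (v k)\<^sup>2)" and "I = (LBINT k. u k * v k)"
  have iuv: "integrable lborel (\<lambda>k. u k * v k)"
    unfolding uv using i by (rule integrable_norm)
  have quad: "0 \<le> A - 2 * t * I + t\<^sup>2 * B" for t
  proof -
    have "0 \<le> (LBINT k. (u k - t * v k)\<^sup>2)" by simp
    also have "\<dots> = (LBINT k. (u k)\<^sup>2 - 2 * t * (u k * v k) + t\<^sup>2 * (v k)\<^sup>2)"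
      by (intro Bochner_Integration.integral_cong) (auto simp: power2_eq_square algebra_simps)
    also have "\<dots> = A - 2 * t * I + t\<^sup>2 * B"
      using iu iv iuv by (simp add: A_def B_def I_def)
    finally show ?thesis .
  qed
  have "I \<ge> 0" unfolding I_def using nn by simp
  have "B \<ge> 0" unfolding B_def by simp
  have "I\<^sup>2 \<le> A * B"
  proof (cases "B = 0")
    case True
    have "I = 0"
    proof (rule ccontr)
      assume "I \<noteq> 0"
      \<comment> \<open>For B = 0 the polynomial is affine in t, and at this t it would take the
        value -1.\<close>
      then show False using quad[of "(A + 1) / (2 * I)"] True by simp
    qed
    with True show ?thesis by simp
  next
    case False
    with \<open>B \<ge> 0\<close> have "B > 0" by simp
    \<comment> \<open>t = I / B minimises the polynomial.\<close>
    then show ?thesis using quad[of "I / B"] by (simp add: power2_eq_square field_simps)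
  qed
  then have "I \<le> sqrt (A * B)" by (rule real_le_rsqrt)
  then show "(LBINT k. cmod (g k * \<psi> k)) \<le> weighted_norm s g * weighted_norm (- s) \<psi>"
    by (simp add: I_def uv A_def B_def u2 v2 weighted_norm_def real_sqrt_mult)
qed

lemma weighted_L2_pairing:
  assumes "g \<in> weighted_L2 s" "\<psi> \<in> weighted_L2 (- s)"
  shows "cmod (LBINT k. g k * \<psi> k) \<le> weighted_norm s g * weighted_norm (- s) \<psi>"
  using order_trans[OF integral_norm_bound weighted_L2_pairing_bound[OF assms]] .

lemma exists_exponent: obtains n :: nat where "a \<le> 2 * real n"
proof -
  obtain n :: nat where "a / 2 \<le> real n" using real_arch_simple by blast
  then show ?thesis by (intro that[of n]) simp
qed

text \<open>One factor 1 + k^2 is left over for integrability, whence s + 1 \<le> 2n; sqrt pi is the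
  L^2 norm of (1 + k^2)^(-1/2).\<close>

lemma weighted_L2_of_decay:
  assumes "\<psi> \<in> borel_measurable lborel" "0 \<le> C" "s + 1 \<le> 2 * real n"
    and bound: "\<And>k. (1 + k\<^sup>2) ^ n * cmod (\<psi> k) \<le> C"
  shows "\<psi> \<in> weighted_L2 s" "weighted_norm s \<psi> \<le> C * sqrt pi"
proof -
  have [measurable]: "\<psi> \<in> borel_measurable lborel" by fact
  have le: "(1 + k\<^sup>2) * ((1 + k\<^sup>2) powr s * (cmod (\<psi> k))\<^sup>2) \<le> C\<^sup>2" for k
  proof -
    have k: "1 \<le> 1 + k\<^sup>2" by simp
    have "(1 + k\<^sup>2) * ((1 + k\<^sup>2) powr s * (cmod (\<psi> k))\<^sup>2) = (1 + k\<^sup>2) powr (s + 1) * (cmod (\<psi> k))\<^sup>2"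
      using k by (simp add: powr_add)
    also have "\<dots> \<le> (1 + k\<^sup>2) powr (2 * real n) * (cmod (\<psi> k))\<^sup>2"
      using assms(3) k by (intro mult_right_mono powr_mono) auto
    also have "(1 + k\<^sup>2) powr (2 * real n) = (1 + k\<^sup>2) ^ (2 * n)"
      using powr_realpow[of "1 + k\<^sup>2" "2 * n"] by (simp add: add_pos_nonneg)
    also have "(1 + k\<^sup>2) ^ (2 * n) * (cmod (\<psi> k))\<^sup>2 = ((1 + k\<^sup>2) ^ n * cmod (\<psi> k))\<^sup>2"
      by (simp add: power_mult_distrib power_mult mult.commute flip: power_mult)
    also have "\<dots> \<le> C\<^sup>2"
      using bound by (intro power_mono) auto
    finally show ?thesis .
  qed
  have i: "integrable lborel (\<lambda>k. (1 + k\<^sup>2) powr s * (cmod (\<psi> k))\<^sup>2)"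
    by (rule integrable_of_square_decay[of _ "C\<^sup>2"]) (use le in auto)
  then show "\<psi> \<in> weighted_L2 s" by (simp add: weighted_L2_def)
  have "(LBINT k. norm ((1 + k\<^sup>2) powr s * (cmod (\<psi> k))\<^sup>2)) \<le> C\<^sup>2 * pi"
    by (rule integral_norm_of_square_decay) (use le in auto)
  then have "(weighted_norm s \<psi>)\<^sup>2 \<le> (C * sqrt pi)\<^sup>2"
    by (simp add: weighted_norm_square power_mult_distrib)
  then show "weighted_norm s \<psi> \<le> C * sqrt pi"
    by (rule power2_le_imp_le) (simp add: assms)
qed

text \<open>Dominated convergence with 4 |g|^2, since two unimodular factors differ by at most 2.
  With \<open>q\<close> the phase this gives continuity in time, with \<open>q\<close> the identity
  continuity in space.\<close>

lemma weighted_norm_iexp_diff_tendsto: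
  assumes "g \<in> weighted_L2 s" "q \<in> borel_measurable lborel"
  shows "((\<lambda>b. weighted_norm s (\<lambda>k. iexp (q k * b) * g k - iexp (q k * a) * g k)) \<longlongrightarrow> 0) (at a)"
  unfolding tendsto_at_iff_sequentially comp_def
proof (intro allI impI)
  fix X assume X: "X \<longlonglongrightarrow> a"
  have [measurable]: "q \<in> borel_measurable lborel" "g \<in> borel_measurable lborel"
    using assms weighted_L2_measurable by auto
  have "(\<lambda>n. LBINT k. (1 + k\<^sup>2) powr s * (cmod (iexp (q k * X n) * g k - iexp (q k * a) * g k))\<^sup>2)
    \<longlonglongrightarrow> (LBINT k::real. 0)"
  proof (rule integral_dominated_convergence[where w = "\<lambda>k. 4 * ((1 + k\<^sup>2) powr s * (cmod (g k))\<^sup>2)"])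
    show "integrable lborel (\<lambda>k. 4 * ((1 + k\<^sup>2) powr s * (cmod (g k))\<^sup>2))"
      using assms by (intro integrable_mult_right weighted_L2_integrable)
    show "AE k in lborel. (\<lambda>n. (1 + k\<^sup>2) powr s * (cmod (iexp (q k * X n) * g k - iexp (q k * a) * g k))\<^sup>2) \<longlonglongrightarrow> 0"
    proof (rule AE_I2)
      fix k
      have "(\<lambda>n. (1 + k\<^sup>2) powr s * (cmod (iexp (q k * X n) * g k - iexp (q k * a) * g k))\<^sup>2)
         \<longlonglongrightarrow> (1 + k\<^sup>2) powr s * (cmod (iexp (q k * a) * g k - iexp (q k * a) * g k))\<^sup>2"
        by (intro tendsto_intros X)
      then show "(\<lambda>n. (1 + k\<^sup>2) powr s * (cmod (iexp (q k * X n) * g k - iexp (q k * a) * g k))\<^sup>2) \<longlonglongrightarrow> 0"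
        by simp
    qed
    show "AE k in lborel. norm ((1 + k\<^sup>2) powr s * (cmod (iexp (q k * X n) * g k - iexp (q k * a) * g k))\<^sup>2)
      \<le> 4 * ((1 + k\<^sup>2) powr s * (cmod (g k))\<^sup>2)" for n
    proof (rule AE_I2)
      fix k
      have "cmod (iexp (q k * X n) * g k - iexp (q k * a) * g k) \<le> cmod (iexp (q k * X n) * g k) + cmod (iexp (q k * a) * g k)"
        by (rule norm_triangle_ineq4)
      also have "\<dots> = 2 * cmod (g k)" unfolding norm_mult norm_iexp by simp
      finally have "(cmod (iexp (q k * X n) * g k - iexp (q k * a) * g k))\<^sup>2 \<le> (2 * cmod (g k))\<^sup>2"
        by (intro power_mono) auto
      from mult_left_mono[OF this, of "(1 + k\<^sup>2) powr s"]
      show "norm ((1 + k\<^sup>2) powr s * (cmod (iexp (q k * X n) * g k - iexp (q k * a) * g k))\<^sup>2)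
        \<le> 4 * ((1 + k\<^sup>2) powr s * (cmod (g k))\<^sup>2)"
        by (simp add: power_mult_distrib)
    qed
  qed measurable
  then show "(\<lambda>n. weighted_norm s (\<lambda>k. iexp (q k * X n) * g k - iexp (q k * a) * g k)) \<longlonglongrightarrow> 0"
    unfolding weighted_norm_def using tendsto_real_sqrt by fastforce
qed

section \<open>Distributions with a locally integrable Fourier transform\<close>

lemma weighted_L2_fourier:
  assumes "\<phi> \<in> schwartz" "s + 1 \<le> 2 * real n"
  shows "fourier \<phi> \<in> weighted_L2 s"
    and "weighted_norm s (fourier \<phi>) \<le> 2 ^ n * 4 * pi * schwartz_seminorm (2 * n + 2) \<phi> * sqrt pi"
  using weighted_L2_of_decay[OF schwartz_measurable[OF fourier_schwartz[OF assms(1)]] _ assms(2)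
    fourier_decay_seminorm[OF assms(1)]] schwartz_seminorm_nonneg[OF assms(1)]
  by auto

lemma weighted_L2_schwartz:
  assumes "\<phi> \<in> schwartz"
  shows "\<phi> \<in> weighted_L2 s"
proof -
  obtain n where n: "s + 1 \<le> 2 * real n" by (rule exists_exponent)
  show ?thesis
  proof (rule weighted_L2_of_decay(1)[OF schwartz_measurable[OF assms] _ n])
    fix k
    have "(1 + k\<^sup>2) ^ n * cmod (\<phi> k) \<le> 2 ^ n * (1 + \<bar>k\<bar> ^ (2 * n)) * cmod (\<phi> k)"
      by (intro mult_right_mono power_1_plus_square_le) auto
    also have "\<dots> = 2 ^ n * (\<bar>k\<bar> ^ 0 * cmod (Dn 0 \<phi> k) + \<bar>k\<bar> ^ (2 * n) * cmod (Dn 0 \<phi> k))"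
      by (simp add: algebra_simps)
    also have "\<dots> \<le> 2 ^ n * (schwartz_seminorm (2 * n) \<phi> + schwartz_seminorm (2 * n) \<phi>)"
      by (intro mult_left_mono add_mono schwartz_bound assms) auto
    finally show "(1 + k\<^sup>2) ^ n * cmod (\<phi> k) \<le> 2 ^ n * (schwartz_seminorm (2 * n) \<phi> + schwartz_seminorm (2 * n) \<phi>)" .
  qed (use schwartz_seminorm_nonneg[OF assms] in auto)
qed

lemma reflected_weighted_L2:
  assumes "\<psi> \<in> weighted_L2 s"
  shows "(\<lambda>k. \<psi> (- k)) \<in> weighted_L2 s" "weighted_norm s (\<lambda>k. \<psi> (- k)) = weighted_norm s \<psi>"
proof -
  have [measurable]: "\<psi> \<in> borel_measurable lborel" by (rule weighted_L2_measurable[OF assms])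
  have "(\<lambda>k. \<psi> (- k)) \<in> borel_measurable lborel" by measurable
  then show "(\<lambda>k. \<psi> (- k)) \<in> weighted_L2 s"
    using lborel_integrable_real_affine[OF weighted_L2_integrable[OF assms], of "-1" 0]
    by (simp add: weighted_L2_def)
  show "weighted_norm s (\<lambda>k. \<psi> (- k)) = weighted_norm s \<psi>"
    unfolding weighted_norm_def
    by (subst (2) lborel_integral_real_affine[where c = "-1" and t = 0]) auto
qed

text \<open>The distribution (1 / 2 pi) int exp(ikx) g(k) dk in x. The integration in x against
  \<open>\<phi>\<close> is carried out first, so that \<open>g\<close> is only ever paired with a
  Schwartz function.\<close>

definition inv_fourier :: "(real \<Rightarrow> complex) \<Rightarrow> functional" where
  "inv_fourier g \<phi> = 1 / (2 * of_real pi) * (LBINT k. g k * fourier \<phi> (- k))"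

lemma fourier_add: "\<phi> \<in> schwartz \<Longrightarrow> \<psi> \<in> schwartz \<Longrightarrow> fourier (\<lambda>x. \<phi> x + \<psi> x) k = fourier \<phi> k + fourier \<psi> k"
proof -
  assume *: "\<phi> \<in> schwartz" "\<psi> \<in> schwartz"
  have i: "integrable lborel (\<lambda>x. iexp (- x * k) * g x)" if "g \<in> schwartz" for g
    by (rule Bochner_Integration.integrable_bound[OF schwartz_integrable[OF that]])
      (use schwartz_measurable[OF that] in \<open>auto simp: norm_mult\<close>)
  show ?thesis
    unfolding fourier_iexp using i[OF *(1)] i[OF *(2)] by (simp add: distrib_left)
qed

lemma fourier_cmult: "fourier (\<lambda>x. c * \<phi> x) k = c * fourier \<phi> k"
  by (simp add: fourier_iexp mult.left_commute)

lemma inv_fourier_integrable: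
  assumes "g \<in> weighted_L2 s" "\<phi> \<in> schwartz"
  shows "integrable lborel (\<lambda>k. g k * fourier \<phi> (- k))"
  by (intro weighted_L2_pairing_integrable[OF assms(1)] reflected_weighted_L2 weighted_L2_schwartz
      fourier_schwartz assms)

lemma tempered_inv_fourier:
  assumes g: "g \<in> weighted_L2 s"
  shows "tempered (inv_fourier g)"
proof -
  obtain n where n: "- s + 1 \<le> 2 * real n" by (rule exists_exponent)
  show ?thesis
    unfolding tempered_def
  proof (intro conjI ballI allI exI)
    show "inv_fourier g (\<lambda>x. \<phi> x + \<psi> x) = inv_fourier g \<phi> + inv_fourier g \<psi>"
      if "\<phi> \<in> schwartz" "\<psi> \<in> schwartz" for \<phi> \<psi>
      using that inv_fourier_integrable[OF g]
      by (simp add: inv_fourier_def fourier_add distrib_left)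
    show "inv_fourier g (\<lambda>x. c * \<phi> x) = c * inv_fourier g \<phi>" for c \<phi>
      by (simp add: inv_fourier_def fourier_cmult mult.left_commute)
    fix \<phi> assume \<phi>: "\<phi> \<in> schwartz"
    have "cmod (LBINT k. g k * fourier \<phi> (- k)) \<le> weighted_norm s g * weighted_norm (- s) (\<lambda>k. fourier \<phi> (- k))"
      by (intro weighted_L2_pairing g reflected_weighted_L2 weighted_L2_schwartz fourier_schwartz \<phi>)
    also have "\<dots> \<le> weighted_norm s g * (2 ^ n * 4 * pi * schwartz_seminorm (2 * n + 2) \<phi> * sqrt pi)"
      using weighted_L2_fourier[OF \<phi> n] by (intro mult_left_mono weighted_norm_nonneg) (simp add: reflected_weighted_L2)
    finally show "norm (inv_fourier g \<phi>) \<le>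
        (1 / (2 * pi) * (weighted_norm s g * (2 ^ n * 4 * pi * sqrt pi))) * schwartz_seminorm (2 * n + 2) \<phi>"
      by (simp add: inv_fourier_def norm_mult norm_divide field_simps)
  qed
qed

lemma fourier_fourier: "\<phi> \<in> schwartz \<Longrightarrow> fourier (fourier \<phi>) (- k) = 2 * of_real pi * \<phi> k"
  using fourier_inversion[of \<phi> k] by (simp add: fourier_iexp)

lemma has_fourier_inv_fourier:
  assumes g: "g \<in> weighted_L2 s"
  shows "has_fourier (inv_fourier g) g"
  unfolding has_fourier_def
proof (intro conjI ballI)
  fix \<phi> assume \<phi>: "\<phi> \<in> schwartz"
  show "integrable lborel (\<lambda>k. g k * \<phi> k)"
    by (rule weighted_L2_pairing_integrable[OF g weighted_L2_schwartz[OF \<phi>]])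
  have "inv_fourier g (fourier \<phi>) = 1 / (2 * of_real pi) * (LBINT k. 2 * of_real pi * (g k * \<phi> k))"
    unfolding inv_fourier_def by (simp only: fourier_fourier[OF \<phi>] mult.left_commute)
  then show "inv_fourier g (fourier \<phi>) = (LBINT k. g k * \<phi> k)" by simp
qed (rule weighted_L2_measurable[OF g])

lemma inv_fourier_sobolev: "g \<in> weighted_L2 s \<Longrightarrow> inv_fourier g \<in> sobolev s"
  unfolding sobolev_def using tempered_inv_fourier has_fourier_inv_fourier weighted_L2_integrable by blast

text \<open>The positive and the negative part of \<open>h\<close> are densities of two measures
  that agree, with finite values, on bounded open intervals. These generate the Borel sets and
  exhaust the line, so the measures coincide, and densities are unique almost everywhere.\<close>

lemma AE_eq_0_of_interval_integrals:
  fixes h :: "real \<Rightarrow> real"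
  assumes [measurable]: "h \<in> borel_measurable lborel"
    and i: "\<And>a b. integrable lborel (\<lambda>x. h x * indicator {a<..<b} x)"
    and z: "\<And>a b. (LBINT x. h x * indicator {a<..<b} x) = 0"
  shows "AE x in lborel. h x = 0"
proof -
  define P N where "P = density lborel (\<lambda>x. ennreal (max 0 (h x)))"
    and "N = density lborel (\<lambda>x. ennreal (max 0 (- h x)))"
  have box: "box a b = {a<..<b}" for a b :: real
    by (simp add: box_real)
  have nn: "emeasure (density lborel (\<lambda>x. ennreal (max 0 (c * h x)))) {a<..<b} =
      ennreal (LBINT x. max 0 (c * h x) * indicator {a<..<b} x)" if "c = 1 \<or> c = -1" for a b c
  proof -
    have "integrable lborel (\<lambda>x. max 0 (c * h x) * indicator {a<..<b} x)"
      by (rule Bochner_Integration.integrable_bound[OF i[of a b]])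
        (use that in \<open>auto simp: indicator_def\<close>)
    then show ?thesis
      by (subst nn_integral_eq_integral[symmetric])
        (auto simp: emeasure_density ennreal_mult' intro!: nn_integral_cong split: split_indicator)
  qed
  have eq: "emeasure P {a<..<b} = emeasure N {a<..<b}" for a b
  proof -
    have j: "integrable lborel (\<lambda>x. max 0 (h x) * indicator {a<..<b} x)"
      by (rule Bochner_Integration.integrable_bound[OF i[of a b]]) (auto simp: indicator_def)
    have "(LBINT x. max 0 (- h x) * indicator {a<..<b} x) =
      (LBINT x. max 0 (h x) * indicator {a<..<b} x - h x * indicator {a<..<b} x)"
      by (intro Bochner_Integration.integral_cong) (auto simp: max_def indicator_def)
    also have "\<dots> = (LBINT x. max 0 (h x) * indicator {a<..<b} x)"
      using i j z by simp
    finally show ?thesis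
      using nn[of 1 a b] nn[of "-1" a b] by (simp add: P_def N_def)
  qed
  have "P = N"
  proof (rule measure_eqI_generator_eq)
    let ?E = "range (\<lambda>(a, b). box a b::real set)"
    show "Int_stable ?E"
      by (auto simp: Int_stable_def box_Int_box)
    show "?E \<subseteq> Pow UNIV" "sets P = sigma_sets UNIV ?E" "sets N = sigma_sets UNIV ?E"
      by (simp_all add: borel_eq_box P_def N_def)
    let ?A = "\<lambda>n::nat. box (- (real n *\<^sub>R One)) (real n *\<^sub>R One) :: real set"
    show "range ?A \<subseteq> ?E" "(\<Union>i. ?A i) = UNIV"
      unfolding UN_box_eq_UNIV by auto
    show "emeasure P (?A i) \<noteq> \<infinity>" for i
      unfolding box P_def using nn[of 1] by simp
    show "emeasure P X = emeasure N X" if "X \<in> ?E" for X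
      using that eq by (auto simp: box)
  qed
  then have "AE x in lborel. ennreal (max 0 (h x)) = ennreal (max 0 (- h x))"
    unfolding P_def N_def by (intro sigma_finite_measure.density_unique[OF sigma_finite_lborel]) auto
  then show ?thesis
    by eventually_elim (auto simp: max_def split: if_splits)
qed

lemma has_fourier_diff:
  assumes "has_fourier u g" "has_fourier v h"
  shows "has_fourier (\<lambda>\<phi>. u \<phi> - v \<phi>) (\<lambda>k. g k - h k)"
  using assms by (auto simp: has_fourier_def left_diff_distrib)

lemma flat_mono: "x \<le> y \<Longrightarrow> flat x \<le> flat y"
  by (auto simp: flat_def)

text \<open>The fundamental lemma of the calculus of variations. Integrals over intervals are limits
  of integrals against steepening bumps; the local integrability that dominates them comes from one
  wider bump.\<close>

lemma AE_eq_0_of_test_functions: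
  fixes h :: "real \<Rightarrow> complex"
  assumes [measurable]: "h \<in> borel_measurable lborel"
    and i: "\<And>\<phi>. \<phi> \<in> test_functions UNIV \<Longrightarrow> integrable lborel (\<lambda>k. h k * \<phi> k)"
    and z: "\<And>\<phi>. \<phi> \<in> test_functions UNIV \<Longrightarrow> (LBINT k. h k * \<phi> k) = 0"
  shows "AE k in lborel. h k = 0"
proof -
  have bump: "(\<lambda>x. complex_of_real (bump c a b x)) \<in> test_functions UNIV" if "c > 0" for a b c
    using bump_test_function[of a b UNIV c] that by simp
  have [measurable]: "bump c a b \<in> borel_measurable borel" for a b c
    unfolding bump_def flat_def by measurable
  have ind: "integrable lborel (\<lambda>k. h k * indicator {a<..<b} k)" for a b
  proof (rule Bochner_Integration.integrable_bound)
    show "integrable lborel (\<lambda>k. of_real (1 / (flat 1)\<^sup>2) * (h k * of_real (bump 1 (a - 1) (b + 1) k)))"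
      by (intro integrable_mult_right i bump) simp
    \<comment> \<open>A point of (a, b) lies at distance at least 1 from both ends of the wider
      interval, so each factor of the bump is at least \<open>flat 1\<close>.\<close>
    have "1 \<le> bump 1 (a - 1) (b + 1) k / (flat 1)\<^sup>2" if "k \<in> {a<..<b}" for k
    proof -
      have "flat 1 * flat 1 \<le> bump 1 (a - 1) (b + 1) k"
        unfolding bump_def using that flat_nonneg by (intro mult_mono flat_mono) auto
      then show ?thesis using flat_pos[of 1] by (simp add: power2_eq_square)
    qed
    then have ind_le: "indicator {a<..<b} k \<le> bump 1 (a - 1) (b + 1) k / (flat 1)\<^sup>2" for k
      using bump_nonneg by (auto simp: indicator_def)
    show "AE k in lborel. norm (h k * indicator {a<..<b} k)
        \<le> norm (of_real (1 / (flat 1)\<^sup>2) * (h k * of_real (bump 1 (a - 1) (b + 1) k)))"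
    proof (rule AE_I2)
      fix k
      have "norm (h k * indicator {a<..<b} k) = cmod (h k) * indicator {a<..<b} k"
        by (simp add: norm_mult indicator_def)
      also have "\<dots> \<le> cmod (h k) * (bump 1 (a - 1) (b + 1) k / (flat 1)\<^sup>2)"
        by (intro mult_left_mono ind_le) simp
      also have "\<dots> = norm (of_real (1 / (flat 1)\<^sup>2) * (h k * of_real (bump 1 (a - 1) (b + 1) k)))"
        using bump_nonneg[of 1 "a - 1" "b + 1" k] by (simp only: norm_mult norm_of_real abs_of_nonneg) simp
      finally show "norm (h k * indicator {a<..<b} k)
        \<le> norm (of_real (1 / (flat 1)\<^sup>2) * (h k * of_real (bump 1 (a - 1) (b + 1) k)))" .
    qed
  qed measurable
  have zero: "(LBINT k. h k * indicator {a<..<b} k) = 0" for a b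
  proof -
    have "(\<lambda>n. LBINT k. h k * of_real (bump (Suc n) a b k)) \<longlonglongrightarrow> (LBINT k. h k * of_real (indicator {a<..<b} k))"
    proof (rule integral_dominated_convergence[where w = "\<lambda>k. cmod (h k * indicator {a<..<b} k)"])
      show "AE k in lborel. (\<lambda>n. h k * of_real (bump (Suc n) a b k)) \<longlonglongrightarrow> h k * of_real (indicator {a<..<b} k)"
        by (intro AE_I2 tendsto_intros bump_tendsto_indicator)
      show "AE k in lborel. norm (h k * of_real (bump (Suc n) a b k)) \<le> cmod (h k * indicator {a<..<b} k)" for n
      proof (rule AE_I2)
        fix k
        show "norm (h k * of_real (bump (Suc n) a b k)) \<le> cmod (h k * indicator {a<..<b} k)"
          using bump_nonneg[of "Suc n" a b k] bump_le_1[of "Suc n" a b k] bump_eq_0[of "Suc n" k a b]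
          by (cases "k \<in> {a<..<b}") (auto simp: norm_mult intro: mult_left_le)
      qed
    qed (use ind in \<open>auto intro: integrable_norm\<close>)
    moreover have "(LBINT k. h k * of_real (bump (Suc n) a b k)) = 0" for n
      by (intro z bump) simp
    ultimately have "(LBINT k. h k * of_real (indicator {a<..<b} k)) = 0"
      by (simp only: LIMSEQ_const_iff)
    also have "(\<lambda>k. h k * of_real (indicator {a<..<b} k)) = (\<lambda>k. h k * indicator {a<..<b} k)"
      by (auto simp: indicator_def)
    finally show ?thesis .
  qed
  have Re: "Re (h k) * indicator {a<..<b} k = Re (h k * indicator {a<..<b} k)"
    and Im: "Im (h k) * indicator {a<..<b} k = Im (h k * indicator {a<..<b} k)" for a b k
    by (auto simp: indicator_def)
  have "AE k in lborel. Re (h k) = 0"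
  proof (rule AE_eq_0_of_interval_integrals)
    show "integrable lborel (\<lambda>k. Re (h k) * indicator {a<..<b} k)" for a b
      unfolding Re using ind by (rule integrable_Re)
    show "(LBINT k. Re (h k) * indicator {a<..<b} k) = 0" for a b
      unfolding Re integral_Re[OF ind] zero by simp
  qed measurable
  moreover have "AE k in lborel. Im (h k) = 0"
  proof (rule AE_eq_0_of_interval_integrals)
    show "integrable lborel (\<lambda>k. Im (h k) * indicator {a<..<b} k)" for a b
      unfolding Im using ind by (rule integrable_Im)
    show "(LBINT k. Im (h k) * indicator {a<..<b} k) = 0" for a b
      unfolding Im integral_Im[OF ind] zero by simp
  qed measurable
  ultimately show ?thesis
    by eventually_elim (simp add: complex_eq_iff)
qed

lemma has_fourier_unique:
  assumes "has_fourier u g" "has_fourier u h"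
  shows "AE k in lborel. g k = h k"
proof -
  have "AE k in lborel. g k - h k = 0"
    using has_fourier_diff[OF assms] test_functions_schwartz
    by (intro AE_eq_0_of_test_functions) (auto simp: has_fourier_def)
  then show ?thesis by simp
qed

section \<open>Sobolev spaces and norms through any representative of the Fourier transform\<close>

lemma has_fourier_dist_fourier: "has_fourier u g \<Longrightarrow> has_fourier u (dist_fourier u)"
  unfolding dist_fourier_def by (rule someI[of "has_fourier u" g])

lemma sobolev_norm_eq:
  assumes "has_fourier u g"
  shows "sobolev_norm s u = weighted_norm s g"
proof -
  note * = has_fourier_dist_fourier[OF assms]
  have [measurable]: "g \<in> borel_measurable lborel" "dist_fourier u \<in> borel_measurable lborel"
    using * assms by (auto simp: has_fourier_def)
  have "(LBINT k. (1 + k\<^sup>2) powr s * (norm (dist_fourier u k))\<^sup>2) = (LBINT k. (1 + k\<^sup>2) powr s * (norm (g k))\<^sup>2)"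
    using has_fourier_unique[OF * assms] by (intro integral_cong_AE) auto
  then show ?thesis by (simp add: sobolev_norm_def weighted_norm_def)
qed

lemma sobolev_dist_fourier:
  assumes "u \<in> sobolev s"
  shows "has_fourier u (dist_fourier u)" "dist_fourier u \<in> weighted_L2 s"
proof -
  obtain g where g: "has_fourier u g" "integrable lborel (\<lambda>k. (1 + k\<^sup>2) powr s * (norm (g k))\<^sup>2)"
    using assms by (auto simp: sobolev_def)
  show *: "has_fourier u (dist_fourier u)" by (rule has_fourier_dist_fourier[OF g(1)])
  have [measurable]: "g \<in> borel_measurable lborel" "dist_fourier u \<in> borel_measurable lborel"
    using * g by (auto simp: has_fourier_def)
  have "integrable lborel (\<lambda>k. (1 + k\<^sup>2) powr s * (norm (dist_fourier u k))\<^sup>2)"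
    by (rule integrable_cong_AE_imp[OF g(2)]) (use has_fourier_unique[OF * g(1)] in auto)
  then show "dist_fourier u \<in> weighted_L2 s" by (simp add: weighted_L2_def)
qed

lemma sobolev_norm_inv_fourier: "g \<in> weighted_L2 s \<Longrightarrow> sobolev_norm r (inv_fourier g) = weighted_norm r g"
  by (rule sobolev_norm_eq[OF has_fourier_inv_fourier])

text \<open>The fourth power of the Fourier transform is multiplication by (2 pi)^2, so its third
  power, rescaled, is an inverse.\<close>

lemma schwartz_eq_fourier:
  assumes "\<phi> \<in> schwartz"
  obtains \<eta> where "\<eta> \<in> schwartz" "\<phi> = fourier \<eta>" "\<And>k. \<eta> k = 1 / (2 * of_real pi) * fourier \<phi> (- k)"
proof
  define \<eta> where "\<eta> = (\<lambda>x. 1 / (2 * of_real pi)\<^sup>2 * fourier (fourier (fourier \<phi>)) x)"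
  show "\<eta> \<in> schwartz"
    unfolding \<eta>_def by (intro schwartz_cmult fourier_schwartz assms)
  show "\<eta> k = 1 / (2 * of_real pi) * fourier \<phi> (- k)" for k
    using fourier_fourier[OF fourier_schwartz[OF assms], of "- k"] by (simp add: \<eta>_def power2_eq_square)
  show "\<phi> = fourier \<eta>"
  proof
    fix x
    have "fourier \<eta> x = 1 / (2 * of_real pi)\<^sup>2 * fourier (fourier (fourier (fourier \<phi>))) (- (- x))"
      unfolding \<eta>_def fourier_cmult by simp
    also have "\<dots> = \<phi> x"
      unfolding fourier_fourier[OF fourier_schwartz[OF fourier_schwartz[OF assms]]]
        fourier_fourier[OF assms] by (simp add: power2_eq_square)
    finally show "\<phi> x = fourier \<eta> x" ..
  qed
qed

text \<open>\<open>has_fourier\<close> tests \<open>u\<close> only on transforms of Schwartz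
  functions. Since every Schwartz function is such a transform, \<open>u\<close> is determined by
  \<open>g\<close>.\<close>

lemma has_fourier_eq_inv_fourier:
  assumes "has_fourier u g" "\<phi> \<in> schwartz"
  shows "u \<phi> = inv_fourier g \<phi>"
proof -
  obtain \<eta> where \<eta>: "\<eta> \<in> schwartz" "\<phi> = fourier \<eta>" "\<And>k. \<eta> k = 1 / (2 * of_real pi) * fourier \<phi> (- k)"
    using schwartz_eq_fourier[OF assms(2)] by blast
  have "u \<phi> = (LBINT k. g k * \<eta> k)"
    using assms(1) \<eta>(1) unfolding \<eta>(2) by (simp add: has_fourier_def)
  also have "\<dots> = (LBINT k. 1 / (2 * of_real pi) * (g k * fourier \<phi> (- k)))"
    unfolding \<eta>(3) by (simp only: mult_ac)
  finally show ?thesis by (simp add: inv_fourier_def)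
qed

lemma continuous_into_inv_fourier:
  assumes "g \<in> weighted_L2 s" "q \<in> borel_measurable lborel"
    "\<And>b. u b = inv_fourier (\<lambda>k. iexp (q k * b) * g k)"
  shows "continuous_into (sobolev s) (sobolev_norm s) u"
proof -
  have W: "(\<lambda>k. iexp (q k * b) * g k) \<in> weighted_L2 s" for b
    by (rule weighted_L2_iexp) (use assms in auto)
  have "sobolev_norm s (\<lambda>\<phi>. u b \<phi> - u a \<phi>) = weighted_norm s (\<lambda>k. iexp (q k * b) * g k - iexp (q k * a) * g k)" for a b
    unfolding assms(3) by (intro sobolev_norm_eq has_fourier_diff has_fourier_inv_fourier[OF W])
  moreover have "u b \<in> sobolev s" for b
    unfolding assms(3) by (intro inv_fourier_sobolev W)
  ultimately show ?thesis
    unfolding continuous_into_def using weighted_norm_iexp_diff_tendsto[OF assms(1,2)] by simp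
qed

section \<open>Partial Fourier transforms of test functions of two variables\<close>

lemma test_functions_swap:
  fixes \<Phi> :: "real \<times> real \<Rightarrow> complex"
  assumes "\<Phi> \<in> test_functions UNIV"
  shows "(\<lambda>z. \<Phi> (prod.swap z)) \<in> test_functions UNIV"
    and "dir_deriv v (\<lambda>z. \<Phi> (prod.swap z)) = (\<lambda>z. dir_deriv (prod.swap v) \<Phi> (prod.swap z))"
proof -
  have L: "bounded_linear (prod.swap :: real \<times> real \<Rightarrow> _)"
    unfolding prod.swap_def by (intro bounded_linear_Pair bounded_linear_fst bounded_linear_snd)
  obtain M where M: "M > 0" "\<And>z. norm z > M \<Longrightarrow> \<Phi> z = 0"
    using test_functions_support[OF assms] by blast
  have "\<Phi> (prod.swap z) = 0" if "z \<notin> cball 0 M" for z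
    using that by (intro M) (cases z, simp add: norm_Pair add.commute)
  moreover have "smooth (\<lambda>z. \<Phi> (prod.swap z))"
    using smooth_affine[OF test_functionsD(1)[OF assms] L, of 0] by simp
  ultimately show "(\<lambda>z. \<Phi> (prod.swap z)) \<in> test_functions UNIV"
    by (auto simp: test_functions_def intro!: exI[of _ "cball 0 M"])
  show "dir_deriv v (\<lambda>z. \<Phi> (prod.swap z)) = (\<lambda>z. dir_deriv (prod.swap v) \<Phi> (prod.swap z))"
    using dir_deriv_affine[OF smooth_differentiable[OF test_functionsD(1)[OF assms]] L, of v 0] by simp
qed

lemma
  fixes \<Phi> :: "real \<times> real \<Rightarrow> complex"
  assumes "\<Phi> \<in> test_functions UNIV"
  shows slice_test_function: "(\<lambda>x. \<Phi> (x, t)) \<in> test_functions UNIV"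
    and slice_dir_deriv: "dir_deriv 1 (\<lambda>x. \<Phi> (x, t)) = (\<lambda>x. dir_deriv (1, 0) \<Phi> (x, t))"
proof -
  have L: "bounded_linear (\<lambda>x::real. (x, 0::real))"
    by (intro bounded_linear_Pair bounded_linear_ident bounded_linear_zero)
  obtain M where M: "M > 0" "\<And>z. norm z > M \<Longrightarrow> \<Phi> z = 0"
    using test_functions_support[OF assms] by blast
  have "\<Phi> (x, t) = 0" if "x \<notin> cball 0 M" for x
    using that norm_fst_le[of x t] by (intro M) auto
  moreover have "smooth (\<lambda>x. \<Phi> (x, t))"
    using smooth_affine[OF test_functionsD(1)[OF assms] L, of "(0, t)"] by simp
  ultimately show "(\<lambda>x. \<Phi> (x, t)) \<in> test_functions UNIV"
    by (auto simp: test_functions_def intro!: exI[of _ "cball 0 M"])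
  show "dir_deriv 1 (\<lambda>x. \<Phi> (x, t)) = (\<lambda>x. dir_deriv (1, 0) \<Phi> (x, t))"
    using dir_deriv_affine[OF smooth_differentiable[OF test_functionsD(1)[OF assms]] L, of 1 "(0, t)"] by simp
qed

lemma slice_Dn:
  fixes \<Phi> :: "real \<times> real \<Rightarrow> complex"
  assumes "\<Phi> \<in> test_functions UNIV"
  shows "Dn n (\<lambda>x. \<Phi> (x, t)) = (\<lambda>x. (dir_deriv (1, 0) ^^ n) \<Phi> (x, t))"
  by (induction n) (simp_all add: slice_dir_deriv[OF test_functions_dir_deriv_funpow[OF assms]])

text \<open>Each derivative of \<open>\<Phi>\<close> is bounded with support in one ball, so the L^1
  norms of the derivatives of the slices are bounded uniformly in t. The decay in k together with
  the indicator in t is a factorised majorant for Fubini.\<close>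

lemma slice_fourier_decay:
  fixes \<Phi> :: "real \<times> real \<Rightarrow> complex"
  assumes "\<Phi> \<in> test_functions UNIV"
  shows "\<exists>C M. 0 \<le> C \<and> (\<forall>t k. (1 + k\<^sup>2) ^ n * cmod (fourier (\<lambda>x. \<Phi> (x, t)) k) \<le> C * indicator {-M..M} t)"
proof -
  obtain M where M: "M > 0" "\<And>z. norm z > M \<Longrightarrow> \<Phi> z = 0"
    using test_functions_support[OF assms] by blast
  have "\<exists>C\<ge>0. \<forall>t. (LBINT x. cmod (Dn m (\<lambda>x. \<Phi> (x, t)) x)) \<le> C" for m
  proof -
    define \<Psi> where "\<Psi> = (dir_deriv (1, 0) ^^ m) \<Phi>"
    have \<Psi>: "\<Psi> \<in> test_functions UNIV"
      unfolding \<Psi>_def by (rule test_functions_dir_deriv_funpow[OF assms])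
    obtain B where B: "B \<ge> 0" "\<And>z. cmod (\<Psi> z) \<le> B"
      using test_functions_bounded[OF \<Psi>] by blast
    obtain N where N: "N > 0" "\<And>z. norm z > N \<Longrightarrow> \<Psi> z = 0"
      using test_functions_support[OF \<Psi>] by blast
    have "(1 + x\<^sup>2) * cmod (\<Psi> (x, t)) \<le> (1 + N\<^sup>2) * B" for x t
    proof (cases "\<bar>x\<bar> > N")
      case True
      then have "\<Psi> (x, t) = 0" using norm_fst_le[of x t] by (intro N) simp
      then show ?thesis using B by simp
    next
      case False
      then have "x\<^sup>2 \<le> N\<^sup>2" by (simp add: abs_le_square_iff[symmetric])
      then show ?thesis using B by (intro mult_mono) auto
    qed
    then have "(LBINT x. cmod (\<Psi> (x, t))) \<le> (1 + N\<^sup>2) * B * pi" for t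
      by (intro integral_norm_of_square_decay schwartz_measurable[OF test_functions_schwartz[OF slice_test_function[OF \<Psi>]]])
    then show ?thesis
      unfolding slice_Dn[OF assms] \<Psi>_def[symmetric] using B(1)
      by (intro exI[of _ "(1 + N\<^sup>2) * B * pi"]) (auto intro!: mult_nonneg_nonneg)
  qed
  then obtain C where C: "\<And>m. C m \<ge> 0" "\<And>m t. (LBINT x. cmod (Dn m (\<lambda>x. \<Phi> (x, t)) x)) \<le> C m"
    by metis
  have "(1 + k\<^sup>2) ^ n * cmod (fourier (\<lambda>x. \<Phi> (x, t)) k) \<le> 2 ^ n * (C 0 + C (2 * n)) * indicator {-M..M} t" for t k
  proof (cases "t \<in> {-M..M}")
    case True
    have "(1 + k\<^sup>2) ^ n * cmod (fourier (\<lambda>x. \<Phi> (x, t)) k)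
      \<le> 2 ^ n * ((LBINT x. cmod (\<Phi> (x, t))) + (LBINT x. cmod (Dn (2 * n) (\<lambda>x. \<Phi> (x, t)) x)))"
      by (rule fourier_decay[OF test_functions_schwartz[OF slice_test_function[OF assms]]])
    also have "\<dots> \<le> 2 ^ n * (C 0 + C (2 * n))"
      using C(2)[of 0] by (intro mult_left_mono add_mono C) auto
    finally show ?thesis using True by simp
  next
    case False
    then have "\<Phi> (x, t) = 0" for x
      using norm_snd_le[of t x] by (intro M) auto
    then have "fourier (\<lambda>x. \<Phi> (x, t)) k = 0" by (simp add: fourier_def)
    then show ?thesis using False by simp
  qed
  then show ?thesis
    using C(1) by (intro exI[of _ "2 ^ n * (C 0 + C (2 * n))"] exI[of _ M]) auto
qed

text \<open>\<open>a\<close> is the frequency in time and \<open>b\<close> the one in space,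
  although space is the first coordinate. The sign is opposite to that of \<open>fourier\<close>:
  \<open>\<Phi>\<close> is paired with the plane wave exp(i (a t + b x)).\<close>

definition fourier2 :: "real \<Rightarrow> real \<Rightarrow> (real \<times> real \<Rightarrow> complex) \<Rightarrow> complex" where
  "fourier2 a b \<Phi> = (LBINT z. iexp (a * snd z + b * fst z) * \<Phi> z)"

lemma test_functions_measurable: "\<Phi> \<in> test_functions U \<Longrightarrow> \<Phi> \<in> borel_measurable borel"
  using test_functions_integrable[of \<Phi> U] borel_measurable_integrable by fastforce

lemma fourier2_integrable:
  fixes \<Phi> :: "real \<times> real \<Rightarrow> complex"
  assumes "\<Phi> \<in> test_functions UNIV"
  shows "integrable lborel (\<lambda>z. iexp (a * snd z + b * fst z) * \<Phi> z)"
proof (rule Bochner_Integration.integrable_bound[OF test_functions_integrable[OF assms]])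
  have "(\<lambda>z::real\<times>real. iexp (a * snd z + b * fst z)) \<in> borel_measurable borel"
    by (intro borel_measurable_continuous_onI continuous_intros)
  then show "(\<lambda>z. iexp (a * snd z + b * fst z) * \<Phi> z) \<in> borel_measurable lborel"
    using test_functions_measurable[OF assms] by simp
  show "AE z in lborel. norm (iexp (a * snd z + b * fst z) * \<Phi> z) \<le> norm (\<Phi> z)"
    unfolding norm_mult norm_iexp by simp
qed

lemma
  assumes "\<Phi> \<in> test_functions UNIV"
  shows fourier2_iterated: "fourier2 a b \<Phi> = (LBINT t. iexp (a * t) * fourier (\<lambda>x. \<Phi> (x, t)) (- b))"
    and fourier2_swap: "fourier2 b a (\<lambda>z. \<Phi> (prod.swap z)) = fourier2 a b \<Phi>"
proof -
  have iter: "fourier2 a b \<Phi> = (LBINT x. LBINT t. iexp (a * t + b * x) * \<Phi> (x, t))"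
    "fourier2 a b \<Phi> = (LBINT t. LBINT x. iexp (a * t + b * x) * \<Phi> (x, t))"
    if "\<Phi> \<in> test_functions UNIV" for a b \<Phi>
  proof -
    have i: "integrable (lborel \<Otimes>\<^sub>M lborel) (\<lambda>(x, t). iexp (a * t + b * x) * \<Phi> (x, t))"
      using fourier2_integrable[OF that, of a b] unfolding lborel_prod by (simp add: case_prod_beta')
    show "fourier2 a b \<Phi> = (LBINT x. LBINT t. iexp (a * t + b * x) * \<Phi> (x, t))"
      unfolding lborel_pair.integral_fst[OF i] unfolding lborel_prod fourier2_def
      by (simp add: case_prod_beta')
    show "fourier2 a b \<Phi> = (LBINT t. LBINT x. iexp (a * t + b * x) * \<Phi> (x, t))"
      unfolding lborel_pair.integral_snd[OF i] unfolding lborel_prod fourier2_def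
      by (simp add: case_prod_beta')
  qed
  show "fourier2 b a (\<lambda>z. \<Phi> (prod.swap z)) = fourier2 a b \<Phi>"
    unfolding iter(1)[OF test_functions_swap(1)[OF assms]] iter(2)[OF assms]
    by (simp add: add.commute)
  have "(LBINT x. iexp (a * t + b * x) * \<Phi> (x, t)) = iexp (a * t) * fourier (\<lambda>x. \<Phi> (x, t)) (- b)" for t
  proof -
    have "(LBINT x. iexp (a * t + b * x) * \<Phi> (x, t)) = (LBINT x. iexp (a * t) * (iexp (- x * - b) * \<Phi> (x, t)))"
      unfolding iexp_add by (intro Bochner_Integration.integral_cong) (auto simp: mult_ac)
    then show ?thesis unfolding fourier_iexp by simp
  qed
  then show "fourier2 a b \<Phi> = (LBINT t. iexp (a * t) * fourier (\<lambda>x. \<Phi> (x, t)) (- b))"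
    by (simp add: iter(2)[OF assms])
qed

lemma fourier2_add:
  assumes "\<Phi> \<in> test_functions UNIV" "\<Psi> \<in> test_functions UNIV"
  shows "fourier2 a b (\<lambda>z. \<Phi> z + \<Psi> z) = fourier2 a b \<Phi> + fourier2 a b \<Psi>"
  unfolding fourier2_def distrib_left
  by (intro Bochner_Integration.integral_add fourier2_integrable assms)

lemma fourier2_cmult: "fourier2 a b (\<lambda>z. c * \<Phi> z) = c * fourier2 a b \<Phi>"
  unfolding fourier2_def mult.left_commute[of _ c] by (rule integral_mult_right_zero)

lemma fourier2_dir_deriv_fst:
  fixes \<Phi> :: "real \<times> real \<Rightarrow> complex"
  assumes "\<Phi> \<in> test_functions UNIV"
  shows "fourier2 a b (dir_deriv (1, 0) \<Phi>) = - \<i> * of_real b * fourier2 a b \<Phi>"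
proof -
  have "fourier (\<lambda>x. dir_deriv (1, 0) \<Phi> (x, t)) (- b) = - \<i> * of_real b * fourier (\<lambda>x. \<Phi> (x, t)) (- b)" for t
    using fourier_dir_deriv[OF test_functions_schwartz[OF slice_test_function[OF assms]]]
    by (simp add: slice_dir_deriv[OF assms])
  then show ?thesis
    unfolding fourier2_iterated[OF assms] fourier2_iterated[OF test_functions_dir_deriv[OF assms]]
    by (simp only: mult.left_commute integral_mult_right_zero)
qed

lemma fourier2_dir_deriv_snd:
  fixes \<Phi> :: "real \<times> real \<Rightarrow> complex"
  assumes "\<Phi> \<in> test_functions UNIV"
  shows "fourier2 a b (dir_deriv (0, 1) \<Phi>) = - \<i> * of_real a * fourier2 a b \<Phi>"
proof -
  have "fourier2 a b (dir_deriv (0, 1) \<Phi>) = fourier2 b a (dir_deriv (1, 0) (\<lambda>z. \<Phi> (prod.swap z)))"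
    unfolding test_functions_swap(2)[OF assms]
    by (simp add: fourier2_swap[OF test_functions_dir_deriv[OF assms]])
  also have "\<dots> = - \<i> * of_real a * fourier2 a b \<Phi>"
    by (simp add: fourier2_dir_deriv_fst[OF test_functions_swap(1)[OF assms]] fourier2_swap[OF assms])
  finally show ?thesis .
qed

text \<open>One computation for both descriptions of the solution: distributions in x indexed by
  time, with \<open>a\<close> the phase and \<open>b\<close> the identity, and distributions in t
  indexed by space, with the two exchanged. The hypothesis \<open>int\<close> is what remains after
  the decay of the slices in the frequency \<open>b k\<close> has been spent.\<close>

lemma
  fixes a b :: "real \<Rightarrow> real"
  assumes \<Phi>: "\<Phi> \<in> test_functions UNIV"
    and [measurable]: "a \<in> borel_measurable lborel" "b \<in> borel_measurable lborel" "g \<in> borel_measurable lborel"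
    and int: "integrable lborel (\<lambda>k. cmod (g k) / (1 + (b k)\<^sup>2) ^ n)"
  shows oscillatory_slices_integrable:
      "integrable lborel (\<lambda>t. LBINT k. iexp (a k * t) * g k * fourier (\<lambda>x. \<Phi> (x, t)) (- b k))"
    and oscillatory_slices_integral:
      "(LBINT t. LBINT k. iexp (a k * t) * g k * fourier (\<lambda>x. \<Phi> (x, t)) (- b k)) =
       (LBINT k. g k * fourier2 (a k) (b k) \<Phi>)"
proof -
  obtain C M where C: "0 \<le> C"
    "\<And>t k. (1 + k\<^sup>2) ^ n * cmod (fourier (\<lambda>x. \<Phi> (x, t)) k) \<le> C * indicator {-M..M} t"
    using slice_fourier_decay[OF \<Phi>] by blast
  define F where "F t k = iexp (a k * t) * g k * fourier (\<lambda>x. \<Phi> (x, t)) (- b k)" for t k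
  have [measurable]: "\<Phi> \<in> borel_measurable (borel \<Otimes>\<^sub>M borel)"
    using test_functions_measurable[OF \<Phi>] by (simp add: borel_prod)
  have meas: "case_prod F \<in> borel_measurable (lborel \<Otimes>\<^sub>M lborel)"
    unfolding F_def fourier_iexp by measurable
  have u: "integrable lborel (indicator {-M..M} :: real \<Rightarrow> real)"
    by (rule integrable_real_indicator) (auto simp: emeasure_lborel_Icc_eq)
  have v: "integrable lborel (\<lambda>k. C * (cmod (g k) / (1 + (b k)\<^sup>2) ^ n))"
    by (rule integrable_mult_right[OF int])
  have bound: "norm (F t k) \<le> indicator {-M..M} t * (C * (cmod (g k) / (1 + (b k)\<^sup>2) ^ n))" for t k
  proof -
    have pos: "(1 + (b k)\<^sup>2) ^ n > 0" by (intro zero_less_power) (simp add: add_pos_nonneg)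
    have "cmod (fourier (\<lambda>x. \<Phi> (x, t)) (- b k)) \<le> C * indicator {-M..M} t / (1 + (b k)\<^sup>2) ^ n"
      using C(2)[of "- b k" t] pos by (simp add: pos_le_divide_eq mult.commute)
    from mult_left_mono[OF this, of "cmod (g k)"] show ?thesis
      unfolding F_def norm_mult norm_iexp by (simp add: mult_ac)
  qed
  note pair = integrable_pair_of_product_bound[OF meas u v bound] Fubini_of_product_bound[OF meas u v bound]
  show "integrable lborel (\<lambda>t. LBINT k. iexp (a k * t) * g k * fourier (\<lambda>x. \<Phi> (x, t)) (- b k))"
    using lborel_pair.integrable_fst[OF pair(1)] by (simp only: F_def)
  have "(LBINT t. LBINT k. F t k) = (LBINT k. LBINT t. F t k)" by (rule pair(2)[symmetric])
  also have "\<dots> = (LBINT k. g k * fourier2 (a k) (b k) \<Phi>)"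
    unfolding F_def fourier2_iterated[OF \<Phi>] mult.assoc mult.left_commute[of _ "g _"]
    by (simp only: integral_mult_right_zero)
  finally show "(LBINT t. LBINT k. iexp (a k * t) * g k * fourier (\<lambda>x. \<Phi> (x, t)) (- b k)) =
       (LBINT k. g k * fourier2 (a k) (b k) \<Phi>)"
    by (simp only: F_def)
qed

section \<open>The solution operator\<close>

text \<open>\<open>omega\<close> is \<open>- \<i>\<close> times this real polynomial, which makes
  the evolution factor unimodular.\<close>

definition phase :: "real \<Rightarrow> real \<Rightarrow> real \<Rightarrow> real \<Rightarrow> real" where
  "phase \<alpha> \<beta> \<delta> k = \<beta> * k ^ 3 - \<alpha> * k\<^sup>2 - \<delta> * k"

lemma phase_measurable [measurable]: "phase \<alpha> \<beta> \<delta> \<in> borel_measurable borel"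
  unfolding phase_def by measurable

lemma exp_omega: "exp (- omega \<alpha> \<beta> \<delta> k * of_real t) = iexp (phase \<alpha> \<beta> \<delta> k * t)"
  by (simp add: omega_def phase_def algebra_simps)

lemma solution_op_eq:
  "solution_op \<alpha> \<beta> \<delta> y0 t = inv_fourier (\<lambda>k. iexp (phase \<alpha> \<beta> \<delta> k * t) * dist_fourier y0 k)"
  unfolding solution_op_def inv_fourier_def exp_omega fourier_def by simp

lemma
  assumes "y0 \<in> sobolev s"
  shows solution_op_continuous: "continuous_into (sobolev s) (sobolev_norm s) (solution_op \<alpha> \<beta> \<delta> y0)"
    and solution_op_norm: "sobolev_norm s (solution_op \<alpha> \<beta> \<delta> y0 t) = sobolev_norm s y0"
    and solution_op_initial: "\<phi> \<in> schwartz \<Longrightarrow> solution_op \<alpha> \<beta> \<delta> y0 0 \<phi> = y0 \<phi>"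
proof -
  note g = sobolev_dist_fourier[OF assms]
  show "continuous_into (sobolev s) (sobolev_norm s) (solution_op \<alpha> \<beta> \<delta> y0)"
    by (rule continuous_into_inv_fourier[OF g(2) _ solution_op_eq]) simp
  have W: "(\<lambda>k. iexp (phase \<alpha> \<beta> \<delta> k * t) * dist_fourier y0 k) \<in> weighted_L2 s"
    by (rule weighted_L2_iexp[OF g(2)]) simp
  have "weighted_norm s (\<lambda>k. iexp (phase \<alpha> \<beta> \<delta> k * t) * dist_fourier y0 k) = weighted_norm s (dist_fourier y0)"
    by (rule weighted_norm_iexp[OF g(2)]) simp
  then show "sobolev_norm s (solution_op \<alpha> \<beta> \<delta> y0 t) = sobolev_norm s y0"
    unfolding solution_op_eq sobolev_norm_inv_fourier[OF W] sobolev_norm_eq[OF g(1)] .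
  show "solution_op \<alpha> \<beta> \<delta> y0 0 \<phi> = y0 \<phi>" if "\<phi> \<in> schwartz"
    using has_fourier_eq_inv_fourier[OF g(1) that] by (simp add: solution_op_eq)
qed

text \<open>Derivatives become multiplications, and the symbol of the transposed operator is -a +
  p(b) in the frequencies (a, b). It vanishes at a = p(k), b = k, the frequencies of the plane waves
  that solve the equation.\<close>

lemma
  assumes \<Phi>: "\<Phi> \<in> test_functions UNIV"
  shows transpose_op_test_function: "transpose_op \<alpha> \<beta> \<delta> \<Phi> \<in> test_functions UNIV"
    and fourier2_transpose_op_eq_0: "fourier2 (phase \<alpha> \<beta> \<delta> k) k (transpose_op \<alpha> \<beta> \<delta> \<Phi>) = 0"
proof -
  note tf = test_functions_mult[OF test_functions_dir_deriv_funpow[OF \<Phi>] smooth_const]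
    test_functions_mult[OF test_functions_dir_deriv[OF \<Phi>] smooth_const]
  have eq: "transpose_op \<alpha> \<beta> \<delta> \<Phi> = (\<lambda>z. ((- \<i> * dir_deriv (0, 1) \<Phi> z
     + (- \<i> * complex_of_real \<beta>) * (dir_deriv (1, 0) ^^ 3) \<Phi> z)
     + complex_of_real \<alpha> * (dir_deriv (1, 0) ^^ 2) \<Phi> z)
     + (- \<i> * complex_of_real \<delta>) * dir_deriv (1, 0) \<Phi> z)"
    by (rule ext) (simp add: transpose_op_def)
  show "transpose_op \<alpha> \<beta> \<delta> \<Phi> \<in> test_functions UNIV"
    unfolding eq by (intro test_functions_add tf)
  have pow: "fourier2 a b ((dir_deriv (1, 0) ^^ n) \<Phi>) = (- \<i> * of_real b) ^ n * fourier2 a b \<Phi>" for a b n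
    by (induction n) (simp_all add: fourier2_dir_deriv_fst[OF test_functions_dir_deriv_funpow[OF \<Phi>]])
  have "fourier2 (phase \<alpha> \<beta> \<delta> k) k (transpose_op \<alpha> \<beta> \<delta> \<Phi>) =
    - \<i> * (- \<i> * of_real (phase \<alpha> \<beta> \<delta> k) * fourier2 (phase \<alpha> \<beta> \<delta> k) k \<Phi>)
    + (- \<i> * complex_of_real \<beta>) * ((- \<i> * of_real k) ^ 3 * fourier2 (phase \<alpha> \<beta> \<delta> k) k \<Phi>)
    + complex_of_real \<alpha> * ((- \<i> * of_real k) ^ 2 * fourier2 (phase \<alpha> \<beta> \<delta> k) k \<Phi>)
    + (- \<i> * complex_of_real \<delta>) * (- \<i> * of_real k * fourier2 (phase \<alpha> \<beta> \<delta> k) k \<Phi>)"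
    unfolding eq
    by (subst fourier2_add, intro test_functions_add tf, intro tf)+
      (simp only: fourier2_cmult pow fourier2_dir_deriv_fst[OF \<Phi>] fourier2_dir_deriv_snd[OF \<Phi>])
  also have "\<dots> = 0"
    by (simp add: phase_def power3_eq_cube power2_eq_square algebra_simps)
  finally show "fourier2 (phase \<alpha> \<beta> \<delta> k) k (transpose_op \<alpha> \<beta> \<delta> \<Phi>) = 0" .
qed

lemma weighted_L2_integrable_quotient:
  assumes "g \<in> weighted_L2 s" and n: "- s + 1 \<le> 2 * real n"
  shows "integrable lborel (\<lambda>k. cmod (g k) / (1 + k\<^sup>2) ^ n)"
proof -
  have pos: "(1 + (k::real)\<^sup>2) ^ n > 0" for k by (intro zero_less_power) (simp add: add_pos_nonneg)
  have "(\<lambda>k. 1 / complex_of_real ((1 + k\<^sup>2) ^ n)) \<in> weighted_L2 (- s)"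
    by (rule weighted_L2_of_decay(1)[OF _ zero_le_one n])
      (use pos in \<open>auto simp: norm_divide simp del: of_real_power of_real_add\<close>)
  from integrable_norm[OF weighted_L2_pairing_integrable[OF assms(1) this]]
  show ?thesis
    using pos by (simp add: norm_mult norm_divide less_imp_le del: of_real_power of_real_add)
qed

lemma
  assumes g: "g \<in> weighted_L2 s" and \<Phi>: "\<Phi> \<in> test_functions UNIV"
    and y: "\<And>t. y t = inv_fourier (\<lambda>k. iexp (phase \<alpha> \<beta> \<delta> k * t) * g k)"
  shows inv_fourier_slices_integrable: "integrable lborel (\<lambda>t. y t (\<lambda>x. \<Phi> (x, t)))"
    and inv_fourier_slices_integral: "(LBINT t. y t (\<lambda>x. \<Phi> (x, t))) =
      1 / (2 * of_real pi) * (LBINT k. g k * fourier2 (phase \<alpha> \<beta> \<delta> k) k \<Phi>)"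
proof -
  obtain n where "- s + 1 \<le> 2 * real n" by (rule exists_exponent)
  note n = weighted_L2_integrable_quotient[OF g this]
  note * = oscillatory_slices_integrable[OF \<Phi> _ _ weighted_L2_measurable[OF g] n, of "phase \<alpha> \<beta> \<delta>"]
    oscillatory_slices_integral[OF \<Phi> _ _ weighted_L2_measurable[OF g] n, of "phase \<alpha> \<beta> \<delta>"]
  show "integrable lborel (\<lambda>t. y t (\<lambda>x. \<Phi> (x, t)))"
    unfolding y inv_fourier_def by (intro integrable_mult_right *) simp_all
  show "(LBINT t. y t (\<lambda>x. \<Phi> (x, t))) =
      1 / (2 * of_real pi) * (LBINT k. g k * fourier2 (phase \<alpha> \<beta> \<delta> k) k \<Phi>)"
    unfolding y inv_fourier_def integral_mult_right_zero by (subst *) simp_all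
qed

lemma solution_op_cauchy_solution:
  assumes "y0 \<in> sobolev s"
  shows "cauchy_solution \<alpha> \<beta> \<delta> y0 (solution_op \<alpha> \<beta> \<delta> y0)"
  unfolding cauchy_solution_def
proof (intro conjI exI ballI)
  show "continuous_into (sobolev s) (sobolev_norm s) (solution_op \<alpha> \<beta> \<delta> y0)"
    by (rule solution_op_continuous[OF assms])
  show "solution_op \<alpha> \<beta> \<delta> y0 0 \<phi> = y0 \<phi>" if "\<phi> \<in> schwartz" for \<phi>
    by (rule solution_op_initial[OF assms that])
  note * = inv_fourier_slices_integrable[OF sobolev_dist_fourier(2)[OF assms] transpose_op_test_function solution_op_eq]
    inv_fourier_slices_integral[OF sobolev_dist_fourier(2)[OF assms] transpose_op_test_function solution_op_eq]
  show "solves_equation \<alpha> \<beta> \<delta> (solution_op \<alpha> \<beta> \<delta> y0)"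
    unfolding solves_equation_def using * by (simp add: fourier2_transpose_op_eq_0)
qed

section \<open>Uniqueness for the Cauchy problem\<close>

text \<open>Minkowski's inequality from the elementary bound \<open>young\<close>, which is sharp
  when x and y are the two norms. As a norm may vanish, strictly larger numbers are used first, at
  the price of a final epsilon.\<close>

lemma weighted_norm_triangle:
  assumes "g \<in> weighted_L2 s" "h \<in> weighted_L2 s"
  shows "weighted_norm s (\<lambda>k. g k + h k) \<le> weighted_norm s g + weighted_norm s h"
proof -
  have *: "weighted_norm s (\<lambda>k. g k + h k) \<le> x + y"
    if x: "weighted_norm s g < x" and y: "weighted_norm s h < y" for x y
  proof -
    have pos: "0 < x" "0 < y" using x y weighted_norm_nonneg by (meson le_less_trans)+
    have young: "(a + b)\<^sup>2 \<le> (1 + y / x) * a\<^sup>2 + (1 + x / y) * b\<^sup>2" for a b :: real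
    proof -
      have "(1 + y / x) * a\<^sup>2 + (1 + x / y) * b\<^sup>2 - (a + b)\<^sup>2 = (y * a - x * b)\<^sup>2 / (x * y)"
        using pos by (simp add: field_simps power2_eq_square)
      moreover have "0 \<le> (y * a - x * b)\<^sup>2 / (x * y)" using pos by simp
      ultimately show ?thesis by linarith
    qed
    have "(weighted_norm s (\<lambda>k. g k + h k))\<^sup>2 \<le>
      (LBINT k. (1 + y / x) * ((1 + k\<^sup>2) powr s * (cmod (g k))\<^sup>2) + (1 + x / y) * ((1 + k\<^sup>2) powr s * (cmod (h k))\<^sup>2))"
      unfolding weighted_norm_square
    proof (rule integral_mono)
      fix k
      have "(cmod (g k + h k))\<^sup>2 \<le> (cmod (g k) + cmod (h k))\<^sup>2"
        by (intro power_mono norm_triangle_ineq) simp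
      also note young
      finally have "(1 + k\<^sup>2) powr s * (cmod (g k + h k))\<^sup>2 \<le>
        (1 + k\<^sup>2) powr s * ((1 + y / x) * (cmod (g k))\<^sup>2 + (1 + x / y) * (cmod (h k))\<^sup>2)"
        by (rule mult_left_mono) simp
      also have "\<dots> = (1 + y / x) * ((1 + k\<^sup>2) powr s * (cmod (g k))\<^sup>2) + (1 + x / y) * ((1 + k\<^sup>2) powr s * (cmod (h k))\<^sup>2)"
        by (simp only: distrib_left mult.left_commute)
      finally show "(1 + k\<^sup>2) powr s * (cmod (g k + h k))\<^sup>2 \<le> \<dots>" .
    qed (intro Bochner_Integration.integrable_add integrable_mult_right weighted_L2_integrable weighted_L2_add assms)+
    also have "\<dots> = (1 + y / x) * (weighted_norm s g)\<^sup>2 + (1 + x / y) * (weighted_norm s h)\<^sup>2"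
      unfolding weighted_norm_square
      using weighted_L2_integrable[OF assms(1)] weighted_L2_integrable[OF assms(2)] by simp
    also have "\<dots> \<le> (1 + y / x) * x\<^sup>2 + (1 + x / y) * y\<^sup>2"
      using x y pos weighted_norm_nonneg by (intro add_mono mult_left_mono power_mono) auto
    also have "\<dots> = (x + y)\<^sup>2"
      using pos by (simp add: field_simps power2_eq_square)
    finally show ?thesis
      by (rule power2_le_imp_le) (use pos in simp)
  qed
  show ?thesis
  proof (rule field_le_epsilon)
    fix e :: real assume "e > 0"
    then show "weighted_norm s (\<lambda>k. g k + h k) \<le> weighted_norm s g + weighted_norm s h + e"
      using *[of "weighted_norm s g + e / 2" "weighted_norm s h + e / 2"] by simp
  qed
qed

section \<open>Continuous curves in a weighted space\<close>

lemma continuous_bounded_on_interval: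
  fixes f :: "real \<Rightarrow> 'a::real_normed_vector"
  assumes "continuous_on {a..b} f"
  obtains C where "\<And>x. x \<in> {a..b} \<Longrightarrow> norm (f x) \<le> C"
proof -
  have "bounded (f ` {a..b})"
    by (intro compact_imp_bounded compact_continuous_image assms) simp
  then show ?thesis using that unfolding bounded_iff by blast
qed

lemma weighted_norm_minus: "weighted_norm s (\<lambda>k. - g k) = weighted_norm s g"
  by (simp add: weighted_norm_def)

text \<open>The condition \<open>continuous_into (sobolev r) (sobolev_norm r)\<close> as it reads on
  the Fourier side, for chosen representatives \<open>g t\<close> of the transforms.\<close>

definition weighted_continuous :: "real \<Rightarrow> (real \<Rightarrow> real \<Rightarrow> complex) \<Rightarrow> bool" where
  "weighted_continuous r g \<longleftrightarrow> (\<forall>t. g t \<in> weighted_L2 r) \<and>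
     (\<forall>a. ((\<lambda>b. weighted_norm r (\<lambda>k. g b k - g a k)) \<longlongrightarrow> 0) (at a))"

lemma weighted_continuousD:
  assumes "weighted_continuous r g"
  shows "g t \<in> weighted_L2 r" "((\<lambda>b. weighted_norm r (\<lambda>k. g b k - g a k)) \<longlongrightarrow> 0) (at a)"
  using assms by (auto simp: weighted_continuous_def)

text \<open>The triangle inequality, used in both directions, makes the norm continuous in t. The
  bound on compact time intervals is what later dominates pairings under an integral in t.\<close>

lemma weighted_continuous_bounded:
  assumes "weighted_continuous r g"
  obtains B where "0 \<le> B" "\<And>t. \<bar>t\<bar> \<le> M \<Longrightarrow> weighted_norm r (g t) \<le> B"
proof -
  note g = weighted_continuousD[OF assms]
  have le: "weighted_norm r (g b) \<le> weighted_norm r (g a) + weighted_norm r (\<lambda>k. g b k - g a k)" for a b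
    using weighted_norm_triangle[OF g(1)[of a] weighted_L2_diff[OF g(1)[of b] g(1)[of a]]] by simp
  have sym: "weighted_norm r (\<lambda>k. g b k - g a k) = weighted_norm r (\<lambda>k. g a k - g b k)" for a b
    using weighted_norm_minus[of r "\<lambda>k. g b k - g a k"] by simp
  have "((\<lambda>b. weighted_norm r (g b) - weighted_norm r (g a)) \<longlongrightarrow> 0) (at a)" for a
  proof (rule Lim_null_comparison[OF _ g(2)[of a]])
    show "\<forall>\<^sub>F b in at a. norm (weighted_norm r (g b) - weighted_norm r (g a)) \<le> weighted_norm r (\<lambda>k. g b k - g a k)"
      using le[of _ a] le[of a] sym[of _ a] by (intro always_eventually allI) (simp add: abs_le_iff algebra_simps)
  qed
  then have "continuous_on {-M..M} (\<lambda>b. weighted_norm r (g b))"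
    by (intro continuous_at_imp_continuous_on ballI) (simp add: isCont_def LIM_zero_iff)
  then obtain B where "\<And>t. t \<in> {-M..M} \<Longrightarrow> norm (weighted_norm r (g t)) \<le> B"
    using continuous_bounded_on_interval by blast
  then show ?thesis
    by (intro that[of "max 0 B"]) (auto simp: abs_le_iff le_max_iff_disj weighted_norm_nonneg)
qed

lemma pairing_diff:
  assumes "g \<in> weighted_L2 s" "h \<in> weighted_L2 s" "\<psi> \<in> weighted_L2 (- s)"
  shows "(LBINT k. (g k - h k) * \<psi> k) = (LBINT k. g k * \<psi> k) - (LBINT k. h k * \<psi> k)"
  unfolding left_diff_distrib
  by (intro Bochner_Integration.integral_diff weighted_L2_pairing_integrable[OF _ assms(3)] assms)

lemma weighted_continuous_pairing:
  assumes "weighted_continuous r g" "\<psi> \<in> weighted_L2 (- r)"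
  shows "continuous_on UNIV (\<lambda>t. LBINT k. g t k * \<psi> k)"
proof (intro continuous_at_imp_continuous_on ballI)
  note g = weighted_continuousD[OF assms(1)]
  fix a
  have "((\<lambda>b. (LBINT k. g b k * \<psi> k) - (LBINT k. g a k * \<psi> k)) \<longlongrightarrow> 0) (at a)"
  proof (rule Lim_null_comparison)
    show "\<forall>\<^sub>F b in at a. norm ((LBINT k. g b k * \<psi> k) - (LBINT k. g a k * \<psi> k))
        \<le> weighted_norm r (\<lambda>k. g b k - g a k) * weighted_norm (- r) \<psi>"
      unfolding pairing_diff[OF g(1) g(1) assms(2), symmetric]
      by (intro always_eventually allI weighted_L2_pairing weighted_L2_diff g assms)
    show "((\<lambda>b. weighted_norm r (\<lambda>k. g b k - g a k) * weighted_norm (- r) \<psi>) \<longlongrightarrow> 0) (at a)"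
      using tendsto_mult_left_zero[OF g(2)] .
  qed
  then show "isCont (\<lambda>t. LBINT k. g t k * \<psi> k) a"
    by (simp add: isCont_def LIM_zero_iff)
qed

section \<open>Weak derivatives on the line\<close>

lemma test_function_antiderivative:
  fixes w :: "real \<Rightarrow> complex"
  assumes "w \<in> test_functions UNIV" "(LBINT t. w t) = 0"
  obtains \<theta> where "\<theta> \<in> test_functions UNIV" "dir_deriv 1 \<theta> = w"
proof -
  note w = test_functionsD(1)[OF assms(1)]
  obtain M0 where M0: "M0 > 0" "\<And>x. norm x > M0 \<Longrightarrow> w x = 0"
    using test_functions_support[OF assms(1)] by blast
  \<comment> \<open>Enlarged by 1 so that \<open>w\<close> vanishes at the endpoints of [-M, M] as
    well.\<close>
  define M where "M = M0 + 1"
  have M: "M > 0" "\<And>x. \<bar>x\<bar> \<ge> M \<Longrightarrow> w x = 0" using M0 by (auto simp: M_def)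
  obtain F where F: "\<And>x. (F has_vector_derivative w x) (at x)"
    using einterval_antiderivative[of "-\<infinity>" "\<infinity>" w] smooth_continuous[OF w, of UNIV]
    by (auto simp: continuous_on_eq_continuous_at)
  have FTC: "(LBINT x. indicator {a..b} x *\<^sub>R w x) = F b - F a" if "a \<le> b" for a b
  proof (rule integral_FTC_Icc[OF that])
    show "(F has_vector_derivative w x) (at x within {a..b})" for x
      by (rule has_vector_derivative_at_within[OF F])
    show "continuous_on {a..b} w" by (rule smooth_continuous[OF w])
  qed
  define \<theta> where "\<theta> t = F t - F (- M)" for t
  have \<theta>: "(\<theta> has_vector_derivative w x) (at x)" for x
    using has_vector_derivative_diff[OF F[of x] has_vector_derivative_const[of "F (- M)"]]
    by (simp add: \<theta>_def[abs_def])
  \<comment> \<open>The antiderivative is put in front of the derivatives of \<open>w\<close>, so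
    that a single sequence yields its smoothness.\<close>
  define D where "D n = (if n = 0 then \<theta> else Dn (n - 1) w)" for n
  have "(D n has_vector_derivative D (Suc n) x) (at x)" for n x
    using \<theta> Dn_has_vector_derivative[OF w, of "n - 1" x] by (cases n) (auto simp: D_def)
  from smooth_derivative_sequence(1)[where F = D, OF this, of 0] have "smooth \<theta>"
    by (simp add: D_def)
  moreover have "\<theta> t = 0" if "t \<notin> {-M..M}" for t
  proof (cases "t < - M")
    case True
    have "(LBINT x. indicator {t..-M} x *\<^sub>R w x) = F (- M) - F t"
      using True by (intro FTC) simp
    moreover have "indicator {t..-M} x *\<^sub>R w x = 0" for x
      using M by (auto simp: indicator_def)
    ultimately show ?thesis by (simp add: \<theta>_def)
  next
    \<comment> \<open>Beyond M the antiderivative has collected the whole integral of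
      \<open>w\<close>, which is 0.\<close>
    case False
    with that have "t > M" by auto
    have "(LBINT x. indicator {-M..t} x *\<^sub>R w x) = F t - F (- M)"
      using \<open>t > M\<close> M(1) by (intro FTC) simp
    moreover have "indicator {-M..t} x *\<^sub>R w x = w x" for x
      using M(2)[of x] \<open>t > M\<close> by (auto simp: indicator_def)
    ultimately show ?thesis using assms(2) by (simp add: \<theta>_def)
  qed
  ultimately have "\<theta> \<in> test_functions UNIV"
    by (auto simp: test_functions_def intro!: exI[of _ "{-M..M}"])
  moreover have "dir_deriv 1 \<theta> = w"
    using has_vector_derivative_dir_deriv[OF \<theta>] by auto
  ultimately show ?thesis by (rule that)
qed

lemma test_function_times_continuous_integrable:
  fixes C :: "real \<Rightarrow> complex"
  assumes "\<theta> \<in> test_functions UNIV" "continuous_on UNIV C"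
  shows "integrable lborel (\<lambda>t. \<theta> t * C t)"
proof -
  obtain K where K: "compact K" "\<And>x. x \<notin> K \<Longrightarrow> \<theta> x = 0"
    using test_functionsD(2)[OF assms(1)] by blast
  have "integrable lborel (\<lambda>x. indicator K x *\<^sub>R (\<theta> x * C x))"
    by (intro borel_integrable_compact K(1) continuous_on_mult smooth_continuous
        test_functionsD(1)[OF assms(1)] continuous_on_subset[OF assms(2)]) simp
  also have "(\<lambda>x. indicator K x *\<^sub>R (\<theta> x * C x)) = (\<lambda>t. \<theta> t * C t)"
    using K(2) by (auto simp: indicator_def)
  finally show ?thesis .
qed

lemma normalised_bump:
  obtains \<rho> :: "real \<Rightarrow> complex" where "\<rho> \<in> test_functions UNIV" "\<And>x. 1 < \<bar>x\<bar> \<Longrightarrow> \<rho> x = 0" "(LBINT x. \<rho> x) = 1"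
proof -
  define \<rho>0 where "\<rho>0 = (\<lambda>x. complex_of_real (bump 1 (-1) 1 x))"
  have \<rho>0: "\<rho>0 \<in> test_functions UNIV"
    unfolding \<rho>0_def by (rule bump_test_function) auto
  \<comment> \<open>A nonnegative function with integral 0 vanishes almost everywhere, whereas the
    bump is positive on (-1, 1).\<close>
  have nz: "(LBINT x. \<rho>0 x) \<noteq> 0"
  proof
    assume "(LBINT x. \<rho>0 x) = 0"
    have i: "integrable lborel (bump 1 (-1) 1)"
      using integrable_Re[OF test_functions_integrable[OF \<rho>0]] by (simp add: \<rho>0_def)
    have "(LBINT x. bump 1 (-1) 1 x) = 0"
      using \<open>(LBINT x. \<rho>0 x) = 0\<close> by (simp add: \<rho>0_def)
    then have "AE x in lborel. bump 1 (-1) 1 x = 0"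
      using integral_nonneg_eq_0_iff_AE[OF i] bump_nonneg by auto
    then have "AE x in lborel. x \<notin> {-1<..<1::real}"
      by eventually_elim (use bump_pos[of 1 _ "-1" 1] in force)
    then have "emeasure lborel {-1<..<1::real} = 0"
      by (subst (asm) AE_iff_measurable[of "{-1<..<1::real}"]) auto
    then show False by simp
  qed
  show ?thesis
  proof (rule that[of "\<lambda>x. 1 / (LBINT x. \<rho>0 x) * \<rho>0 x"])
    show "(\<lambda>x. 1 / (LBINT x. \<rho>0 x) * \<rho>0 x) \<in> test_functions UNIV"
      by (rule test_functions_mult[OF \<rho>0 smooth_const])
    show "1 / (LBINT x. \<rho>0 x) * \<rho>0 x = 0" if "1 < \<bar>x\<bar>" for x
    proof -
      have "x \<notin> {-1<..<1}" using that by auto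
      then show ?thesis using bump_eq_0[of 1 x "-1" 1] by (simp add: \<rho>0_def)
    qed
    show "(LBINT x. 1 / (LBINT x. \<rho>0 x) * \<rho>0 x) = 1"
      unfolding integral_mult_right_zero using nz by simp
  qed
qed

text \<open>The du Bois-Reymond lemma. Every test function is its integral times the fixed
  \<open>\<rho>\<close> plus the derivative of a test function, so \<open>C\<close> pairs with it
  like the constant \<open>c\<close>, its pairing with \<open>\<rho>\<close>.\<close>

lemma constant_of_weak_derivative_eq_0:
  fixes C :: "real \<Rightarrow> complex"
  assumes cont: "continuous_on UNIV C"
    and weak: "\<And>\<theta>. \<theta> \<in> test_functions UNIV \<Longrightarrow> (LBINT t. dir_deriv 1 \<theta> t * C t) = 0"
  shows "\<exists>c. \<forall>t. C t = c"
proof -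
  obtain \<rho> :: "real \<Rightarrow> complex" where \<rho>: "\<rho> \<in> test_functions UNIV" and int_\<rho>: "(LBINT x. \<rho> x) = 1"
    using normalised_bump by blast
  define c where "c = (LBINT t. \<rho> t * C t)"
  have "AE t in lborel. C t - c = 0"
  proof (rule AE_eq_0_of_test_functions)
    show "(\<lambda>t. C t - c) \<in> borel_measurable lborel"
      using borel_measurable_continuous_onI[OF cont] by simp
    fix \<psi> :: "real \<Rightarrow> complex" assume \<psi>: "\<psi> \<in> test_functions UNIV"
    have i: "integrable lborel (\<lambda>t. \<psi> t * (C t - c))"
      by (intro test_function_times_continuous_integrable \<psi> continuous_intros cont)
    then show "integrable lborel (\<lambda>t. (C t - c) * \<psi> t)" by (simp only: mult.commute)
    define d where "d = (LBINT t. \<psi> t)"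
    define w where "w t = \<psi> t + (- d) * \<rho> t" for t
    have w: "w \<in> test_functions UNIV"
      unfolding w_def[abs_def] by (intro test_functions_add test_functions_mult \<rho> \<psi> smooth_const)
    have "(LBINT t. w t) = 0"
      unfolding w_def d_def using test_functions_integrable[OF \<psi>] test_functions_integrable[OF \<rho>] int_\<rho>
      by simp
    then obtain \<theta> where \<theta>: "\<theta> \<in> test_functions UNIV" "dir_deriv 1 \<theta> = w"
      using test_function_antiderivative[OF w] by blast
    have iw: "integrable lborel (\<lambda>t. \<psi> t * C t)" "integrable lborel (\<lambda>t. \<rho> t * C t)"
      by (intro test_function_times_continuous_integrable \<psi> \<rho> cont)+
    have "0 = (LBINT t. w t * C t)" using weak[OF \<theta>(1)] \<theta>(2) by simp
    also have "\<dots> = (LBINT t. \<psi> t * C t - d * (\<rho> t * C t))"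
      by (simp add: w_def algebra_simps)
    also have "\<dots> = (LBINT t. \<psi> t * C t) - d * c"
      using iw by (simp add: c_def)
    also have "\<dots> = (LBINT t. \<psi> t * C t) - (LBINT t. \<psi> t * c)"
      using test_functions_integrable[OF \<psi>] by (simp add: d_def)
    also have "\<dots> = (LBINT t. \<psi> t * C t - \<psi> t * c)"
      using iw test_functions_integrable[OF \<psi>] by simp
    finally show "(LBINT t. (C t - c) * \<psi> t) = 0"
      by (simp add: algebra_simps)
  qed
  then have "AE t in lborel. C t = c" by simp
  \<comment> \<open>A closed set of full measure is the whole line, so equality holds at every
    point.\<close>
  moreover have "closed {t. C t = c}"
    using cont by (intro closed_Collect_eq) auto
  ultimately have "C t = c" for t
    using mem_closed_if_AE_lebesgue[of "{t. C t = c}" t] AE_completion by fastforce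
  then show ?thesis by blast
qed

text \<open>An antiderivative of \<open>B\<close> has the same weak derivative as \<open>A\<close>,
  so the two differ by a constant.\<close>

lemma has_vector_derivative_of_weak:
  fixes A B :: "real \<Rightarrow> complex"
  assumes A: "continuous_on UNIV A" and B: "continuous_on UNIV B"
    and weak: "\<And>\<theta>. \<theta> \<in> test_functions UNIV \<Longrightarrow> (LBINT t. dir_deriv 1 \<theta> t * A t + \<theta> t * B t) = 0"
  shows "(A has_vector_derivative B t) (at t)"
proof -
  obtain F where F: "\<And>x. (F has_vector_derivative B x) (at x)"
    using einterval_antiderivative[of "-\<infinity>" "\<infinity>" B] B by (auto simp: continuous_on_eq_continuous_at)
  have cF: "continuous_on UNIV F"
    using F has_vector_derivative_continuous by (blast intro: continuous_at_imp_continuous_on)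
  have "\<exists>c. \<forall>t. A t - F t = c"
  proof (rule constant_of_weak_derivative_eq_0)
    show "continuous_on UNIV (\<lambda>t. A t - F t)" by (intro continuous_intros A cF)
    fix \<theta> :: "real \<Rightarrow> complex" assume \<theta>: "\<theta> \<in> test_functions UNIV"
    note \<theta>' = test_functions_dir_deriv[OF \<theta>, of 1]
    note i = test_function_times_continuous_integrable
    obtain M where M: "M > 0" "\<And>x. norm x > M \<Longrightarrow> \<theta> x = 0"
      using test_functions_support[OF \<theta>] by blast
    obtain M' where M': "M' > 0" "\<And>x. norm x > M' \<Longrightarrow> dir_deriv 1 \<theta> x = 0"
      using test_functions_support[OF \<theta>'] by blast
    have bound: "\<exists>C. \<forall>x. (1 + x\<^sup>2) * cmod (G x) \<le> C"
      if "continuous_on UNIV G" "\<And>x. \<bar>x\<bar> > L \<Longrightarrow> G x = 0" for G :: "real \<Rightarrow> complex" and L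
    proof -
      have "continuous_on {-L..L} (\<lambda>x. (1 + x\<^sup>2) * cmod (G x))"
        using that(1) by (intro continuous_intros) (auto intro: continuous_on_subset)
      then obtain C where C: "\<And>x. x \<in> {-L..L} \<Longrightarrow> norm ((1 + x\<^sup>2) * cmod (G x)) \<le> C"
        using continuous_bounded_on_interval by blast
      have "(1 + x\<^sup>2) * cmod (G x) \<le> max 0 C" for x
      proof (cases "\<bar>x\<bar> > L")
        case False
        then have "x \<in> {-L..L}" by (simp add: abs_le_iff not_less)
        from C[OF this] show ?thesis by (simp add: le_max_iff_disj abs_mult)
      qed (use that(2)[of x] in simp)
      then show ?thesis by blast
    qed
    have c1: "continuous_on UNIV (\<lambda>x. \<theta> x * F x)"
      and c2: "continuous_on UNIV (\<lambda>x. \<theta> x * B x + dir_deriv 1 \<theta> x * F x)"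
      by (intro continuous_intros smooth_continuous test_functionsD(1)[OF \<theta>] test_functionsD(1)[OF \<theta>'] cF B)+
    obtain C where C: "\<And>x. (1 + x\<^sup>2) * cmod (\<theta> x * F x) \<le> C"
      using bound[OF c1, of M] M by auto
    obtain C' where C': "\<And>x. (1 + x\<^sup>2) * cmod (\<theta> x * B x + dir_deriv 1 \<theta> x * F x) \<le> C'"
      using bound[OF c2, of "max M M'"] M M' by auto
    have "(LBINT x. \<theta> x * B x + dir_deriv 1 \<theta> x * F x) = 0"
      by (rule integral_derivative_eq_0[OF has_vector_derivative_mult[OF
            smooth_has_vector_derivative[OF test_functionsD(1)[OF \<theta>]] F] c2 C C'])
    then have 1: "(LBINT x. \<theta> x * B x) + (LBINT x. dir_deriv 1 \<theta> x * F x) = 0"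
      using i[OF \<theta> B] i[OF \<theta>' cF] by simp
    have 2: "(LBINT x. dir_deriv 1 \<theta> x * A x) + (LBINT x. \<theta> x * B x) = 0"
      using weak[OF \<theta>] i[OF \<theta> B] i[OF \<theta>' A] by simp
    have "(LBINT t. dir_deriv 1 \<theta> t * (A t - F t)) = (LBINT x. dir_deriv 1 \<theta> x * A x) - (LBINT x. dir_deriv 1 \<theta> x * F x)"
      using i[OF \<theta>' A] i[OF \<theta>' cF] by (simp add: right_diff_distrib)
    also have "\<dots> = 0" using 1 2 by (simp add: add_eq_0_iff)
    finally show "(LBINT t. dir_deriv 1 \<theta> t * (A t - F t)) = 0" .
  qed
  then obtain c where "A = (\<lambda>t. F t + c)" by (metis add.commute diff_add_cancel ext)
  then show ?thesis
    using has_vector_derivative_add[OF F has_vector_derivative_const] by simp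
qed

section \<open>Dilated cutoffs and tensor products of test functions\<close>

lemma dir_deriv_scale:
  assumes "smooth f"
  shows "dir_deriv 1 (\<lambda>x. f (e * x)) = (\<lambda>x. of_real e * dir_deriv 1 f (e * x))"
proof -
  have "dir_deriv 1 (\<lambda>x. f (e * x)) = (\<lambda>x. dir_deriv e f (e * x))"
    using dir_deriv_affine[OF smooth_differentiable[OF assms] bounded_linear_mult_right, of 1 e 0] by simp
  also have "\<dots> = (\<lambda>x. of_real e * dir_deriv 1 f (e * x))"
    by (rule ext) (rule has_vector_derivative_dir_deriv[OF smooth_has_vector_derivative[OF assms]])
  finally show ?thesis .
qed

lemma smooth_scale: "smooth f \<Longrightarrow> smooth (\<lambda>x::real. f (e * x))"
  using smooth_affine[OF _ bounded_linear_mult_right, of f e 0] by simp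

text \<open>A derivative falling on the dilated cutoff only produces a factor e \<le> 1, which makes
  the bounds uniform in \<open>e\<close>. The induction varies both functions, since either may be
  the one differentiated.\<close>

lemma cutoff_bound:
  assumes "\<phi> \<in> schwartz" "\<eta> \<in> test_functions UNIV"
  shows "\<exists>C. \<forall>e. 0 < e \<and> e \<le> 1 \<longrightarrow> (\<forall>x. (1 + x\<^sup>2) * cmod (Dn m (\<lambda>x. \<eta> (e * x) * \<phi> x) x) \<le> C)"
  using assms
proof (induction m arbitrary: \<phi> \<eta>)
  case 0
  obtain B where B: "B \<ge> 0" "\<And>x. cmod (\<eta> x) \<le> B"
    using test_functions_bounded[OF 0(2)] by blast
  have "(1 + x\<^sup>2) * cmod (\<eta> (e * x) * \<phi> x) \<le> B * (2 * schwartz_seminorm 2 \<phi>)" for e x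
  proof -
    have "(1 + x\<^sup>2) * cmod (\<eta> (e * x) * \<phi> x) = cmod (\<eta> (e * x)) * ((1 + x\<^sup>2) * cmod (\<phi> x))"
      by (simp add: norm_mult)
    also have "\<dots> \<le> B * (2 * schwartz_seminorm 2 \<phi>)"
      by (rule mult_mono[OF B(2) _ B(1)]) (use schwartz_bound_inverse_square[OF 0(1), of 0 2 0 x] in auto)
    finally show ?thesis .
  qed
  then show ?case by auto
next
  case (Suc m)
  note \<phi>' = schwartz_dir_deriv[OF Suc.prems(1)] and \<eta>' = test_functions_dir_deriv[OF Suc.prems(2), of 1]
  note s = schwartz_smooth[OF Suc.prems(1)] test_functionsD(1)[OF Suc.prems(2)]
    schwartz_smooth[OF \<phi>'] test_functionsD(1)[OF \<eta>']
  obtain C1 where C1: "\<And>e x. 0 < e \<Longrightarrow> e \<le> 1 \<Longrightarrow> (1 + x\<^sup>2) * cmod (Dn m (\<lambda>x. \<eta> (e * x) * dir_deriv 1 \<phi> x) x) \<le> C1"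
    using Suc.IH[OF \<phi>' Suc.prems(2)] by blast
  obtain C2 where C2: "\<And>e x. 0 < e \<Longrightarrow> e \<le> 1 \<Longrightarrow> (1 + x\<^sup>2) * cmod (Dn m (\<lambda>x. dir_deriv 1 \<eta> (e * x) * \<phi> x) x) \<le> C2"
    using Suc.IH[OF Suc.prems(1) \<eta>'] by blast
  have "(1 + x\<^sup>2) * cmod (Dn (Suc m) (\<lambda>x. \<eta> (e * x) * \<phi> x) x) \<le> C1 + C2" if e: "0 < e" "e \<le> 1" for e x
  proof -
    have "dir_deriv 1 (\<lambda>x. \<eta> (e * x) * \<phi> x) =
      (\<lambda>x. \<eta> (e * x) * dir_deriv 1 \<phi> x + of_real e * (dir_deriv 1 \<eta> (e * x) * \<phi> x))"
      by (subst dir_deriv_mult) (simp_all add: smooth_differentiable smooth_scale s dir_deriv_scale mult.assoc)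
    then have "Dn (Suc m) (\<lambda>x. \<eta> (e * x) * \<phi> x) x = Dn m (\<lambda>x. \<eta> (e * x) * dir_deriv 1 \<phi> x) x
      + of_real e * Dn m (\<lambda>x. dir_deriv 1 \<eta> (e * x) * \<phi> x) x"
      unfolding Dn_Suc' by (simp add: Dn_add Dn_cmult smooth_mult smooth_const smooth_scale s)
    then have "cmod (Dn (Suc m) (\<lambda>x. \<eta> (e * x) * \<phi> x) x) \<le> cmod (Dn m (\<lambda>x. \<eta> (e * x) * dir_deriv 1 \<phi> x) x)
      + e * cmod (Dn m (\<lambda>x. dir_deriv 1 \<eta> (e * x) * \<phi> x) x)"
      using e norm_triangle_ineq[of "Dn m (\<lambda>x. \<eta> (e * x) * dir_deriv 1 \<phi> x) x"
          "of_real e * Dn m (\<lambda>x. dir_deriv 1 \<eta> (e * x) * \<phi> x) x"]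
      by (simp only: norm_mult norm_of_real abs_of_pos)
    also have "\<dots> \<le> cmod (Dn m (\<lambda>x. \<eta> (e * x) * dir_deriv 1 \<phi> x) x)
      + cmod (Dn m (\<lambda>x. dir_deriv 1 \<eta> (e * x) * \<phi> x) x)"
      using e by (simp add: mult_left_le_one_le)
    finally have "(1 + x\<^sup>2) * cmod (Dn (Suc m) (\<lambda>x. \<eta> (e * x) * \<phi> x) x) \<le>
      (1 + x\<^sup>2) * (cmod (Dn m (\<lambda>x. \<eta> (e * x) * dir_deriv 1 \<phi> x) x)
      + cmod (Dn m (\<lambda>x. dir_deriv 1 \<eta> (e * x) * \<phi> x) x))"
      by (rule mult_left_mono) simp
    also have "\<dots> \<le> C1 + C2"
      unfolding distrib_left by (intro add_mono C1 C2 e)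
    finally show ?thesis .
  qed
  then show ?case by blast
qed

lemma dir_deriv_zero: "smooth (f :: real \<Rightarrow> complex) \<Longrightarrow> dir_deriv 0 f = (\<lambda>x. 0)"
  using has_vector_derivative_dir_deriv[OF smooth_has_vector_derivative, of f 0] by auto

lemma
  fixes \<theta> f :: "real \<Rightarrow> complex"
  assumes \<theta>: "\<theta> \<in> test_functions UNIV" and f: "f \<in> test_functions UNIV"
  shows tensor_test_function: "(\<lambda>z. \<theta> (snd z) * f (fst z)) \<in> test_functions UNIV"
    and dir_deriv_tensor_snd: "dir_deriv (0, 1) (\<lambda>z. \<theta> (snd z) * f (fst z)) = (\<lambda>z. dir_deriv 1 \<theta> (snd z) * f (fst z))"
    and dir_deriv_tensor_fst: "dir_deriv (1, 0) (\<lambda>z. \<theta> (snd z) * f (fst z)) = (\<lambda>z. \<theta> (snd z) * dir_deriv 1 f (fst z))"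
proof -
  note s = test_functionsD(1)[OF \<theta>] test_functionsD(1)[OF f]
  have s1: "smooth (\<lambda>z::real\<times>real. \<theta> (snd z))" and s2: "smooth (\<lambda>z::real\<times>real. f (fst z))"
    using smooth_affine[OF s(1) bounded_linear_snd, of 0] smooth_affine[OF s(2) bounded_linear_fst, of 0] by simp_all
  obtain K L where K: "compact K" "\<And>x. x \<notin> K \<Longrightarrow> \<theta> x = 0" and L: "compact L" "\<And>x. x \<notin> L \<Longrightarrow> f x = 0"
    using test_functionsD(2)[OF \<theta>] test_functionsD(2)[OF f] by blast
  show "(\<lambda>z. \<theta> (snd z) * f (fst z)) \<in> test_functions UNIV"
    using K L s1 s2 by (auto simp: test_functions_def intro!: smooth_mult exI[of _ "L \<times> K"] compact_Times)
  have d1: "dir_deriv v (\<lambda>z::real\<times>real. \<theta> (snd z)) = (\<lambda>z. dir_deriv (snd v) \<theta> (snd z))" for v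
    using dir_deriv_affine[OF smooth_differentiable[OF s(1)] bounded_linear_snd, of v 0] by simp
  have d2: "dir_deriv v (\<lambda>z::real\<times>real. f (fst z)) = (\<lambda>z. dir_deriv (fst v) f (fst z))" for v
    using dir_deriv_affine[OF smooth_differentiable[OF s(2)] bounded_linear_fst, of v 0] by simp
  show "dir_deriv (0, 1) (\<lambda>z. \<theta> (snd z) * f (fst z)) = (\<lambda>z. dir_deriv 1 \<theta> (snd z) * f (fst z))"
    "dir_deriv (1, 0) (\<lambda>z. \<theta> (snd z) * f (fst z)) = (\<lambda>z. \<theta> (snd z) * dir_deriv 1 f (fst z))"
    using s by (simp_all add: dir_deriv_mult smooth_differentiable s1 s2 d1 d2 dir_deriv_zero)
qed

lemma dir_deriv_tensor_funpow:
  fixes \<theta> f :: "real \<Rightarrow> complex"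
  assumes \<theta>: "\<theta> \<in> test_functions UNIV" and f: "f \<in> test_functions UNIV"
  shows "(dir_deriv (1, 0) ^^ n) (\<lambda>z. \<theta> (snd z) * f (fst z)) = (\<lambda>z. \<theta> (snd z) * Dn n f (fst z))"
  by (induction n) (simp_all add: dir_deriv_tensor_fst[OF \<theta> test_functions_dir_deriv_funpow[OF f]])

text \<open>The transpose of the spatial part of the equation; at the frequency -k its symbol is the
  phase at k.\<close>

definition spatial_op :: "real \<Rightarrow> real \<Rightarrow> real \<Rightarrow> (real \<Rightarrow> complex) \<Rightarrow> real \<Rightarrow> complex" where
  "spatial_op \<alpha> \<beta> \<delta> f x = (- \<i> * of_real \<beta>) * Dn 3 f x + (of_real \<alpha> * Dn 2 f x + (- \<i> * of_real \<delta>) * Dn 1 f x)"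

lemma transpose_op_tensor:
  assumes "\<theta> \<in> test_functions UNIV" "f \<in> test_functions UNIV"
  shows "transpose_op \<alpha> \<beta> \<delta> (\<lambda>z. \<theta> (snd z) * f (fst z)) (x, t) =
    (- \<i> * dir_deriv 1 \<theta> t) * f x + \<theta> t * spatial_op \<alpha> \<beta> \<delta> f x"
  unfolding transpose_op_def spatial_op_def
  by (simp only: dir_deriv_tensor_funpow[OF assms] dir_deriv_tensor_snd[OF assms] dir_deriv_tensor_fst[OF assms])
    (simp add: algebra_simps)

lemma
  assumes f: "f \<in> schwartz"
  shows spatial_op_schwartz: "spatial_op \<alpha> \<beta> \<delta> f \<in> schwartz"
    and fourier_spatial_op: "fourier (spatial_op \<alpha> \<beta> \<delta> f) (- k) = of_real (phase \<alpha> \<beta> \<delta> k) * fourier f (- k)"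
proof -
  note s = schwartz_cmult[OF schwartz_Dn[OF f]]
  show "spatial_op \<alpha> \<beta> \<delta> f \<in> schwartz"
    unfolding spatial_op_def[abs_def] by (intro schwartz_add s)
  have "fourier (spatial_op \<alpha> \<beta> \<delta> f) (- k) = (- \<i> * of_real \<beta>) * ((\<i> * of_real (- k)) ^ 3 * fourier f (- k))
    + (of_real \<alpha> * ((\<i> * of_real (- k)) ^ 2 * fourier f (- k)) + (- \<i> * of_real \<delta>) * ((\<i> * of_real (- k)) ^ 1 * fourier f (- k)))"
    unfolding spatial_op_def[abs_def]
    by (subst fourier_add, intro schwartz_add s, intro schwartz_add s)+
      (simp only: fourier_cmult fourier_Dn[OF f])
  also have "\<dots> = of_real (phase \<alpha> \<beta> \<delta> k) * fourier f (- k)"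
    by (simp add: phase_def power3_eq_cube power2_eq_square algebra_simps)
  finally show "fourier (spatial_op \<alpha> \<beta> \<delta> f) (- k) = of_real (phase \<alpha> \<beta> \<delta> k) * fourier f (- k)" .
qed

text \<open>Dominated convergence twice: in k by the common decay of the \<open>\<psi> j\<close>,
  and in t by the boundedness of the curve \<open>g\<close> on the support of
  \<open>\<theta>\<close>. Measurability in t comes from the continuity of the pairings.\<close>

lemma pairing_limit:
  assumes g: "weighted_continuous r g" and n: "- r + 1 \<le> 2 * real n"
    and \<psi>: "\<And>j. \<psi> j \<in> borel_measurable lborel" "\<And>j k. (1 + k\<^sup>2) ^ n * cmod (\<psi> j k) \<le> K"
    and lim: "\<And>k. (\<lambda>j. \<psi> j k) \<longlonglongrightarrow> \<psi>' k" and \<psi>': "\<psi>' \<in> weighted_L2 (- r)"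
    and \<theta>: "\<theta> \<in> test_functions UNIV"
  shows "(\<lambda>j. LBINT t. \<theta> t * (LBINT k. g t k * \<psi> j k)) \<longlonglongrightarrow> (LBINT t. \<theta> t * (LBINT k. g t k * \<psi>' k))"
proof -
  have K: "0 \<le> K" using order_trans[OF _ \<psi>(2)[of 0 0]] by simp
  note \<psi>W = weighted_L2_of_decay[OF \<psi>(1) K n \<psi>(2)]
  note gW = weighted_continuousD(1)[OF g]
  have [measurable]: "g t \<in> borel_measurable lborel" "\<psi> j \<in> borel_measurable lborel"
    "\<psi>' \<in> borel_measurable lborel" for t j
    using weighted_L2_measurable[OF gW] \<psi>(1) weighted_L2_measurable[OF \<psi>'] by auto
  obtain M where M: "M > 0" "\<And>x. norm x > M \<Longrightarrow> \<theta> x = 0"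
    using test_functions_support[OF \<theta>] by blast
  obtain B where B: "0 \<le> B" "\<And>t. \<bar>t\<bar> \<le> M \<Longrightarrow> weighted_norm r (g t) \<le> B"
    using weighted_continuous_bounded[OF g] by blast
  have i: "integrable lborel (\<lambda>t. \<theta> t * (LBINT k. g t k * \<psi> k))" if "\<psi> \<in> weighted_L2 (- r)" for \<psi>
    by (rule test_function_times_continuous_integrable[OF \<theta> weighted_continuous_pairing[OF g that]])
  have pos: "(1 + (k::real)\<^sup>2) ^ n > 0" for k by (intro zero_less_power) (simp add: add_pos_nonneg)
  show ?thesis
  proof (rule integral_dominated_convergence[where w = "\<lambda>t. cmod (\<theta> t) * (B * (K * sqrt pi))"])
    show "AE t in lborel. (\<lambda>j. \<theta> t * (LBINT k. g t k * \<psi> j k)) \<longlonglongrightarrow> \<theta> t * (LBINT k. g t k * \<psi>' k)"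
    proof (intro AE_I2 tendsto_mult tendsto_const)
      fix t
      show "(\<lambda>j. LBINT k. g t k * \<psi> j k) \<longlonglongrightarrow> (LBINT k. g t k * \<psi>' k)"
      proof (rule integral_dominated_convergence[where w = "\<lambda>k. K * (cmod (g t k) / (1 + k\<^sup>2) ^ n)"])
        show "integrable lborel (\<lambda>k. K * (cmod (g t k) / (1 + k\<^sup>2) ^ n))"
          by (rule integrable_mult_right[OF weighted_L2_integrable_quotient[OF gW n]])
        show "AE k in lborel. (\<lambda>j. g t k * \<psi> j k) \<longlonglongrightarrow> g t k * \<psi>' k"
          by (intro AE_I2 tendsto_intros lim)
        show "AE k in lborel. norm (g t k * \<psi> j k) \<le> K * (cmod (g t k) / (1 + k\<^sup>2) ^ n)" for j
        proof (rule AE_I2)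
          fix k
          have "cmod (\<psi> j k) \<le> K / (1 + k\<^sup>2) ^ n"
            using \<psi>(2)[of k j] pos by (simp add: pos_le_divide_eq mult.commute)
          from mult_left_mono[OF this, of "cmod (g t k)"]
          show "norm (g t k * \<psi> j k) \<le> K * (cmod (g t k) / (1 + k\<^sup>2) ^ n)"
            by (simp add: norm_mult mult.commute)
        qed
      qed measurable
    qed
    show "AE t in lborel. norm (\<theta> t * (LBINT k. g t k * \<psi> j k)) \<le> cmod (\<theta> t) * (B * (K * sqrt pi))" for j
    proof (rule AE_I2)
      fix t
      show "norm (\<theta> t * (LBINT k. g t k * \<psi> j k)) \<le> cmod (\<theta> t) * (B * (K * sqrt pi))"
      proof (cases "\<bar>t\<bar> > M")
        case False
        then have "weighted_norm r (g t) * weighted_norm (- r) (\<psi> j) \<le> B * (K * sqrt pi)"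
          by (intro mult_mono B \<psi>W weighted_norm_nonneg) auto
        with weighted_L2_pairing[OF gW \<psi>W(1), of t j] have "cmod (LBINT k. g t k * \<psi> j k) \<le> B * (K * sqrt pi)"
          by (rule order_trans)
        then show ?thesis unfolding norm_mult by (rule mult_left_mono) simp
      qed (use M(2)[of t] in simp)
    qed
    show "integrable lborel (\<lambda>t. cmod (\<theta> t) * (B * (K * sqrt pi)))"
      by (intro integrable_mult_left integrable_norm test_functions_integrable[OF \<theta>])
    show "(\<lambda>t. \<theta> t * (LBINT k. g t k * \<psi>' k)) \<in> borel_measurable lborel"
      using i[OF \<psi>'] by (rule borel_measurable_integrable)
    show "(\<lambda>t. \<theta> t * (LBINT k. g t k * \<psi> j k)) \<in> borel_measurable lborel" for j
      using i[OF \<psi>W(1)] by (rule borel_measurable_integrable)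
  qed
qed

section \<open>The equation on the Fourier side\<close>

lemma smooth_phase: "smooth (\<lambda>k. complex_of_real (phase \<alpha> \<beta> \<delta> k))"
proof -
  have "smooth (\<lambda>k. of_real \<beta> * complex_of_real k ^ 3 + (of_real (- \<alpha>) * complex_of_real k ^ 2 + of_real (- \<delta>) * complex_of_real k ^ 1))"
    by (intro smooth_add smooth_mult smooth_const smooth_of_real_power)
  then show ?thesis by (simp add: phase_def algebra_simps)
qed

text \<open>The integer 2 replaces the sharp exponent 3/2; it is the number of extra powers of decay
  that \<open>evolution_derivative\<close> asks of its approximations.\<close>

lemma phase_upper_bound: "\<exists>C\<ge>0. \<forall>k. \<bar>phase \<alpha> \<beta> \<delta> k\<bar> \<le> C * (1 + k\<^sup>2)\<^sup>2"
proof (intro exI conjI allI)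
  fix k :: real
  have k1: "\<bar>k\<bar> \<le> 1 + k\<^sup>2" using zero_le_power2[of "\<bar>k\<bar> - 1"] zero_le_power2[of k] by (simp add: power2_diff)
  have k0: "1 \<le> 1 + k\<^sup>2" by simp
  have kk: "1 + k\<^sup>2 \<le> (1 + k\<^sup>2)\<^sup>2" using mult_left_mono[OF k0, of "1 + k\<^sup>2"] by (simp add: power2_eq_square)
  have k2: "k\<^sup>2 \<le> (1 + k\<^sup>2)\<^sup>2" using kk by simp
  have k1': "\<bar>k\<bar> \<le> (1 + k\<^sup>2)\<^sup>2" using k1 kk by simp
  have "\<bar>k\<bar> ^ 3 = \<bar>k\<bar> * k\<^sup>2" by (simp add: power3_eq_cube power2_eq_square)
  also have "\<dots> \<le> (1 + k\<^sup>2) * (1 + k\<^sup>2)" using k1 by (intro mult_mono) auto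
  finally have k3: "\<bar>k\<bar> ^ 3 \<le> (1 + k\<^sup>2)\<^sup>2" by (simp add: power2_eq_square)
  have "\<bar>phase \<alpha> \<beta> \<delta> k\<bar> \<le> \<bar>\<beta>\<bar> * \<bar>k\<bar> ^ 3 + \<bar>\<alpha>\<bar> * k\<^sup>2 + \<bar>\<delta>\<bar> * \<bar>k\<bar>"
    unfolding phase_def
    by (rule order_trans[OF abs_triangle_ineq4 add_mono[OF order_trans[OF abs_triangle_ineq4]]])
      (simp_all add: abs_mult power_abs)
  also have "\<dots> \<le> \<bar>\<beta>\<bar> * (1 + k\<^sup>2)\<^sup>2 + \<bar>\<alpha>\<bar> * (1 + k\<^sup>2)\<^sup>2 + \<bar>\<delta>\<bar> * (1 + k\<^sup>2)\<^sup>2"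
    by (intro add_mono mult_left_mono k1' k2 k3) auto
  finally show "\<bar>phase \<alpha> \<beta> \<delta> k\<bar> \<le> (\<bar>\<beta>\<bar> + \<bar>\<alpha>\<bar> + \<bar>\<delta>\<bar>) * (1 + k\<^sup>2)\<^sup>2"
    by (simp add: algebra_simps)
qed simp

text \<open>The equation tested with \<open>\<theta>\<close> in time and \<open>f\<close> in space:
  the weak form of g' = i p g, paired with the reflected transform of \<open>f\<close>.\<close>

lemma weak_evolution:
  assumes g: "weighted_continuous r g"
    and z: "\<And>t. has_fourier (z t) (g t)" and temp: "\<And>t. tempered (z t)"
    and eq: "solves_equation \<alpha> \<beta> \<delta> z"
    and \<theta>: "\<theta> \<in> test_functions UNIV" and f: "f \<in> test_functions UNIV"
  shows "(LBINT t. dir_deriv 1 \<theta> t * (LBINT k. g t k * fourier f (- k))) +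
    (LBINT t. \<theta> t * (LBINT k. g t k * (\<i> * (of_real (phase \<alpha> \<beta> \<delta> k) * fourier f (- k))))) = 0"
proof -
  note fS = test_functions_schwartz[OF f]
  note LS = spatial_op_schwartz[OF fS, of \<alpha> \<beta> \<delta>]
  define \<Phi> where "\<Phi> = (\<lambda>z. \<theta> (snd z) * f (fst z))"
  have \<Phi>: "\<Phi> \<in> test_functions UNIV" unfolding \<Phi>_def by (rule tensor_test_function[OF \<theta> f])
  have W: "(\<lambda>k. fourier h (- k)) \<in> weighted_L2 (- r)" if "h \<in> schwartz" for h
    by (intro reflected_weighted_L2 weighted_L2_schwartz fourier_schwartz that)
  note i = test_function_times_continuous_integrable[OF _ weighted_continuous_pairing[OF g W]]
  have zt: "z t (\<lambda>x. transpose_op \<alpha> \<beta> \<delta> \<Phi> (x, t)) = 1 / (2 * of_real pi) *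
      (- \<i> * (dir_deriv 1 \<theta> t * (LBINT k. g t k * fourier f (- k)))
       + \<theta> t * (LBINT k. g t k * fourier (spatial_op \<alpha> \<beta> \<delta> f) (- k)))" for t
  proof -
    have "z t (\<lambda>x. transpose_op \<alpha> \<beta> \<delta> \<Phi> (x, t)) = (- \<i> * dir_deriv 1 \<theta> t) * z t f + \<theta> t * z t (spatial_op \<alpha> \<beta> \<delta> f)"
    proof -
      have add: "z t (\<lambda>x. \<phi> x + \<psi> x) = z t \<phi> + z t \<psi>" if "\<phi> \<in> schwartz" "\<psi> \<in> schwartz" for \<phi> \<psi>
        using temp[of t] that by (simp add: tempered_def)
      have cmult: "z t (\<lambda>x. c * \<phi> x) = c * z t \<phi>" if "\<phi> \<in> schwartz" for c \<phi>
        using temp[of t] that by (simp add: tempered_def)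
      show ?thesis
        unfolding \<Phi>_def transpose_op_tensor[OF \<theta> f]
        by (simp only: add[OF schwartz_cmult[OF fS] schwartz_cmult[OF LS]] cmult[OF fS] cmult[OF LS])
    qed
    also have "\<dots> = 1 / (2 * of_real pi) *
      (- \<i> * (dir_deriv 1 \<theta> t * (LBINT k. g t k * fourier f (- k)))
       + \<theta> t * (LBINT k. g t k * fourier (spatial_op \<alpha> \<beta> \<delta> f) (- k)))"
      unfolding has_fourier_eq_inv_fourier[OF z fS] has_fourier_eq_inv_fourier[OF z LS] inv_fourier_def
      by (simp add: field_simps)
    finally show ?thesis .
  qed
  have "(LBINT t. z t (\<lambda>x. transpose_op \<alpha> \<beta> \<delta> \<Phi> (x, t))) = 0"
    using eq \<Phi> unfolding solves_equation_def by blast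
  then have "(LBINT t. - \<i> * (dir_deriv 1 \<theta> t * (LBINT k. g t k * fourier f (- k)))
       + \<theta> t * (LBINT k. g t k * fourier (spatial_op \<alpha> \<beta> \<delta> f) (- k))) = 0"
    unfolding zt integral_mult_right_zero by simp
  then have "- \<i> * (LBINT t. dir_deriv 1 \<theta> t * (LBINT k. g t k * fourier f (- k)))
       + (LBINT t. \<theta> t * (LBINT k. g t k * fourier (spatial_op \<alpha> \<beta> \<delta> f) (- k))) = 0"
    using i[OF test_functions_dir_deriv[OF \<theta>] fS] i[OF \<theta> LS] by simp
  \<comment> \<open>Multiplication by i clears the factor -i that the time derivative carries in
    \<open>transpose_op\<close>.\<close>
  then have "\<i> * (- \<i> * (LBINT t. dir_deriv 1 \<theta> t * (LBINT k. g t k * fourier f (- k)))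
       + (LBINT t. \<theta> t * (LBINT k. g t k * fourier (spatial_op \<alpha> \<beta> \<delta> f) (- k)))) = 0" by simp
  then have *: "(LBINT t. dir_deriv 1 \<theta> t * (LBINT k. g t k * fourier f (- k)))
       + \<i> * (LBINT t. \<theta> t * (LBINT k. g t k * fourier (spatial_op \<alpha> \<beta> \<delta> f) (- k))) = 0"
    by (simp add: distrib_left flip: mult.assoc)
  have "\<i> * (LBINT t. \<theta> t * (LBINT k. g t k * fourier (spatial_op \<alpha> \<beta> \<delta> f) (- k))) =
     (LBINT t. \<theta> t * (LBINT k. g t k * (\<i> * (of_real (phase \<alpha> \<beta> \<delta> k) * fourier f (- k)))))"
    unfolding fourier_spatial_op[OF fS] integral_mult_right_zero[symmetric]
    by (simp only: mult.left_commute[of \<i>] integral_mult_right_zero)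
  with * show ?thesis by simp
qed

text \<open>The cutoff equals 1 at the origin and is dilated with e tending to 0. Decay of the
  transforms, uniform in j, amounts to uniform L^1 bounds on \<open>f j\<close> and its derivative
  of order 2n, which \<open>cutoff_bound\<close> supplies.\<close>

lemma cutoff_approximation:
  assumes \<phi>: "\<phi> \<in> schwartz"
  obtains f K where "\<And>j. f j \<in> test_functions UNIV" "\<And>j k. (1 + k\<^sup>2) ^ n * cmod (fourier (f j) k) \<le> K"
    "\<And>k. (\<lambda>j. fourier (f j) k) \<longlonglongrightarrow> fourier \<phi> k"
proof -
  define \<eta> where "\<eta> x = of_real (1 / bump 1 (-1) 1 0) * complex_of_real (bump 1 (-1) 1 x)" for x
  have \<eta>: "\<eta> \<in> test_functions UNIV"
    unfolding \<eta>_def[abs_def] by (intro test_functions_mult bump_test_function smooth_const) auto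
  have \<eta>0: "\<eta> 0 = 1"
    using bump_pos[of 1 0 "-1" 1] by (simp add: \<eta>_def)
  obtain B where B: "B \<ge> 0" "\<And>x. cmod (\<eta> x) \<le> B"
    using test_functions_bounded[OF \<eta>] by blast
  have [measurable]: "\<phi> \<in> borel_measurable lborel" "\<eta> \<in> borel_measurable borel"
    using schwartz_measurable[OF \<phi>] test_functions_measurable[OF \<eta>] by auto
  define e where "e j = inverse (real (Suc j))" for j
  have e: "e j > 0" "e j \<le> 1" for j by (auto simp: e_def inverse_le_1_iff)
  have e_lim: "e \<longlonglongrightarrow> 0" unfolding e_def by (rule LIMSEQ_inverse_real_of_nat)
  define f where "f j x = \<eta> (e j * x) * \<phi> x" for j x
  have f: "f j \<in> test_functions UNIV" for j
  proof -
    obtain M where M: "M > 0" "\<And>x. norm x > M \<Longrightarrow> \<eta> x = 0"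
      using test_functions_support[OF \<eta>] by blast
    have "f j x = 0" if "x \<notin> {- (M / e j)..M / e j}" for x
    proof -
      have "\<bar>e j * x\<bar> > M"
        using that e(1)[of j] by (auto simp: abs_mult field_simps not_le abs_if split: if_splits)
      then show ?thesis using M(2)[of "e j * x"] by (simp add: f_def)
    qed
    moreover have "smooth (f j)"
      unfolding f_def[abs_def] by (intro smooth_mult smooth_scale test_functionsD(1)[OF \<eta>] schwartz_smooth \<phi>)
    ultimately show ?thesis
      by (auto simp: test_functions_def intro!: exI[of _ "{- (M / e j)..M / e j}"])
  qed
  obtain C where C: "\<And>m e x. 0 < e \<Longrightarrow> e \<le> 1 \<Longrightarrow> (1 + x\<^sup>2) * cmod (Dn m (\<lambda>x. \<eta> (e * x) * \<phi> x) x) \<le> C m"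
    using cutoff_bound[OF \<phi> \<eta>] by metis
  have I: "(LBINT x. cmod (Dn m (f j) x)) \<le> C m * pi" for m j
    by (rule integral_norm_of_square_decay)
      (use C[OF e] schwartz_measurable[OF schwartz_Dn[OF test_functions_schwartz[OF f]]] in \<open>simp_all add: f_def[abs_def]\<close>)
  show ?thesis
  proof (rule that[of f "2 ^ n * (C 0 * pi + C (2 * n) * pi)"])
    show "(1 + k\<^sup>2) ^ n * cmod (fourier (f j) k) \<le> 2 ^ n * (C 0 * pi + C (2 * n) * pi)" for j k
      using fourier_decay[OF test_functions_schwartz[OF f], of k n j]
      by (rule order_trans) (use I[of 0 j] I[of "2 * n" j] in \<open>auto intro!: mult_left_mono add_mono\<close>)
    show "(\<lambda>j. fourier (f j) k) \<longlonglongrightarrow> fourier \<phi> k" for k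
      unfolding fourier_iexp
    proof (rule integral_dominated_convergence[where w = "\<lambda>x. B * cmod (\<phi> x)"])
      show "integrable lborel (\<lambda>x. B * cmod (\<phi> x))"
        by (intro integrable_mult_right integrable_norm schwartz_integrable \<phi>)
      show "AE x in lborel. (\<lambda>j. iexp (- x * k) * f j x) \<longlonglongrightarrow> iexp (- x * k) * \<phi> x"
      proof (rule AE_I2)
        fix x
        have "isCont \<eta> 0"
          using smooth_continuous[OF test_functionsD(1)[OF \<eta>], of UNIV] by (simp add: continuous_on_eq_continuous_at)
        moreover have "(\<lambda>j. e j * x) \<longlonglongrightarrow> 0" using tendsto_mult_left_zero[OF e_lim] .
        ultimately have "(\<lambda>j. \<eta> (e j * x)) \<longlonglongrightarrow> \<eta> 0" by (rule isCont_tendsto_compose)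
        from tendsto_mult[OF tendsto_const tendsto_mult[OF this tendsto_const]]
        show "(\<lambda>j. iexp (- x * k) * f j x) \<longlonglongrightarrow> iexp (- x * k) * \<phi> x"
          unfolding f_def \<eta>0 mult_1 .
      qed
      show "AE x in lborel. norm (iexp (- x * k) * f j x) \<le> B * cmod (\<phi> x)" for j
        unfolding norm_mult norm_iexp f_def using B by (intro AE_I2) (simp add: mult_right_mono)
      show "(\<lambda>x. iexp (- x * k) * f j x) \<in> borel_measurable lborel" for j
        unfolding f_def by measurable
    qed measurable
  qed (rule f)
qed

lemma phase_times_test_function:
  "\<eta> \<in> test_functions UNIV \<Longrightarrow> (\<lambda>k. of_real (phase \<alpha> \<beta> \<delta> k) * \<eta> k) \<in> test_functions UNIV"
  by (rule test_functions_mult[OF _ smooth_phase])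

text \<open>The weak equation is available for transforms of compactly supported functions, whereas
  here \<open>\<eta>\<close> has compact support in frequency. Its transform is a Schwartz function
  and is approximated by test functions \<open>f j\<close>; transformed once more and reflected, it
  is 2 pi \<open>\<eta>\<close>. Both pairings in the limit equation are continuous in t, so the
  weak derivative is a classical one.\<close>

lemma evolution_derivative:
  assumes g: "weighted_continuous r g"
    and z: "\<And>t. has_fourier (z t) (g t)" and temp: "\<And>t. tempered (z t)"
    and eq: "solves_equation \<alpha> \<beta> \<delta> z" and \<eta>: "\<eta> \<in> test_functions UNIV"
  shows "((\<lambda>t. LBINT k. g t k * \<eta> k) has_vector_derivative
    \<i> * (LBINT k. g t k * (of_real (phase \<alpha> \<beta> \<delta> k) * \<eta> k))) (at t)"
proof -
  define p where "p = phase \<alpha> \<beta> \<delta>"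
  define F where "F k = 2 * of_real pi * \<eta> k" for k
  define P where "P k = \<i> * (of_real (p k) * F k)" for k
  note \<eta>S = test_functions_schwartz[OF \<eta>]
  obtain C where C: "0 \<le> C" "\<And>k. \<bar>p k\<bar> \<le> C * (1 + k\<^sup>2)\<^sup>2"
    using phase_upper_bound unfolding p_def by blast
  obtain n where n: "- r + 1 \<le> 2 * real n" by (rule exists_exponent)
  \<comment> \<open>Two powers of 1 + k^2 more than the pairing asks for: they absorb the growth of
    the phase.\<close>
  obtain f K where f: "\<And>j. f j \<in> test_functions UNIV"
    "\<And>j k. (1 + k\<^sup>2) ^ (n + 2) * cmod (fourier (f j) k) \<le> K"
    "\<And>k. (\<lambda>j. fourier (f j) k) \<longlonglongrightarrow> fourier (fourier \<eta>) k"
    using cutoff_approximation[OF fourier_schwartz[OF \<eta>S], of "n + 2"] by metis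
  have lim: "(\<lambda>j. fourier (f j) (- k)) \<longlonglongrightarrow> F k" for k
    using f(3)[of "- k"] unfolding F_def fourier_fourier[OF \<eta>S] .
  have F: "F \<in> test_functions UNIV" and P: "P \<in> test_functions UNIV"
    unfolding P_def[abs_def] F_def[abs_def] p_def
    by (intro test_functions_mult \<eta> smooth_const smooth_phase)+
  have FW: "F \<in> weighted_L2 (- r)" and PW: "P \<in> weighted_L2 (- r)"
    using F P test_functions_schwartz weighted_L2_schwartz by blast+
  have meas: "fourier (f j) \<in> borel_measurable lborel" for j
    by (rule schwartz_measurable[OF fourier_schwartz[OF test_functions_schwartz[OF f(1)]]])
  have k0: "1 \<le> 1 + k\<^sup>2" for k :: real by simp
  have bound: "(1 + k\<^sup>2) ^ n * cmod (\<i> * (of_real (p k) * fourier (f j) (- k))) \<le> C * K" for j k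
  proof -
    have "(1 + k\<^sup>2) ^ n * cmod (\<i> * (of_real (p k) * fourier (f j) (- k))) = \<bar>p k\<bar> * ((1 + k\<^sup>2) ^ n * cmod (fourier (f j) (- k)))"
      by (simp add: norm_mult)
    also have "\<dots> \<le> C * (1 + k\<^sup>2)\<^sup>2 * ((1 + k\<^sup>2) ^ n * cmod (fourier (f j) (- k)))"
      by (intro mult_right_mono C) simp
    also have "\<dots> = C * ((1 + (- k)\<^sup>2) ^ (n + 2) * cmod (fourier (f j) (- k)))"
      by (simp only: power_add power2_minus mult_ac)
    also have "\<dots> \<le> C * K"
      by (intro mult_left_mono f C)
    finally show ?thesis .
  qed
  have bound0: "(1 + k\<^sup>2) ^ n * cmod (fourier (f j) (- k)) \<le> K" for j k
  proof -
    have "(1 + k\<^sup>2) ^ n * cmod (fourier (f j) (- k)) \<le> (1 + k\<^sup>2) ^ (n + 2) * cmod (fourier (f j) (- k))"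
      by (intro mult_right_mono power_increasing k0) auto
    also have "\<dots> \<le> K" using f(2)[of "- k" j] by simp
    finally show ?thesis .
  qed
  have weak: "(LBINT t. dir_deriv 1 \<theta> t * (LBINT k. g t k * F k) + \<theta> t * (LBINT k. g t k * P k)) = 0"
    if \<theta>: "\<theta> \<in> test_functions UNIV" for \<theta>
  proof -
    note \<theta>' = test_functions_dir_deriv[OF \<theta>]
    have "(\<lambda>j. (LBINT t. dir_deriv 1 \<theta> t * (LBINT k. g t k * fourier (f j) (- k))) +
      (LBINT t. \<theta> t * (LBINT k. g t k * (\<i> * (of_real (p k) * fourier (f j) (- k))))))
      \<longlonglongrightarrow> (LBINT t. dir_deriv 1 \<theta> t * (LBINT k. g t k * F k)) + (LBINT t. \<theta> t * (LBINT k. g t k * P k))"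
    proof (intro tendsto_add)
      show "(\<lambda>j. LBINT t. dir_deriv 1 \<theta> t * (LBINT k. g t k * fourier (f j) (- k)))
        \<longlonglongrightarrow> (LBINT t. dir_deriv 1 \<theta> t * (LBINT k. g t k * F k))"
        by (rule pairing_limit[OF g n _ bound0 lim FW \<theta>']) (use meas in measurable)
      show "(\<lambda>j. LBINT t. \<theta> t * (LBINT k. g t k * (\<i> * (of_real (p k) * fourier (f j) (- k)))))
        \<longlonglongrightarrow> (LBINT t. \<theta> t * (LBINT k. g t k * P k))"
      proof (rule pairing_limit[OF g n _ bound _ PW \<theta>])
        show "(\<lambda>j. \<i> * (of_real (p k) * fourier (f j) (- k))) \<longlonglongrightarrow> P k" for k
          unfolding P_def by (intro tendsto_intros lim)
        have [measurable]: "p \<in> borel_measurable borel" by (simp add: p_def)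
        show "(\<lambda>k. \<i> * (of_real (p k) * fourier (f j) (- k))) \<in> borel_measurable lborel" for j
          using meas by measurable
      qed
    qed
    then have "(LBINT t. dir_deriv 1 \<theta> t * (LBINT k. g t k * F k)) + (LBINT t. \<theta> t * (LBINT k. g t k * P k)) = 0"
      unfolding p_def weak_evolution[OF g z temp eq \<theta> f(1)] by (simp only: LIMSEQ_const_iff)
    then show ?thesis
      using test_function_times_continuous_integrable[OF \<theta>' weighted_continuous_pairing[OF g FW]]
        test_function_times_continuous_integrable[OF \<theta> weighted_continuous_pairing[OF g PW]] by simp
  qed
  have "((\<lambda>t. LBINT k. g t k * F k) has_vector_derivative (LBINT k. g t k * P k)) (at t)"
    by (rule has_vector_derivative_of_weak[OF weighted_continuous_pairing[OF g FW] weighted_continuous_pairing[OF g PW] weak])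
  moreover have "(LBINT k. g t k * F k) = 2 * of_real pi * (LBINT k. g t k * \<eta> k)" for t
    unfolding F_def mult.left_commute[of "g t _"] by (rule integral_mult_right_zero)
  moreover have "(LBINT k. g t k * P k) = 2 * of_real pi * (\<i> * (LBINT k. g t k * (of_real (phase \<alpha> \<beta> \<delta> k) * \<eta> k)))"
    unfolding integral_mult_right_zero[symmetric] P_def F_def p_def by (simp only: mult_ac)
  ultimately have "((\<lambda>t. 2 * of_real pi * (LBINT k. g t k * \<eta> k)) has_vector_derivative
      2 * of_real pi * (\<i> * (LBINT k. g t k * (of_real (phase \<alpha> \<beta> \<delta> k) * \<eta> k)))) (at t)" by simp
  from has_vector_derivative_mult_right[OF this, of "1 / (2 * of_real pi)"] show ?thesis by simp
qed

text \<open>A product rule. Around a fixed time t the pairing splits into the one with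
  \<open>E t\<close> frozen, whose derivative is given by \<open>evolution_derivative\<close>, and
  the contribution \<open>Q\<close> of the change of \<open>E\<close>. Their derivatives at t are i
  G(t) and -i G(t).\<close>

lemma evolution_conserved:
  assumes g: "weighted_continuous r g"
    and z: "\<And>t. has_fourier (z t) (g t)" and temp: "\<And>t. tempered (z t)"
    and eq: "solves_equation \<alpha> \<beta> \<delta> z" and \<eta>: "\<eta> \<in> test_functions UNIV"
  shows "(LBINT k. g t k * (iexp (- (phase \<alpha> \<beta> \<delta> k * t)) * \<eta> k)) = (LBINT k. g 0 k * \<eta> k)"
proof -
  define p where "p = phase \<alpha> \<beta> \<delta>"
  define E where "E t k = iexp (- (p k * t)) * \<eta> k" for t k
  have "smooth (\<lambda>k. exp (- \<i> * of_real t * complex_of_real (p k)))" for t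
    unfolding p_def by (intro smooth_exp smooth_mult smooth_const smooth_phase)
  then have "smooth (\<lambda>k. iexp (- (p k * t)))" for t by (simp add: mult_ac)
  then have E: "E t \<in> test_functions UNIV" for t
    unfolding E_def[abs_def] by (rule test_functions_mult[OF \<eta>])
  note gW = weighted_continuousD(1)[OF g]
  have W: "h \<in> weighted_L2 (- r)" if "h \<in> test_functions UNIV" for h
    using that test_functions_schwartz weighted_L2_schwartz by blast
  \<comment> \<open>The second time derivative of \<open>E\<close> has modulus p^2
    |\<open>\<eta>\<close>| at all times; this function controls the Taylor remainder.\<close>
  define p\<eta> where "p\<eta> k = of_real (p k) * (of_real (p k) * \<eta> k)" for k
  have p\<eta>: "p\<eta> \<in> test_functions UNIV"
    unfolding p\<eta>_def[abs_def] p_def by (intro phase_times_test_function \<eta>)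
  define N where "N t = (LBINT k. g t k * E t k)" for t
  have "(N has_vector_derivative 0) (at t)" for t
  proof -
    define pE where "pE k = of_real (p k) * E t k" for k
    have pE: "pE \<in> test_functions UNIV"
      unfolding pE_def[abs_def] p_def by (intro phase_times_test_function E)
    define G where "G s = (LBINT k. g s k * pE k)" for s
    define Q where "Q s = (LBINT k. g s k * (E s k - E t k))" for s
    obtain B where B: "0 \<le> B" "\<And>s. \<bar>s\<bar> \<le> \<bar>t\<bar> + 1 \<Longrightarrow> weighted_norm r (g s) \<le> B"
      using weighted_continuous_bounded[OF g] by blast
    \<comment> \<open>The first-order Taylor remainder of \<open>E\<close> at t, the time derivative
      of \<open>E\<close> being -i p E.\<close>
    define H where "H s k = E s k - E t k + of_real (s - t) * (\<i> * pE k)" for s k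
    have H: "H s \<in> weighted_L2 (- r)" "weighted_norm (- r) (H s) \<le> (s - t)\<^sup>2 / 2 * weighted_norm (- r) p\<eta>" for s
    proof -
      have le: "cmod (H s k) \<le> (s - t)\<^sup>2 / 2 * cmod (p\<eta> k)" for k
      proof -
        have "iexp (- (p k * s)) = iexp (- (p k * t)) * iexp (- (p k * (s - t)))"
          unfolding iexp_add[symmetric] by (simp add: algebra_simps)
        then have "H s k = iexp (- (p k * t)) * (iexp (- (p k * (s - t))) - (1 + \<i> * of_real (- (p k * (s - t))))) * \<eta> k"
          unfolding H_def pE_def E_def by (simp add: algebra_simps)
        then have "cmod (H s k) = cmod (iexp (- (p k * (s - t))) - (1 + \<i> * of_real (- (p k * (s - t))))) * cmod (\<eta> k)"
          by (simp only: norm_mult norm_iexp mult_1)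
        also have "cmod (iexp (- (p k * (s - t))) - (1 + \<i> * of_real (- (p k * (s - t))))) \<le> (p k * (s - t))\<^sup>2 / 2"
          using iexp_approx1[of "- (p k * (s - t))" 1] by (simp add: power2_eq_square)
        finally have "cmod (H s k) \<le> (p k * (s - t))\<^sup>2 / 2 * cmod (\<eta> k)"
          by (simp add: mult_right_mono)
        also have "\<dots> = (s - t)\<^sup>2 / 2 * cmod (p\<eta> k)"
          by (simp add: p\<eta>_def norm_mult power_mult_distrib power2_eq_square)
        finally show ?thesis .
      qed
      have "(1 + k\<^sup>2) powr (- r) * (cmod (H s k))\<^sup>2 \<le> ((s - t)\<^sup>2 / 2)\<^sup>2 * ((1 + k\<^sup>2) powr (- r) * (cmod (p\<eta> k))\<^sup>2)" for k
      proof -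
        have "(1 + k\<^sup>2) powr (- r) * (cmod (H s k))\<^sup>2 \<le> (1 + k\<^sup>2) powr (- r) * ((s - t)\<^sup>2 / 2 * cmod (p\<eta> k))\<^sup>2"
          by (intro mult_left_mono power_mono le) auto
        then show ?thesis by (simp only: power_mult_distrib mult_ac)
      qed
      moreover have "H s \<in> borel_measurable lborel"
        unfolding H_def using weighted_L2_measurable[OF W[OF E]] weighted_L2_measurable[OF W[OF pE]] by measurable
      ultimately show "H s \<in> weighted_L2 (- r)" "weighted_norm (- r) (H s) \<le> (s - t)\<^sup>2 / 2 * weighted_norm (- r) p\<eta>"
        using weighted_L2_bound[OF W[OF p\<eta>], of "H s" "(s - t)\<^sup>2 / 2" "- r"] by auto
    qed
    \<comment> \<open>The linear term is paired with g(s), not with g(t); the difference is (s - t)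
      (G s - G t) up to a unimodular factor, which is o(s - t) because \<open>G\<close> is
      continuous.\<close>
    have Q_eq: "Q s - (s - t) *\<^sub>R (- \<i> * G t) = (LBINT k. g s k * H s k) - of_real (s - t) * (\<i> * (G s - G t))" for s
    proof -
      have i: "integrable lborel (\<lambda>k. g s k * h k)" if "h \<in> test_functions UNIV" for h
        by (rule weighted_L2_pairing_integrable[OF gW W[OF that]])
      have d: "integrable lborel (\<lambda>k. g s k * (E s k - E t k))"
        unfolding right_diff_distrib by (intro Bochner_Integration.integrable_diff i E)
      have "(LBINT k. g s k * H s k) = (LBINT k. g s k * (E s k - E t k) + of_real (s - t) * \<i> * (g s k * pE k))"
        by (simp add: H_def algebra_simps)
      also have "\<dots> = Q s + of_real (s - t) * \<i> * G s"
        using d i[OF pE] by (simp add: Q_def G_def)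
      finally show ?thesis by (simp add: scaleR_conv_of_real algebra_simps)
    qed
    have Gc: "((\<lambda>s. G s - G t) \<longlongrightarrow> 0) (at t)"
      using weighted_continuous_pairing[OF g W[OF pE]]
      by (simp add: G_def[abs_def] continuous_on_eq_continuous_at isCont_def LIM_zero_iff)
    have "((\<lambda>s. (Q s - Q t - (s - t) *\<^sub>R (- \<i> * G t)) /\<^sub>R norm (s - t)) \<longlongrightarrow> 0) (at t)"
    proof (rule Lim_null_comparison)
      show "\<forall>\<^sub>F s in at t. norm ((Q s - Q t - (s - t) *\<^sub>R (- \<i> * G t)) /\<^sub>R norm (s - t))
        \<le> \<bar>s - t\<bar> * (B * (weighted_norm (- r) p\<eta> / 2)) + cmod (G s - G t)"
        unfolding eventually_at
      proof (intro exI[of _ 1] conjI ballI impI)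
        fix s assume s: "s \<noteq> t \<and> dist s t < 1"
        have "Q t = 0" by (simp add: Q_def)
        then have "norm (Q s - Q t - (s - t) *\<^sub>R (- \<i> * G t)) \<le> cmod (LBINT k. g s k * H s k) + cmod (of_real (s - t) * (\<i> * (G s - G t)))"
          using norm_triangle_ineq4 by (simp only: diff_zero Q_eq)
        also have "\<dots> \<le> B * ((s - t)\<^sup>2 / 2 * weighted_norm (- r) p\<eta>) + \<bar>s - t\<bar> * cmod (G s - G t)"
        proof (rule add_mono)
          have "\<bar>s\<bar> \<le> \<bar>t\<bar> + 1"
            using s abs_triangle_ineq[of "s - t" t] by (simp add: dist_real_def)
          then show "cmod (LBINT k. g s k * H s k) \<le> B * ((s - t)\<^sup>2 / 2 * weighted_norm (- r) p\<eta>)"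
            by (intro order_trans[OF weighted_L2_pairing[OF gW H(1)]] mult_mono B H weighted_norm_nonneg)
          show "cmod (of_real (s - t) * (\<i> * (G s - G t))) \<le> \<bar>s - t\<bar> * cmod (G s - G t)"
            unfolding norm_mult norm_of_real by simp
        qed
        also have "\<dots> = \<bar>s - t\<bar> * (\<bar>s - t\<bar> * (B * (weighted_norm (- r) p\<eta> / 2)) + cmod (G s - G t))"
        proof -
          have "(s - t)\<^sup>2 = \<bar>s - t\<bar> * \<bar>s - t\<bar>" by (simp add: power2_eq_square)
          then show ?thesis by (simp only:) (simp add: distrib_left mult_ac)
        qed
        finally have le: "norm (Q s - Q t - (s - t) *\<^sub>R (- \<i> * G t))
          \<le> (\<bar>s - t\<bar> * (B * (weighted_norm (- r) p\<eta> / 2)) + cmod (G s - G t)) * \<bar>s - t\<bar>"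
          by (simp only: mult.commute)
        have "norm (w /\<^sub>R norm (s - t)) = norm w / \<bar>s - t\<bar>" for w :: complex
          by (simp add: divide_inverse mult.commute)
        moreover have "0 < \<bar>s - t\<bar>" using s by simp
        ultimately show "norm ((Q s - Q t - (s - t) *\<^sub>R (- \<i> * G t)) /\<^sub>R norm (s - t))
          \<le> \<bar>s - t\<bar> * (B * (weighted_norm (- r) p\<eta> / 2)) + cmod (G s - G t)"
          using le by (simp only: pos_divide_le_eq)
      qed simp
      have "((\<lambda>s. \<bar>s - t\<bar> * (B * (weighted_norm (- r) p\<eta> / 2)) + cmod (G s - G t)) \<longlongrightarrow>
        \<bar>t - t\<bar> * (B * (weighted_norm (- r) p\<eta> / 2)) + cmod 0) (at t)"
        by (intro tendsto_intros Gc)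
      then show "((\<lambda>s. \<bar>s - t\<bar> * (B * (weighted_norm (- r) p\<eta> / 2)) + cmod (G s - G t)) \<longlongrightarrow> 0) (at t)" by simp
    qed
    then have Q: "(Q has_vector_derivative - \<i> * G t) (at t)"
      unfolding has_vector_derivative_def has_derivative_def
      using bounded_linear_scaleR_left[of "- \<i> * G t"] by simp
    have A: "((\<lambda>s. LBINT k. g s k * E t k) has_vector_derivative \<i> * G t) (at t)"
      using evolution_derivative[OF g z temp eq E] by (simp add: G_def pE_def p_def)
    have "N s = (LBINT k. g s k * E t k) + Q s" for s
    proof -
      have "(LBINT k. g s k * E t k) + Q s = (LBINT k. g s k * E t k + g s k * (E s k - E t k))"
        unfolding Q_def right_diff_distrib
        by (intro Bochner_Integration.integral_add[symmetric] Bochner_Integration.integrable_diff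
            weighted_L2_pairing_integrable[OF gW W[OF E]])
      then show ?thesis by (simp add: N_def algebra_simps)
    qed
    then show ?thesis
      using has_vector_derivative_add[OF A Q] by (simp add: N_def[abs_def])
  qed
  then obtain c where "\<And>t. N t = c"
    using has_vector_derivative_zero_constant[of UNIV N] by auto
  then have "N t = N 0" by simp
  then show ?thesis by (simp add: N_def E_def p_def)
qed

text \<open>The competing solution may live in a space of another order \<open>r\<close>. Its
  transform at time 0 still agrees almost everywhere with that of \<open>y0\<close>, because
  transforms are unique; the conserved pairings then determine g(t) almost everywhere.\<close>

lemma cauchy_solution_unique:
  assumes y0: "y0 \<in> sobolev s" and sol: "cauchy_solution \<alpha> \<beta> \<delta> y0 z" and \<phi>: "\<phi> \<in> schwartz"
  shows "z t \<phi> = solution_op \<alpha> \<beta> \<delta> y0 t \<phi>"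
proof -
  obtain r where r: "continuous_into (sobolev r) (sobolev_norm r) z"
    and eq: "solves_equation \<alpha> \<beta> \<delta> z" and init: "\<And>\<phi>. \<phi> \<in> schwartz \<Longrightarrow> z 0 \<phi> = y0 \<phi>"
    using sol by (auto simp: cauchy_solution_def)
  define g where "g t = dist_fourier (z t)" for t
  have zr: "z t \<in> sobolev r" for t using r by (simp add: continuous_into_def)
  have z: "has_fourier (z t) (g t)" and gW: "g t \<in> weighted_L2 r" for t
    unfolding g_def using sobolev_dist_fourier[OF zr] by auto
  have temp: "tempered (z t)" for t using zr by (auto simp: sobolev_def)
  have "sobolev_norm r (\<lambda>\<phi>. z b \<phi> - z a \<phi>) = weighted_norm r (\<lambda>k. g b k - g a k)" for a b
    by (intro sobolev_norm_eq has_fourier_diff z)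
  then have g: "weighted_continuous r g"
    using r gW by (simp add: continuous_into_def weighted_continuous_def)
  note y0' = sobolev_dist_fourier[OF y0]
  have "has_fourier y0 (g 0)"
    using z[of 0] init fourier_schwartz by (simp add: has_fourier_def)
  then have g0: "AE k in lborel. g 0 k = dist_fourier y0 k"
    by (rule has_fourier_unique[OF _ y0'(1)])
  let ?p = "phase \<alpha> \<beta> \<delta>"
  have [measurable]: "g t \<in> borel_measurable lborel" "dist_fourier y0 \<in> borel_measurable lborel"
    "fourier \<phi> \<in> borel_measurable lborel" for t
    using weighted_L2_measurable[OF gW] weighted_L2_measurable[OF y0'(2)] schwartz_measurable[OF fourier_schwartz[OF \<phi>]]
    by auto
  have gpW: "(\<lambda>k. iexp (- (?p k * t)) * g t k) \<in> weighted_L2 r"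
    by (rule weighted_L2_iexp[OF gW]) simp
  have "AE k in lborel. iexp (- (?p k * t)) * g t k - g 0 k = 0"
  proof (rule AE_eq_0_of_test_functions)
    fix \<eta> :: "real \<Rightarrow> complex" assume \<eta>: "\<eta> \<in> test_functions UNIV"
    have \<eta>W: "\<eta> \<in> weighted_L2 (- r)"
      using \<eta> test_functions_schwartz weighted_L2_schwartz by blast
    show "integrable lborel (\<lambda>k. (iexp (- (?p k * t)) * g t k - g 0 k) * \<eta> k)"
      by (rule weighted_L2_pairing_integrable[OF weighted_L2_diff[OF gpW gW] \<eta>W])
    have "(LBINT k. (iexp (- (?p k * t)) * g t k - g 0 k) * \<eta> k) =
      (LBINT k. g t k * (iexp (- (?p k * t)) * \<eta> k)) - (LBINT k. g 0 k * \<eta> k)"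
      unfolding pairing_diff[OF gpW gW \<eta>W] by (simp only: mult_ac)
    also have "\<dots> = 0"
      unfolding evolution_conserved[OF g z temp eq \<eta>] by simp
    finally show "(LBINT k. (iexp (- (?p k * t)) * g t k - g 0 k) * \<eta> k) = 0" .
  qed measurable
  with g0 have gt: "AE k in lborel. g t k = iexp (?p k * t) * dist_fourier y0 k"
  proof eventually_elim
    case (elim k)
    have "g t k = iexp (?p k * t) * iexp (- (?p k * t)) * g t k"
      unfolding iexp_add[symmetric] by simp
    also have "\<dots> = iexp (?p k * t) * dist_fourier y0 k"
      using elim by (simp only: mult.assoc) simp
    finally show ?case .
  qed
  have "z t \<phi> = inv_fourier (g t) \<phi>"
    by (rule has_fourier_eq_inv_fourier[OF z \<phi>])
  also have "\<dots> = inv_fourier (\<lambda>k. iexp (?p k * t) * dist_fourier y0 k) \<phi>"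
  proof -
    have "(LBINT k. g t k * fourier \<phi> (- k)) = (LBINT k. iexp (?p k * t) * dist_fourier y0 k * fourier \<phi> (- k))"
      by (rule integral_cong_AE) (use gt in auto)
    then show ?thesis by (simp only: inv_fourier_def)
  qed
  finally show ?thesis by (simp only: solution_op_eq)
qed

section \<open>Change of variables in frequency\<close>

text \<open>The lower bound on the slope makes \<open>q\<close> a bijection. The image of q'(k) dk
  under \<open>q\<close> gives every interval its length, and this characterises Lebesgue measure.
  Finitely many corners are allowed so that a piecewise defined \<open>q\<close> can be
  used.\<close>

lemma monotone_change_of_variables:
  fixes q q' :: "real \<Rightarrow> real"
  assumes cont: "continuous_on UNIV q" and S: "finite S"
    and der: "\<And>x. x \<notin> S \<Longrightarrow> (q has_real_derivative q' x) (at x)"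
    and [measurable]: "q' \<in> borel_measurable borel" and c: "0 < c" "\<And>x. c \<le> q' x"
  obtains \<kappa> where "\<kappa> \<in> borel_measurable borel" "\<And>k. \<kappa> (q k) = k"
    "lborel = distr (density lborel (\<lambda>k. ennreal (q' k))) borel q"
proof -
  have q' : "0 \<le> q' x" for x using c(1) c(2)[of x] by linarith
  have [measurable]: "q \<in> borel_measurable borel" by (rule borel_measurable_continuous_onI[OF cont])
  have hi: "(q' has_integral (q b - q a)) {a..b}" if "a \<le> b" for a b
    by (rule fundamental_theorem_of_calculus_strong[OF S that])
      (use der in \<open>auto simp: has_real_derivative_iff_has_vector_derivative intro: continuous_on_subset[OF cont]\<close>)
  have growth: "c * (b - a) \<le> q b - q a" if "a \<le> b" for a b
  proof (rule has_integral_le[OF _ hi[OF that]])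
    show "((\<lambda>x. c) has_integral c * (b - a)) {a..b}"
      using has_integral_const_real[of c a b] that by (simp add: mult.commute)
  qed (rule c)
  have strict: "q a < q b" if "a < b" for a b
  proof -
    have "0 < c * (b - a)" using that c(1) by (intro mult_pos_pos) auto
    with growth[of a b] that show ?thesis by linarith
  qed
  have inj: "inj q"
    by (rule injI) (metis less_irrefl linorder_neqE strict)
  have "\<exists>x. q x = y" for y
  proof -
    \<comment> \<open>With slope at least \<open>c\<close>, moving by d from the origin changes
      \<open>q\<close> by at least |y| + |q 0|, hence past the value y.\<close>
    define d where "d = (\<bar>y\<bar> + \<bar>q 0\<bar>) / c"
    have d: "0 \<le> d" "c * d = \<bar>y\<bar> + \<bar>q 0\<bar>" using c(1) by (auto simp: d_def)
    have "q (- d) \<le> y" "y \<le> q d"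
      using growth[of "- d" 0] growth[of 0 d] d by auto
    then show ?thesis
      using IVT'[of q "- d" y d] d(1) continuous_on_subset[OF cont] by auto
  qed
  then have surj: "surj q" by (metis surjI)
  define \<kappa> where "\<kappa> = inv q"
  have \<kappa>: "\<kappa> (q k) = k" "q (\<kappa> \<tau>) = \<tau>" for k \<tau>
    unfolding \<kappa>_def using inj surj by (simp_all add: surj_f_inv_f)
  have less: "q a < q b \<longleftrightarrow> a < b" for a b
    using strict by (metis less_asym linorder_neqE)
  \<comment> \<open>Measurability of the inverse comes from its monotonicity.\<close>
  have "mono \<kappa>"
    by (rule monoI) (metis \<kappa>(2) less not_less)
  then have \<kappa>_meas: "\<kappa> \<in> borel_measurable borel" by (rule borel_measurable_mono)
  have "lborel = distr (density lborel (\<lambda>k. ennreal (q' k))) borel q"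
  proof (rule lborel_eqI)
    fix l u :: real assume "\<And>b. b \<in> Basis \<Longrightarrow> l \<bullet> b \<le> u \<bullet> b"
    then have lu: "l \<le> u" by simp
    have le: "\<kappa> l \<le> \<kappa> u" using lu \<open>mono \<kappa>\<close> by (simp add: monoD)
    have vimage: "q -` {l<..<u} = {\<kappa> l<..<\<kappa> u}"
      using less[of "\<kappa> l"] less[of _ "\<kappa> u"] by (auto simp: \<kappa>)
    have "((\<lambda>x. if x \<in> {\<kappa> l..\<kappa> u} then q' x else 0) has_integral (u - l)) UNIV"
      using hi[OF le] unfolding \<kappa>(2) by (simp only: has_integral_restrict_UNIV)
    then have "(\<integral>\<^sup>+x. ennreal (if x \<in> {\<kappa> l..\<kappa> u} then q' x else 0) \<partial>lborel) = u - l"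
      by (intro nn_integral_has_integral_lborel) (auto simp: q')
    moreover have "emeasure (distr (density lborel (\<lambda>k. ennreal (q' k))) borel q) (box l u)
      = (\<integral>\<^sup>+x. ennreal (q' x) * indicator {\<kappa> l<..<\<kappa> u} x \<partial>lborel)"
      by (simp add: emeasure_distr emeasure_density vimage box_real)
    moreover have "\<dots> = (\<integral>\<^sup>+x. ennreal (if x \<in> {\<kappa> l..\<kappa> u} then q' x else 0) \<partial>lborel)"
    proof (rule nn_integral_cong_AE)
      have "AE x in lborel. x \<noteq> \<kappa> l" "AE x in lborel. x \<noteq> \<kappa> u"
        by (rule AE_lborel_singleton)+
      then show "AE x in lborel. ennreal (q' x) * indicator {\<kappa> l<..<\<kappa> u} x = ennreal (if x \<in> {\<kappa> l..\<kappa> u} then q' x else 0)"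
        by eventually_elim (auto simp: indicator_def)
    qed
    ultimately show "emeasure (distr (density lborel (\<lambda>k. ennreal (q' k))) borel q) (box l u) = (\<Prod>b\<in>Basis. (u - l) \<bullet> b)"
      by simp
  qed simp
  then show ?thesis using that \<kappa>_meas \<kappa>(1) by blast
qed

text \<open>The function is g / q' composed with the inverse of \<open>q\<close>, so that h(tau)
  dtau corresponds to g(k) dk. In the squared norm one factor 1 / q' survives, which is why q'
  stands on the right of \<open>bound\<close>. That condition is imposed only where \<open>g\<close>
  is nonzero, so that \<open>q\<close> may be modified elsewhere.\<close>

lemma transported_function:
  fixes q q' :: "real \<Rightarrow> real"
  assumes cont: "continuous_on UNIV q" and S: "finite S"
    and der: "\<And>x. x \<notin> S \<Longrightarrow> (q has_real_derivative q' x) (at x)"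
    and [measurable]: "q' \<in> borel_measurable borel" and c: "0 < c" "\<And>x. c \<le> q' x"
    and g: "g \<in> weighted_L2 s" and C: "0 \<le> C"
    and bound: "\<And>k. g k \<noteq> 0 \<Longrightarrow> (1 + (q k)\<^sup>2) powr \<sigma> \<le> C\<^sup>2 * (q' k * (1 + k\<^sup>2) powr s)"
  obtains h where "h \<in> weighted_L2 \<sigma>" "weighted_norm \<sigma> h \<le> C * weighted_norm s g"
    "\<And>\<psi>. \<psi> \<in> borel_measurable borel \<Longrightarrow> (LBINT \<tau>. h \<tau> * \<psi> \<tau>) = (LBINT k. g k * \<psi> (q k))"
proof -
  obtain \<kappa> where [measurable]: "\<kappa> \<in> borel_measurable borel" and \<kappa>: "\<And>k. \<kappa> (q k) = k"
    and lb: "lborel = distr (density lborel (\<lambda>k. ennreal (q' k))) borel q"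
    using monotone_change_of_variables[OF cont S der assms(4) c] by blast
  have q': "0 < q' x" for x using c(1) c(2)[of x] by linarith
  have [measurable]: "q \<in> borel_measurable borel" by (rule borel_measurable_continuous_onI[OF cont])
  have [measurable]: "g \<in> borel_measurable borel" using weighted_L2_measurable[OF g] by simp
  have int: "(LBINT \<tau>. f \<tau>) = (LBINT k. q' k *\<^sub>R f (q k))"
    if [measurable]: "f \<in> borel_measurable borel" for f :: "real \<Rightarrow> 'b::{banach, second_countable_topology}"
    by (subst lb, subst integral_distr, simp, simp, subst integral_density) (auto simp: q' less_imp_le)
  have intble: "integrable lborel f \<longleftrightarrow> integrable lborel (\<lambda>k. q' k *\<^sub>R f (q k))"
    if [measurable]: "f \<in> borel_measurable borel" for f :: "real \<Rightarrow> 'b::{banach, second_countable_topology}"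
    by (subst lb, subst integrable_distr_eq, simp, simp, subst integrable_density) (auto simp: q' less_imp_le)
  define h where "h \<tau> = g (\<kappa> \<tau>) / of_real (q' (\<kappa> \<tau>))" for \<tau>
  have [measurable]: "h \<in> borel_measurable borel" unfolding h_def by measurable
  have le: "q' k *\<^sub>R ((1 + (q k)\<^sup>2) powr \<sigma> * (cmod (h (q k)))\<^sup>2) \<le> C\<^sup>2 * ((1 + k\<^sup>2) powr s * (cmod (g k))\<^sup>2)" for k
  proof (cases "g k = 0")
    case False
    have "q' k *\<^sub>R ((1 + (q k)\<^sup>2) powr \<sigma> * (cmod (h (q k)))\<^sup>2) = (1 + (q k)\<^sup>2) powr \<sigma> * ((cmod (g k))\<^sup>2 / q' k)"
      using q'[of k] by (simp add: h_def \<kappa> norm_divide power_divide power2_eq_square)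
    also have "\<dots> \<le> C\<^sup>2 * (q' k * (1 + k\<^sup>2) powr s) * ((cmod (g k))\<^sup>2 / q' k)"
      using q'[of k] by (intro mult_right_mono bound False) (simp add: less_imp_le)
    also have "\<dots> = C\<^sup>2 * ((1 + k\<^sup>2) powr s * (cmod (g k))\<^sup>2)"
      using q'[of k] by simp
    finally show ?thesis .
  qed (simp add: h_def \<kappa>)
  have i: "integrable lborel (\<lambda>k. C\<^sup>2 * ((1 + k\<^sup>2) powr s * (cmod (g k))\<^sup>2))"
    by (rule integrable_mult_right[OF weighted_L2_integrable[OF g]])
  have i': "integrable lborel (\<lambda>k. q' k *\<^sub>R ((1 + (q k)\<^sup>2) powr \<sigma> * (cmod (h (q k)))\<^sup>2))"
    by (rule Bochner_Integration.integrable_bound[OF i])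
      (use le q' in \<open>auto intro!: AE_I2 simp: abs_mult less_imp_le\<close>)
  have W: "h \<in> weighted_L2 \<sigma>"
    using intble[of "\<lambda>\<tau>. (1 + \<tau>\<^sup>2) powr \<sigma> * (cmod (h \<tau>))\<^sup>2"] i' by (simp add: weighted_L2_def)
  have "(weighted_norm \<sigma> h)\<^sup>2 = (LBINT k. q' k *\<^sub>R ((1 + (q k)\<^sup>2) powr \<sigma> * (cmod (h (q k)))\<^sup>2))"
    unfolding weighted_norm_square by (rule int) simp
  also have "\<dots> \<le> (LBINT k. C\<^sup>2 * ((1 + k\<^sup>2) powr s * (cmod (g k))\<^sup>2))"
    by (rule integral_mono[OF i' i le])
  also have "\<dots> = (C * weighted_norm s g)\<^sup>2"
    by (simp add: weighted_norm_square power_mult_distrib)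
  finally have N: "weighted_norm \<sigma> h \<le> C * weighted_norm s g"
    by (rule power2_le_imp_le) (simp add: C weighted_norm_nonneg)
  have "(LBINT \<tau>. h \<tau> * \<psi> \<tau>) = (LBINT k. g k * \<psi> (q k))" if [measurable]: "\<psi> \<in> borel_measurable borel" for \<psi>
  proof -
    have "(LBINT \<tau>. h \<tau> * \<psi> \<tau>) = (LBINT k. q' k *\<^sub>R (h (q k) * \<psi> (q k)))"
      by (rule int) simp
    also have "\<dots> = (LBINT k. g k * \<psi> (q k))"
    proof (rule Bochner_Integration.integral_cong)
      show "q' k *\<^sub>R (h (q k) * \<psi> (q k)) = g k * \<psi> (q k)" for k
        using q'[of k] by (simp add: h_def \<kappa> scaleR_conv_of_real)
    qed simp
    finally show ?thesis .
  qed
  with W N that show ?thesis by blast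
qed

section \<open>The phase at high frequency\<close>

definition phase' :: "real \<Rightarrow> real \<Rightarrow> real \<Rightarrow> real \<Rightarrow> real" where
  "phase' \<alpha> \<beta> \<delta> k = 3 * \<beta> * k\<^sup>2 - 2 * \<alpha> * k - \<delta>"

lemma phase_has_derivative: "(phase \<alpha> \<beta> \<delta> has_real_derivative phase' \<alpha> \<beta> \<delta> k) (at k)"
  unfolding phase_def[abs_def] phase'_def
  by (auto intro!: derivative_eq_intros simp: power2_eq_square)

lemma continuous_on_phase: "continuous_on A (phase \<alpha> \<beta> \<delta>)"
  unfolding phase_def[abs_def] by (intro continuous_intros)

lemma phase'_measurable [measurable]: "phase' \<alpha> \<beta> \<delta> \<in> borel_measurable borel"
  unfolding phase'_def by measurable

text \<open>Beyond R the leading terms dominate, for the phase and for its derivative. The last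
  conclusion gives the chord of the phase over [-R, R] a positive slope.\<close>

lemma phase_high_frequency:
  assumes "\<beta> > 0"
  obtains R where "1 \<le> R" "\<And>k. R \<le> \<bar>k\<bar> \<Longrightarrow> \<beta> / 2 * \<bar>k\<bar> ^ 3 \<le> \<bar>phase \<alpha> \<beta> \<delta> k\<bar>"
    "\<And>k. R \<le> \<bar>k\<bar> \<Longrightarrow> \<beta> * (1 + k\<^sup>2) \<le> phase' \<alpha> \<beta> \<delta> k" "phase \<alpha> \<beta> \<delta> (- R) < phase \<alpha> \<beta> \<delta> R"
proof -
  \<comment> \<open>For |k| \<ge> R the lower order terms amount to at most half of the cubic term,
    and in the derivative to at most a third of the quadratic one.\<close>
  define R where "R = max 1 (2 * (\<bar>\<alpha>\<bar> + \<bar>\<delta>\<bar>) / \<beta>)"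
  have R1: "1 \<le> R" by (simp add: R_def)
  have "2 * (\<bar>\<alpha>\<bar> + \<bar>\<delta>\<bar>) / \<beta> \<le> R" by (simp add: R_def)
  then have Rb: "2 * (\<bar>\<alpha>\<bar> + \<bar>\<delta>\<bar>) \<le> \<beta> * R" using assms by (simp add: field_simps)
  have big: "1 \<le> \<bar>k\<bar>" "2 * (\<bar>\<alpha>\<bar> + \<bar>\<delta>\<bar>) \<le> \<beta> * \<bar>k\<bar>" if "R \<le> \<bar>k\<bar>" for k
    using that R1 order_trans[OF Rb mult_left_mono[OF that less_imp_le[OF assms]]] by auto
  have sq: "\<bar>k\<bar> \<le> k\<^sup>2" if "1 \<le> \<bar>k\<bar>" for k :: real
    using mult_left_mono[OF that, of "\<bar>k\<bar>"] by (simp add: power2_eq_square)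
  show ?thesis
  proof (rule that[OF R1])
    fix k assume k: "R \<le> \<bar>k\<bar>"
    note b = big[OF k] and s = sq[OF big(1)[OF k]]
    have "\<bar>\<alpha> * k\<^sup>2 + \<delta> * k\<bar> \<le> \<bar>\<alpha>\<bar> * k\<^sup>2 + \<bar>\<delta>\<bar> * \<bar>k\<bar>"
      by (rule order_trans[OF abs_triangle_ineq]) (simp add: abs_mult)
    also have "\<dots> \<le> \<bar>\<alpha>\<bar> * k\<^sup>2 + \<bar>\<delta>\<bar> * k\<^sup>2"
      by (intro add_left_mono mult_left_mono s) simp
    also have "\<dots> = (\<bar>\<alpha>\<bar> + \<bar>\<delta>\<bar>) * k\<^sup>2" by (simp add: algebra_simps)
    also have "\<dots> \<le> (\<beta> * \<bar>k\<bar> / 2) * k\<^sup>2"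
      using b(2) by (intro mult_right_mono) auto
    also have "\<dots> = \<beta> / 2 * \<bar>k\<bar> ^ 3" by (simp add: power3_eq_cube power2_eq_square)
    finally have low: "\<bar>\<alpha> * k\<^sup>2 + \<delta> * k\<bar> \<le> \<beta> / 2 * \<bar>k\<bar> ^ 3" .
    have "\<bar>\<beta> * k ^ 3\<bar> = \<beta> * \<bar>k\<bar> ^ 3" using assms by (simp add: abs_mult power_abs)
    moreover have "phase \<alpha> \<beta> \<delta> k = \<beta> * k ^ 3 - (\<alpha> * k\<^sup>2 + \<delta> * k)" by (simp add: phase_def)
    ultimately show "\<beta> / 2 * \<bar>k\<bar> ^ 3 \<le> \<bar>phase \<alpha> \<beta> \<delta> k\<bar>"
      using low abs_triangle_ineq2[of "\<beta> * k ^ 3" "\<alpha> * k\<^sup>2 + \<delta> * k"] by simp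
    have "2 * \<alpha> * k + \<delta> \<le> 2 * (\<bar>\<alpha>\<bar> * \<bar>k\<bar>) + \<bar>\<delta>\<bar>"
      using abs_ge_self[of "\<alpha> * k"] abs_ge_self[of \<delta>] by (simp add: abs_mult)
    also have "\<dots> \<le> 2 * (\<bar>\<alpha>\<bar> * \<bar>k\<bar>) + \<bar>\<delta>\<bar> * \<bar>k\<bar>"
      using mult_left_mono[OF b(1), of "\<bar>\<delta>\<bar>"] by simp
    also have "\<dots> \<le> 2 * (\<bar>\<alpha>\<bar> + \<bar>\<delta>\<bar>) * \<bar>k\<bar>" by (simp add: algebra_simps)
    also have "\<dots> \<le> \<beta> * \<bar>k\<bar> * \<bar>k\<bar>" by (intro mult_right_mono b) simp
    also have "\<dots> = \<beta> * k\<^sup>2" by (simp add: power2_eq_square mult.assoc)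
    finally have "2 * \<alpha> * k + \<delta> \<le> \<beta> * k\<^sup>2" .
    moreover have "\<beta> * 1 \<le> \<beta> * k\<^sup>2" using assms b(1) s by (intro mult_left_mono) auto
    ultimately show "\<beta> * (1 + k\<^sup>2) \<le> phase' \<alpha> \<beta> \<delta> k" by (simp add: phase'_def algebra_simps)
  next
    have "\<delta> < \<beta> * R\<^sup>2"
    proof -
      have "\<beta> * R \<le> \<beta> * R\<^sup>2" using R1 assms sq[of R] by (intro mult_left_mono) auto
      moreover have "0 < \<beta> * R" using assms R1 by simp
      moreover have "2 * \<bar>\<delta>\<bar> \<le> \<beta> * R" using Rb by simp
      ultimately show ?thesis by linarith
    qed
    then have "R * \<delta> < R * (\<beta> * R\<^sup>2)" using R1 by simp
    then show "phase \<alpha> \<beta> \<delta> (- R) < phase \<alpha> \<beta> \<delta> R"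
      by (simp add: phase_def power3_eq_cube power2_eq_square mult_ac)
  qed
qed

lemma phase_square_lower_bound:
  assumes "\<beta> > 0"
  obtains c where "0 < c" "\<And>k. c * (1 + k\<^sup>2) ^ 3 \<le> 1 + (phase \<alpha> \<beta> \<delta> k)\<^sup>2"
proof -
  obtain R where R: "1 \<le> R" "\<And>k. R \<le> \<bar>k\<bar> \<Longrightarrow> \<beta> / 2 * \<bar>k\<bar> ^ 3 \<le> \<bar>phase \<alpha> \<beta> \<delta> k\<bar>"
    using phase_high_frequency[OF assms] by metis
  \<comment> \<open>For |k| \<ge> R one has (1 + k^2)^3 \<le> 8 k^6, and 8 / 32 is the square of the
    factor 1 / 2 in front of the cubic bound; below R it suffices that c (1 + R^2)^3 \<le>
    1.\<close>
  define c where "c = min (\<beta>\<^sup>2 / 32) (1 / (1 + R\<^sup>2) ^ 3)"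
  have pos: "0 < (1 + R\<^sup>2) ^ 3" by (intro zero_less_power) (simp add: add_pos_nonneg)
  have "c * (1 + k\<^sup>2) ^ 3 \<le> 1 + (phase \<alpha> \<beta> \<delta> k)\<^sup>2" for k
  proof (cases "R \<le> \<bar>k\<bar>")
    case True
    have "1 \<le> k\<^sup>2" using True R(1) by (simp add: abs_square_le_1 flip: not_less) (metis abs_square_less_1 not_less order_trans)
    then have "(1 + k\<^sup>2) ^ 3 \<le> (2 * k\<^sup>2) ^ 3" by (intro power_mono) auto
    then have "c * (1 + k\<^sup>2) ^ 3 \<le> \<beta>\<^sup>2 / 32 * (2 * k\<^sup>2) ^ 3"
      by (intro mult_mono) (auto simp: c_def)
    also have "\<dots> = (\<beta> / 2 * \<bar>k\<bar> ^ 3)\<^sup>2"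
      by (simp add: power_mult_distrib power_divide flip: power_mult)
    also have "\<dots> \<le> \<bar>phase \<alpha> \<beta> \<delta> k\<bar>\<^sup>2"
      using assms by (intro power_mono R True) auto
    finally show ?thesis by simp
  next
    case False
    then have "k\<^sup>2 \<le> R\<^sup>2" by (simp add: abs_le_square_iff[symmetric])
    then have "(1 + k\<^sup>2) ^ 3 \<le> (1 + R\<^sup>2) ^ 3" by (intro power_mono) auto
    then have "c * (1 + k\<^sup>2) ^ 3 \<le> 1 / (1 + R\<^sup>2) ^ 3 * (1 + R\<^sup>2) ^ 3"
      by (intro mult_mono) (auto simp: c_def)
    also have "\<dots> = 1" using pos by simp
    finally show ?thesis by (simp add: add_increasing2)
  qed
  moreover have "0 < c" using assms pos by (simp add: c_def)
  ultimately show ?thesis using that by blast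
qed

lemma phase_square_upper_bound:
  obtains C where "0 < C" "\<And>k. 1 + (phase \<alpha> \<beta> \<delta> k)\<^sup>2 \<le> C * (1 + k\<^sup>2) ^ 3"
proof -
  have "1 + (phase \<alpha> \<beta> \<delta> k)\<^sup>2 \<le> (1 + 3 * (\<beta>\<^sup>2 + \<alpha>\<^sup>2 + \<delta>\<^sup>2)) * (1 + k\<^sup>2) ^ 3" for k
  proof -
    have three: "(a - b - c)\<^sup>2 \<le> 3 * (a\<^sup>2 + b\<^sup>2 + c\<^sup>2)" for a b c :: real
    proof -
      have "3 * (a\<^sup>2 + b\<^sup>2 + c\<^sup>2) - (a - b - c)\<^sup>2 = (a + b)\<^sup>2 + (a + c)\<^sup>2 + (b - c)\<^sup>2"
        by (simp add: power2_eq_square algebra_simps)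
      then show ?thesis by (smt (verit) zero_le_power2)
    qed
    have pw: "k\<^sup>2 ^ m \<le> (1 + k\<^sup>2) ^ 3" if "m \<le> 3" for m
    proof -
      have "k\<^sup>2 ^ m \<le> (1 + k\<^sup>2) ^ m" by (intro power_mono) auto
      also have "\<dots> \<le> (1 + k\<^sup>2) ^ 3" using that by (intro power_increasing) auto
      finally show ?thesis .
    qed
    have "(phase \<alpha> \<beta> \<delta> k)\<^sup>2 \<le> 3 * ((\<beta> * k ^ 3)\<^sup>2 + (\<alpha> * k\<^sup>2)\<^sup>2 + (\<delta> * k)\<^sup>2)"
      unfolding phase_def by (rule three)
    also have "\<dots> = 3 * (\<beta>\<^sup>2 * k\<^sup>2 ^ 3 + \<alpha>\<^sup>2 * k\<^sup>2 ^ 2 + \<delta>\<^sup>2 * k\<^sup>2 ^ 1)"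
      by (simp add: power_mult_distrib flip: power_mult)
    also have "\<dots> \<le> 3 * (\<beta>\<^sup>2 * (1 + k\<^sup>2) ^ 3 + \<alpha>\<^sup>2 * (1 + k\<^sup>2) ^ 3 + \<delta>\<^sup>2 * (1 + k\<^sup>2) ^ 3)"
      by (intro mult_left_mono add_mono pw) auto
    finally have "(phase \<alpha> \<beta> \<delta> k)\<^sup>2 \<le> 3 * (\<beta>\<^sup>2 * (1 + k\<^sup>2) ^ 3 + \<alpha>\<^sup>2 * (1 + k\<^sup>2) ^ 3 + \<delta>\<^sup>2 * (1 + k\<^sup>2) ^ 3)" .
    moreover have "1 \<le> (1 + k\<^sup>2) ^ 3" by (rule one_le_power) simp
    ultimately have "1 + (phase \<alpha> \<beta> \<delta> k)\<^sup>2 \<le> (1 + k\<^sup>2) ^ 3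
      + 3 * (\<beta>\<^sup>2 * (1 + k\<^sup>2) ^ 3 + \<alpha>\<^sup>2 * (1 + k\<^sup>2) ^ 3 + \<delta>\<^sup>2 * (1 + k\<^sup>2) ^ 3)"
      by (rule add_mono[rotated])
    also have "\<dots> = (1 + 3 * (\<beta>\<^sup>2 + \<alpha>\<^sup>2 + \<delta>\<^sup>2)) * (1 + k\<^sup>2) ^ 3"
      by (simp only: distrib_right distrib_left mult_1 mult.assoc)
    finally show ?thesis .
  qed
  moreover have "0 < 1 + 3 * (\<beta>\<^sup>2 + \<alpha>\<^sup>2 + \<delta>\<^sup>2)" by (intro add_pos_nonneg) auto
  ultimately show ?thesis using that by blast
qed

text \<open>The exponent \<open>(s + 1) / 3\<close>: the weight \<open>1 + p\<^sup>2\<close> is comparable to \<open>(1 + k\<^sup>2) ^ 3\<close>,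
  and the Jacobian \<open>p'\<close> contributes another factor \<open>1 + k\<^sup>2\<close>.\<close>

lemma phase_weight:
  assumes "\<beta> > 0" "0 < d"
  obtains C where "0 \<le> C" "\<And>k. d * (1 + k\<^sup>2) \<le> phase' \<alpha> \<beta> \<delta> k \<Longrightarrow>
    (1 + (phase \<alpha> \<beta> \<delta> k)\<^sup>2) powr ((s + 1) / 3) \<le> C\<^sup>2 * (phase' \<alpha> \<beta> \<delta> k * (1 + k\<^sup>2) powr s)"
proof -
  obtain c where c: "0 < c" "\<And>k. c * (1 + k\<^sup>2) ^ 3 \<le> 1 + (phase \<alpha> \<beta> \<delta> k)\<^sup>2"
    using phase_square_lower_bound[OF assms(1)] by blast
  obtain C where C: "0 < C" "\<And>k. 1 + (phase \<alpha> \<beta> \<delta> k)\<^sup>2 \<le> C * (1 + k\<^sup>2) ^ 3"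
    using phase_square_upper_bound by blast
  define \<sigma> where "\<sigma> = (s + 1) / 3"
  \<comment> \<open>The sign of the exponent decides whether the upper or the lower bound on 1 + p^2
    is the relevant one; the sum of the two constants covers both cases.\<close>
  define A where "A = (c powr \<sigma> + C powr \<sigma>) / d"
  have A: "0 \<le> A" unfolding A_def using assms(2) by simp
  show ?thesis
  proof (rule that[of "sqrt A"])
    fix k assume d: "d * (1 + k\<^sup>2) \<le> phase' \<alpha> \<beta> \<delta> k"
    have pos: "0 < 1 + k\<^sup>2" by (simp add: add_pos_nonneg)
    have mult: "(a * (1 + k\<^sup>2) ^ 3) powr \<sigma> = a powr \<sigma> * ((1 + k\<^sup>2) powr s * (1 + k\<^sup>2))" if "0 < a" for a
    proof -
      have "(1 + k\<^sup>2) ^ 3 = (1 + k\<^sup>2) powr 3"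
        using powr_realpow[OF pos, of 3] by simp
      then have "((1 + k\<^sup>2) ^ 3) powr \<sigma> = (1 + k\<^sup>2) powr (3 * \<sigma>)"
        by (simp only: powr_powr)
      also have "3 * \<sigma> = s + 1" by (simp add: \<sigma>_def)
      also have "(1 + k\<^sup>2) powr (s + 1) = (1 + k\<^sup>2) powr s * (1 + k\<^sup>2)" using pos by (simp add: powr_add)
      finally show ?thesis using that pos by (simp add: powr_mult)
    qed
    have "(1 + (phase \<alpha> \<beta> \<delta> k)\<^sup>2) powr \<sigma> \<le> (c powr \<sigma> + C powr \<sigma>) * ((1 + k\<^sup>2) powr s * (1 + k\<^sup>2))"
    proof (cases "0 \<le> \<sigma>")
      case True
      have "(1 + (phase \<alpha> \<beta> \<delta> k)\<^sup>2) powr \<sigma> \<le> (C * (1 + k\<^sup>2) ^ 3) powr \<sigma>"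
        by (intro powr_mono2 True C) simp
      then show ?thesis
        using mult[OF C(1)] pos by (simp add: distrib_right add_increasing)
    next
      case False
      have "(1 + (phase \<alpha> \<beta> \<delta> k)\<^sup>2) powr \<sigma> \<le> (c * (1 + k\<^sup>2) ^ 3) powr \<sigma>"
        using False pos c by (intro powr_mono2') auto
      then show ?thesis
        using mult[OF c(1)] pos by (simp add: distrib_right add_increasing2)
    qed
    also have "\<dots> = A * (d * (1 + k\<^sup>2) * (1 + k\<^sup>2) powr s)"
      using assms(2) by (simp add: A_def)
    also have "\<dots> \<le> A * (phase' \<alpha> \<beta> \<delta> k * (1 + k\<^sup>2) powr s)"
      by (intro mult_left_mono mult_right_mono d A) simp
    finally show "(1 + (phase \<alpha> \<beta> \<delta> k)\<^sup>2) powr ((s + 1) / 3) \<le> (sqrt A)\<^sup>2 * (phase' \<alpha> \<beta> \<delta> k * (1 + k\<^sup>2) powr s)"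
      using A by (simp add: \<sigma>_def)
  qed (simp add: A)
qed

lemma phase'_elliptic:
  assumes "\<beta> > 0" "\<alpha>\<^sup>2 + 3 * \<beta> * \<delta> < 0"
  obtains d where "0 < d" "\<And>k. d * (1 + k\<^sup>2) \<le> phase' \<alpha> \<beta> \<delta> k"
proof -
  \<comment> \<open>Completing the square: the derivative of the phase is 3 \<beta> (k - a)^2 + D,
    and the negative discriminant says that D > 0.\<close>
  define a where "a = \<alpha> / (3 * \<beta>)"
  define D where "D = - (\<alpha>\<^sup>2 + 3 * \<beta> * \<delta>) / (3 * \<beta>)"
  have D: "0 < D" unfolding D_def using assms by simp
  have eq: "phase' \<alpha> \<beta> \<delta> k = 3 * \<beta> * (k - a)\<^sup>2 + D" for k
    unfolding phase'_def a_def D_def using assms(1) by (simp add: field_simps power2_eq_square)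
  \<comment> \<open>Calibrated to k^2 \<le> 2 (k - a)^2 + 2 a^2: one entry is matched with the
    square, the other with the constant D.\<close>
  define d where "d = min (3 * \<beta> / 2) (D / (1 + 2 * a\<^sup>2))"
  have p: "0 < 1 + 2 * a\<^sup>2" by (simp add: add_pos_nonneg)
  have d: "0 < d" unfolding d_def using D p assms(1) by simp
  have dD: "d \<le> D / (1 + 2 * a\<^sup>2)" "d \<le> 3 * \<beta> / 2" by (simp_all only: d_def min.cobounded1 min.cobounded2)
  have "d * (1 + k\<^sup>2) \<le> phase' \<alpha> \<beta> \<delta> k" for k
  proof -
    have "2 * (k - a)\<^sup>2 + 2 * a\<^sup>2 - k\<^sup>2 = (k - 2 * a)\<^sup>2"
      by (simp add: power2_eq_square algebra_simps)
    then have "k\<^sup>2 \<le> 2 * (k - a)\<^sup>2 + 2 * a\<^sup>2" by (smt (verit) zero_le_power2)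
    then have "d * (1 + k\<^sup>2) \<le> d * ((1 + 2 * a\<^sup>2) + 2 * (k - a)\<^sup>2)"
      using d by (intro mult_left_mono) auto
    also have "\<dots> = d * (1 + 2 * a\<^sup>2) + d * (2 * (k - a)\<^sup>2)" by (rule distrib_left)
    also have "\<dots> \<le> D / (1 + 2 * a\<^sup>2) * (1 + 2 * a\<^sup>2) + 3 * \<beta> / 2 * (2 * (k - a)\<^sup>2)"
      using p by (intro add_mono mult_right_mono dD) auto
    also have "\<dots> = phase' \<alpha> \<beta> \<delta> k" using p by (simp add: eq)
    finally show ?thesis .
  qed
  with d that show ?thesis by blast
qed

text \<open>Inside \<open>[-R, R]\<close>, where the phase need not be monotone, it is replaced by its linear
  interpolation; this does not affect functions vanishing there.\<close>

lemma transport_by_phase_high: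
  assumes "\<beta> > 0" "1 \<le> R" and d: "\<And>k. R \<le> \<bar>k\<bar> \<Longrightarrow> \<beta> * (1 + k\<^sup>2) \<le> phase' \<alpha> \<beta> \<delta> k"
    and lt: "phase \<alpha> \<beta> \<delta> (- R) < phase \<alpha> \<beta> \<delta> R"
  obtains C where "0 \<le> C" "\<And>g. g \<in> weighted_L2 s \<Longrightarrow> (\<And>k. \<bar>k\<bar> \<le> R \<Longrightarrow> g k = 0) \<Longrightarrow>
    \<exists>h\<in>weighted_L2 ((s + 1) / 3). weighted_norm ((s + 1) / 3) h \<le> C * weighted_norm s g \<and>
      (\<forall>\<psi>\<in>borel_measurable borel. (LBINT \<tau>. h \<tau> * \<psi> \<tau>) = (LBINT k. g k * \<psi> (phase \<alpha> \<beta> \<delta> k)))"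
proof -
  let ?p = "phase \<alpha> \<beta> \<delta>" and ?p' = "phase' \<alpha> \<beta> \<delta>"
  define m where "m = (?p R - ?p (- R)) / (2 * R)"
  define b where "b = (?p R + ?p (- R)) / 2"
  define q where "q k = (if k \<in> {-R..R} then m * k + b else ?p k)" for k
  define q' where "q' k = (if k \<in> {-R..R} then m else ?p' k)" for k
  have m: "0 < m" unfolding m_def using lt assms(2) by simp
  have ends: "m * R + b = ?p R" "m * (- R) + b = ?p (- R)"
    unfolding m_def b_def using assms(2) by (simp_all add: field_simps)
  obtain C where C: "0 \<le> C" "\<And>k. \<beta> * (1 + k\<^sup>2) \<le> ?p' k \<Longrightarrow>
    (1 + (?p k)\<^sup>2) powr ((s + 1) / 3) \<le> C\<^sup>2 * (?p' k * (1 + k\<^sup>2) powr s)"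
    using phase_weight[OF assms(1,1)] by blast
  have cont: "continuous_on UNIV q"
  proof -
    have "UNIV = {-R..R} \<union> ({..-R} \<union> {R..})" by auto
    moreover have "continuous_on ({-R..R} \<union> ({..-R} \<union> {R..})) q"
      unfolding q_def[abs_def]
      by (rule continuous_on_cases)
        (use ends in \<open>auto intro!: continuous_intros continuous_on_phase closed_Un simp: not_le dest!: antisym\<close>)
    ultimately show ?thesis by simp
  qed
  \<comment> \<open>The two junctions form the exceptional set of the change of variables.\<close>
  have der: "(q has_real_derivative q' x) (at x)" if "x \<notin> {-R, R}" for x
  proof (cases "x \<in> {-R..R}")
    case True
    with that have x: "x \<in> {-R<..<R}" by auto
    have "((\<lambda>k. m * k + b) has_real_derivative m) (at x)" by (auto intro!: derivative_eq_intros)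
    then have "(q has_real_derivative m) (at x)"
      by (rule has_field_derivative_transform_within_open[of _ _ _ "{-R<..<R}"]) (use x in \<open>auto simp: q_def\<close>)
    then show ?thesis using True by (simp add: q'_def)
  next
    case False
    have "(q has_real_derivative ?p' x) (at x)"
      by (rule has_field_derivative_transform_within_open[OF phase_has_derivative, of "- {-R..R}"])
        (use False in \<open>auto simp: q_def\<close>)
    moreover have "q' x = ?p' x" using False by (auto simp: q'_def)
    ultimately show ?thesis by simp
  qed
  have meas: "q' \<in> borel_measurable borel" unfolding q'_def[abs_def] by measurable
  have q'_ge: "min m \<beta> \<le> q' x" for x
  proof (cases "x \<in> {-R..R}")
    case False
    then have "R \<le> \<bar>x\<bar>" by auto
    then have "\<beta> * (1 + x\<^sup>2) \<le> ?p' x" by (rule d)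
    moreover have "\<beta> * 1 \<le> \<beta> * (1 + x\<^sup>2)" using assms(1) by (intro mult_left_mono) auto
    ultimately have "\<beta> \<le> ?p' x" by simp
    with False show ?thesis by (simp add: q'_def min_le_iff_disj)
  qed (simp add: q'_def)
  show ?thesis
  proof (rule that[OF C(1)])
    fix g assume g: "g \<in> weighted_L2 s" and g0: "\<And>k. \<bar>k\<bar> \<le> R \<Longrightarrow> g k = 0"
    have out: "q k = ?p k" "q' k = ?p' k" "R \<le> \<bar>k\<bar>" if "g k \<noteq> 0" for k
    proof -
      have "\<not> \<bar>k\<bar> \<le> R" using that g0 by blast
      then show "q k = ?p k" "q' k = ?p' k" "R \<le> \<bar>k\<bar>" by (auto simp: q_def q'_def)
    qed
    have bd: "(1 + (q k)\<^sup>2) powr ((s + 1) / 3) \<le> C\<^sup>2 * (q' k * (1 + k\<^sup>2) powr s)" if "g k \<noteq> 0" for k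
      unfolding out[OF that] by (rule C(2)[OF d[OF out(3)[OF that]]])
    have fin: "finite {-R, R}" by simp
    have pos: "0 < min m \<beta>" using m assms(1) by simp
    obtain h where h: "h \<in> weighted_L2 ((s + 1) / 3)" "weighted_norm ((s + 1) / 3) h \<le> C * weighted_norm s g"
      "\<And>\<psi>. \<psi> \<in> borel_measurable borel \<Longrightarrow> (LBINT \<tau>. h \<tau> * \<psi> \<tau>) = (LBINT k. g k * \<psi> (q k))"
      using transported_function[OF cont fin der meas pos q'_ge g C(1) bd] by blast
    have "(\<lambda>k. g k * \<psi> (q k)) = (\<lambda>k. g k * \<psi> (?p k))" for \<psi>
      using out(1) by (metis mult_zero_left)
    with h show "\<exists>h\<in>weighted_L2 ((s + 1) / 3). weighted_norm ((s + 1) / 3) h \<le> C * weighted_norm s g \<and>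
      (\<forall>\<psi>\<in>borel_measurable borel. (LBINT \<tau>. h \<tau> * \<psi> \<tau>) = (LBINT k. g k * \<psi> (?p k)))"
      by (intro bexI[of _ h]) auto
  qed
qed

lemma transport_by_phase_elliptic:
  assumes "\<beta> > 0" "\<alpha>\<^sup>2 + 3 * \<beta> * \<delta> < 0"
  obtains C where "0 \<le> C" "\<And>g. g \<in> weighted_L2 s \<Longrightarrow>
    \<exists>h\<in>weighted_L2 ((s + 1) / 3). weighted_norm ((s + 1) / 3) h \<le> C * weighted_norm s g \<and>
      (\<forall>\<psi>\<in>borel_measurable borel. (LBINT \<tau>. h \<tau> * \<psi> \<tau>) = (LBINT k. g k * \<psi> (phase \<alpha> \<beta> \<delta> k)))"
proof -
  let ?p = "phase \<alpha> \<beta> \<delta>" and ?p' = "phase' \<alpha> \<beta> \<delta>"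
  obtain d where d: "0 < d" "\<And>k. d * (1 + k\<^sup>2) \<le> ?p' k"
    using phase'_elliptic[OF assms] by blast
  have d1: "d \<le> ?p' k" for k
  proof -
    have "d * 1 \<le> d * (1 + k\<^sup>2)" using d(1) by (intro mult_left_mono) auto
    with d(2)[of k] show ?thesis by simp
  qed
  obtain C where C: "0 \<le> C" "\<And>k. d * (1 + k\<^sup>2) \<le> ?p' k \<Longrightarrow>
    (1 + (?p k)\<^sup>2) powr ((s + 1) / 3) \<le> C\<^sup>2 * (?p' k * (1 + k\<^sup>2) powr s)"
    using phase_weight[OF assms(1) d(1)] by blast
  show ?thesis
  proof (rule that[OF C(1)])
    fix g assume g: "g \<in> weighted_L2 s"
    obtain h where "h \<in> weighted_L2 ((s + 1) / 3)" "weighted_norm ((s + 1) / 3) h \<le> C * weighted_norm s g"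
      "\<And>\<psi>. \<psi> \<in> borel_measurable borel \<Longrightarrow> (LBINT \<tau>. h \<tau> * \<psi> \<tau>) = (LBINT k. g k * \<psi> (?p k))"
      using transported_function[OF continuous_on_phase finite.emptyI phase_has_derivative phase'_measurable d(1) d1 g C(1) C(2)[OF d(2)]]
      by blast
    then show "\<exists>h\<in>weighted_L2 ((s + 1) / 3). weighted_norm ((s + 1) / 3) h \<le> C * weighted_norm s g \<and>
      (\<forall>\<psi>\<in>borel_measurable borel. (LBINT \<tau>. h \<tau> * \<psi> \<tau>) = (LBINT k. g k * \<psi> (?p k)))"
      by blast
  qed
qed

section \<open>Localisation in time of the low frequencies\<close>

text \<open>The Fourier transform of the indicator of [-a, a], which is 2 sin(a u) / u away from u =
  0.\<close>

definition interval_kernel :: "real \<Rightarrow> real \<Rightarrow> complex" where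
  "interval_kernel a u = (LBINT y. indicator {-a..a} y *\<^sub>R iexp (- y * u))"

lemma interval_kernel_measurable [measurable]: "interval_kernel a \<in> borel_measurable borel"
proof -
  have "(\<lambda>u. LBINT y. indicator {-a..a} y *\<^sub>R iexp (- y * u)) \<in> borel_measurable lborel"
    by (rule lborel.borel_measurable_lebesgue_integral) measurable
  then show ?thesis by (simp add: interval_kernel_def[abs_def])
qed

text \<open>Combines the trivial bound 2 a for |a u| \<le> 1 with the decay 2 / |u| beyond. The
  integral of the majorant is linear in a.\<close>

lemma interval_kernel_bound:
  assumes "0 < a"
  shows "(cmod (interval_kernel a u))\<^sup>2 \<le> 8 * a\<^sup>2 / (1 + (a * u)\<^sup>2)"
proof -
  have pos: "0 < 1 + (a * u)\<^sup>2" by (simp add: add_pos_nonneg)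
  show ?thesis
  proof (cases "(a * u)\<^sup>2 \<le> 1")
    case True
    have "cmod (interval_kernel a u) \<le> (LBINT y. norm (indicator {-a..a} y *\<^sub>R iexp (- y * u)))"
      unfolding interval_kernel_def by (rule integral_norm_bound)
    also have "\<dots> = (LBINT y. indicator {-a..a} y)"
      unfolding norm_scaleR norm_iexp by simp
    also have "\<dots> = 2 * a" using assms by simp
    finally have "(cmod (interval_kernel a u))\<^sup>2 \<le> (2 * a)\<^sup>2" by (intro power_mono) auto
    also have "\<dots> \<le> 8 * a\<^sup>2 / (1 + (a * u)\<^sup>2)"
    proof -
      have "(2 * a)\<^sup>2 * (1 + (a * u)\<^sup>2) \<le> (2 * a)\<^sup>2 * 2"
        using True by (intro mult_left_mono) auto
      then show ?thesis unfolding pos_le_divide_eq[OF pos] by (simp add: power_mult_distrib)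
    qed
    finally show ?thesis .
  next
    case False
    then have u: "u \<noteq> 0" by auto
    define F where "F y = 1 / (- \<i> * of_real u) * iexp (- y * u)" for y
    have dF: "(F has_vector_derivative iexp (- y * u)) (at y)" for y
      using has_vector_derivative_mult_right[OF iexp_has_vector_derivative[of u y], of "1 / (- \<i> * of_real u)"] u
      by (simp add: F_def[abs_def])
    have "(LBINT y. indicator {-a..a} y *\<^sub>R iexp (- y * u)) = F a - F (- a)"
    proof (rule integral_FTC_Icc)
      show "(F has_vector_derivative iexp (- y * u)) (at y within {-a..a})" for y
        by (rule has_vector_derivative_at_within[OF dF])
      show "continuous_on {-a..a} (\<lambda>y. iexp (- y * u))" by (intro continuous_intros)
    qed (use assms in simp)
    then have "interval_kernel a u = F a - F (- a)" by (simp only: interval_kernel_def)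
    also have "cmod \<dots> \<le> cmod (F a) + cmod (F (- a))" by (rule norm_triangle_ineq4)
    also have "\<dots> = 2 / \<bar>u\<bar>" unfolding F_def norm_divide norm_mult norm_iexp by simp
    finally have "(cmod (interval_kernel a u))\<^sup>2 \<le> (2 / \<bar>u\<bar>)\<^sup>2" by (intro power_mono) auto
    also have "\<dots> \<le> 8 * a\<^sup>2 / (1 + (a * u)\<^sup>2)"
    proof -
      have "(2 / \<bar>u\<bar>)\<^sup>2 * (1 + (a * u)\<^sup>2) \<le> (2 / \<bar>u\<bar>)\<^sup>2 * (2 * (a * u)\<^sup>2)"
        using False by (intro mult_left_mono) auto
      also have "\<dots> = 8 * a\<^sup>2" using u by (simp add: power_divide power_mult_distrib)
      finally show ?thesis unfolding pos_le_divide_eq[OF pos] .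
    qed
    finally show ?thesis .
  qed
qed

lemma integral_interval_kernel_majorant:
  assumes "0 < a"
  shows "integrable lborel (\<lambda>u. 8 * a\<^sup>2 / (1 + (a * u)\<^sup>2))" "(LBINT u. 8 * a\<^sup>2 / (1 + (a * u)\<^sup>2)) = 8 * a * pi"
proof -
  show "integrable lborel (\<lambda>u. 8 * a\<^sup>2 / (1 + (a * u)\<^sup>2))"
    using lborel_integrable_real_affine[OF integrable_inverse_1_plus_square_UNIV[of "8 * a\<^sup>2"], of a 0] assms by simp
  have "8 * a\<^sup>2 * pi = (LBINT u. 8 * a\<^sup>2 / (1 + u\<^sup>2))"
    by (rule integral_inverse_1_plus_square_UNIV[symmetric])
  also have "\<dots> = \<bar>a\<bar> *\<^sub>R (LBINT u. 8 * a\<^sup>2 / (1 + (0 + a * u)\<^sup>2))"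
    using assms by (intro lborel_integral_real_affine) simp
  finally show "(LBINT u. 8 * a\<^sup>2 / (1 + (a * u)\<^sup>2)) = 8 * a * pi"
    using assms by (simp add: power2_eq_square)
qed

text \<open>Convolution with a bump of mass 1 supported in [-1, 1] keeps the value 1 up to distance
  1 from the ends of [-a, a], and it turns the transform into a product.\<close>

lemma mollified_indicator:
  fixes \<rho> :: "real \<Rightarrow> complex"
  assumes \<rho>: "\<rho> \<in> test_functions UNIV" "\<And>x. 1 < \<bar>x\<bar> \<Longrightarrow> \<rho> x = 0" "(LBINT x. \<rho> x) = 1"
  defines "\<theta> a t \<equiv> LBINT y. indicator {-a..a} y *\<^sub>R \<rho> (t - y)"
  shows mollified_indicator_integrable: "integrable lborel (\<theta> a)"
    and mollified_indicator_eq_1: "\<bar>t\<bar> \<le> a - 1 \<Longrightarrow> \<theta> a t = 1"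
    and fourier_mollified_indicator: "fourier (\<theta> a) u = fourier \<rho> u * interval_kernel a u"
proof -
  obtain B where B: "B \<ge> 0" "\<And>x. cmod (\<rho> x) \<le> B"
    using test_functions_bounded[OF \<rho>(1)] by blast
  have [measurable]: "\<rho> \<in> borel_measurable borel" by (rule test_functions_measurable[OF \<rho>(1)])
  have ind: "integrable lborel (indicator {c..d} :: real \<Rightarrow> real)" for c d
    by (rule integrable_real_indicator) (auto simp: emeasure_lborel_Icc_eq)
  have bound: "norm (z * (indicator {-a..a} y *\<^sub>R \<rho> (t - y))) \<le> (B * indicator {-a-1..a+1} t) * indicator {-a..a} y"
    if "cmod z = 1" for z t y
  proof (cases "y \<in> {-a..a} \<and> \<bar>t - y\<bar> \<le> 1")
    case True
    then have "t \<in> {-a-1..a+1}" by auto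
    with True that B show ?thesis by (simp add: norm_mult)
  next
    case False
    then have "y \<notin> {-a..a} \<or> \<rho> (t - y) = 0" using \<rho>(2) by force
    then show ?thesis using B(1) by auto
  qed
  have meas: "(\<lambda>(t, y). w t * (indicator {-a..a} y *\<^sub>R \<rho> (t - y))) \<in> borel_measurable (lborel \<Otimes>\<^sub>M lborel)"
    if [measurable]: "w \<in> borel_measurable borel" for w :: "real \<Rightarrow> complex"
    by measurable
  note pair = integrable_pair_of_product_bound[OF _ integrable_mult_right[OF ind] ind]
    Fubini_of_product_bound[OF _ integrable_mult_right[OF ind] ind]
  have "integrable (lborel \<Otimes>\<^sub>M lborel) (\<lambda>(t, y). 1 * (indicator {-a..a} y *\<^sub>R \<rho> (t - y)))"
    by (rule pair(1)[OF meas bound]) simp_all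
  from lborel_pair.integrable_fst[OF this] show "integrable lborel (\<theta> a)"
    by (simp add: \<theta>_def[abs_def])
  show "\<theta> a t = 1" if "\<bar>t\<bar> \<le> a - 1"
  proof -
    have "indicator {-a..a} y *\<^sub>R \<rho> (t - y) = \<rho> (t - y)" for y
      using \<rho>(2)[of "t - y"] that by (auto simp: indicator_def abs_le_iff not_le)
    then have "\<theta> a t = (LBINT y. \<rho> (t + (-1) * y))" by (simp add: \<theta>_def)
    also have "\<dots> = (LBINT x. \<rho> x)"
      by (subst (2) lborel_integral_real_affine[where c = "-1" and t = t]) auto
    finally show ?thesis using \<rho>(3) by simp
  qed
  have "fourier (\<theta> a) u = (LBINT t. LBINT y. iexp (- t * u) * (indicator {-a..a} y *\<^sub>R \<rho> (t - y)))"
    unfolding fourier_iexp \<theta>_def integral_mult_right_zero ..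
  also have "\<dots> = (LBINT y. LBINT t. iexp (- t * u) * (indicator {-a..a} y *\<^sub>R \<rho> (t - y)))"
    by (rule pair(2)[OF meas bound, symmetric]) (simp, rule norm_iexp)
  also have "\<dots> = (LBINT y. (indicator {-a..a} y *\<^sub>R iexp (- y * u)) * fourier \<rho> u)"
  proof (rule Bochner_Integration.integral_cong)
    fix y
    have "(LBINT t. iexp (- t * u) * (indicator {-a..a} y *\<^sub>R \<rho> (t - y)))
      = (LBINT v. iexp (- (y + 1 * v) * u) * (indicator {-a..a} y *\<^sub>R \<rho> (y + 1 * v - y)))"
      by (subst lborel_integral_real_affine[where c = 1 and t = y]) auto
    also have "\<dots> = (LBINT v. (indicator {-a..a} y *\<^sub>R iexp (- y * u)) * (iexp (- v * u) * \<rho> v))"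
    proof (rule Bochner_Integration.integral_cong)
      fix v
      have "iexp (- (y + 1 * v) * u) = iexp (- y * u) * iexp (- v * u)"
        unfolding iexp_add[symmetric] by (simp add: algebra_simps)
      then show "iexp (- (y + 1 * v) * u) * (indicator {-a..a} y *\<^sub>R \<rho> (y + 1 * v - y))
        = (indicator {-a..a} y *\<^sub>R iexp (- y * u)) * (iexp (- v * u) * \<rho> v)"
        by (simp add: scaleR_conv_of_real mult_ac)
    qed simp
    also have "\<dots> = (indicator {-a..a} y *\<^sub>R iexp (- y * u)) * fourier \<rho> u"
      unfolding fourier_iexp by (rule integral_mult_right_zero)
    finally show "(LBINT t. iexp (- t * u) * (indicator {-a..a} y *\<^sub>R \<rho> (t - y))) = \<dots>" .
  qed simp
  also have "\<dots> = fourier \<rho> u * interval_kernel a u"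
    unfolding integral_mult_left_zero interval_kernel_def by (rule mult.commute)
  finally show "fourier (\<theta> a) u = fourier \<rho> u * interval_kernel a u" .
qed

text \<open>The transform of the fixed bump absorbs every power of 1 + u^2, so the dependence on
  \<open>a\<close> is that of the unsmoothed indicator, namely linear. Its square root is the origin
  of the factor T^(1/2).\<close>

lemma time_cutoff:
  obtains C where "0 \<le> C" "\<And>a. 0 < a \<Longrightarrow> \<exists>\<theta>. integrable lborel \<theta> \<and> (\<forall>t. \<bar>t\<bar> \<le> a - 1 \<longrightarrow> \<theta> t = 1) \<and>
    fourier \<theta> \<in> borel_measurable borel \<and>
    integrable lborel (\<lambda>u. (1 + u\<^sup>2) ^ m * (cmod (fourier \<theta> u))\<^sup>2) \<and>
    (LBINT u. (1 + u\<^sup>2) ^ m * (cmod (fourier \<theta> u))\<^sup>2) \<le> C * a"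
proof -
  obtain \<rho> :: "real \<Rightarrow> complex" where \<rho>: "\<rho> \<in> test_functions UNIV" "\<And>x. 1 < \<bar>x\<bar> \<Longrightarrow> \<rho> x = 0" "(LBINT x. \<rho> x) = 1"
    by (rule normalised_bump) (rule that, assumption+)
  note \<rho>S = test_functions_schwartz[OF \<rho>(1)]
  define K where "K = 2 ^ m * 4 * pi * schwartz_seminorm (2 * m + 2) \<rho>"
  have K: "(1 + u\<^sup>2) ^ m * (cmod (fourier \<rho> u))\<^sup>2 \<le> K\<^sup>2" for u
  proof -
    have one: "1 \<le> (1 + u\<^sup>2) ^ m" by (rule one_le_power) simp
    have "(1 + u\<^sup>2) ^ m * (cmod (fourier \<rho> u))\<^sup>2 \<le> (1 + u\<^sup>2) ^ m * ((1 + u\<^sup>2) ^ m * (cmod (fourier \<rho> u))\<^sup>2)"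
      using mult_right_mono[OF one, of "(1 + u\<^sup>2) ^ m * (cmod (fourier \<rho> u))\<^sup>2"] by simp
    also have "\<dots> = ((1 + u\<^sup>2) ^ m * cmod (fourier \<rho> u))\<^sup>2"
      by (simp add: power_mult_distrib power2_eq_square)
    also have "\<dots> \<le> K\<^sup>2"
      unfolding K_def by (intro power_mono fourier_decay_seminorm \<rho>S) simp
    finally show ?thesis .
  qed
  have [measurable]: "fourier \<rho> \<in> borel_measurable borel"
    using schwartz_measurable[OF fourier_schwartz[OF \<rho>S]] by simp
  show ?thesis
  proof (rule that[of "K\<^sup>2 * (8 * pi)"])
    fix a :: real assume a: "0 < a"
    define \<theta> where "\<theta> t = (LBINT y. indicator {-a..a} y *\<^sub>R \<rho> (t - y))" for t
    note \<theta> = mollified_indicator[OF \<rho>, of a, folded \<theta>_def]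
    have \<theta>1: "\<theta> t = 1" if "\<bar>t\<bar> \<le> a - 1" for t
      unfolding \<theta>_def by (rule mollified_indicator_eq_1[OF \<rho> that])
    have D: "fourier \<theta> = (\<lambda>u. fourier \<rho> u * interval_kernel a u)" using \<theta>(3) by auto
    have meas: "fourier \<theta> \<in> borel_measurable borel" unfolding D by measurable
    have le: "(1 + u\<^sup>2) ^ m * (cmod (fourier \<theta> u))\<^sup>2 \<le> K\<^sup>2 * (8 * a\<^sup>2 / (1 + (a * u)\<^sup>2))" for u
    proof -
      have "(1 + u\<^sup>2) ^ m * (cmod (fourier \<theta> u))\<^sup>2 = (1 + u\<^sup>2) ^ m * (cmod (fourier \<rho> u))\<^sup>2 * (cmod (interval_kernel a u))\<^sup>2"
        by (simp add: D norm_mult power_mult_distrib)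
      also have "\<dots> \<le> K\<^sup>2 * (8 * a\<^sup>2 / (1 + (a * u)\<^sup>2))"
        by (intro mult_mono K interval_kernel_bound a) auto
      finally show ?thesis .
    qed
    have i: "integrable lborel (\<lambda>u. K\<^sup>2 * (8 * a\<^sup>2 / (1 + (a * u)\<^sup>2)))"
      by (rule integrable_mult_right[OF integral_interval_kernel_majorant(1)[OF a]])
    have i': "integrable lborel (\<lambda>u. (1 + u\<^sup>2) ^ m * (cmod (fourier \<theta> u))\<^sup>2)"
    proof (rule Bochner_Integration.integrable_bound[OF i])
      show "(\<lambda>u. (1 + u\<^sup>2) ^ m * (cmod (fourier \<theta> u))\<^sup>2) \<in> borel_measurable lborel"
        using meas by measurable
      show "AE u in lborel. norm ((1 + u\<^sup>2) ^ m * (cmod (fourier \<theta> u))\<^sup>2) \<le> norm (K\<^sup>2 * (8 * a\<^sup>2 / (1 + (a * u)\<^sup>2)))"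
      proof (rule AE_I2)
        fix u
        have "norm ((1 + u\<^sup>2) ^ m * (cmod (fourier \<theta> u))\<^sup>2) = (1 + u\<^sup>2) ^ m * (cmod (fourier \<theta> u))\<^sup>2"
          by (simp add: abs_mult power_abs)
        also note le
        also note abs_ge_self
        finally show "norm ((1 + u\<^sup>2) ^ m * (cmod (fourier \<theta> u))\<^sup>2) \<le> norm (K\<^sup>2 * (8 * a\<^sup>2 / (1 + (a * u)\<^sup>2)))"
          by simp
      qed
    qed
    have "(LBINT u. (1 + u\<^sup>2) ^ m * (cmod (fourier \<theta> u))\<^sup>2) \<le> (LBINT u. K\<^sup>2 * (8 * a\<^sup>2 / (1 + (a * u)\<^sup>2)))"
      by (rule integral_mono[OF i' i le])
    also have "\<dots> = K\<^sup>2 * (8 * pi) * a"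
      unfolding integral_mult_right_zero integral_interval_kernel_majorant(2)[OF a] by simp
    finally have fin: "(LBINT u. (1 + u\<^sup>2) ^ m * (cmod (fourier \<theta> u))\<^sup>2) \<le> K\<^sup>2 * (8 * pi) * a" .
    show "\<exists>\<theta>. integrable lborel \<theta> \<and> (\<forall>t. \<bar>t\<bar> \<le> a - 1 \<longrightarrow> \<theta> t = 1) \<and>
      fourier \<theta> \<in> borel_measurable borel \<and>
      integrable lborel (\<lambda>u. (1 + u\<^sup>2) ^ m * (cmod (fourier \<theta> u))\<^sup>2) \<and>
      (LBINT u. (1 + u\<^sup>2) ^ m * (cmod (fourier \<theta> u))\<^sup>2) \<le> K\<^sup>2 * (8 * pi) * a"
      by (intro exI[of _ \<theta>] conjI allI impI \<theta>(1) \<theta>1 meas i' fin)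
  qed simp
qed

text \<open>Cauchy-Schwarz with respect to |f| dk, obtained by splitting f D into f / sqrt |f| and
  sqrt |f| D.\<close>

lemma integral_mult_square_le:
  fixes f D :: "real \<Rightarrow> complex"
  assumes f: "integrable lborel f" and [measurable]: "D \<in> borel_measurable lborel" and B: "\<And>k. cmod (D k) \<le> B"
  shows "(cmod (LBINT k. f k * D k))\<^sup>2 \<le> (LBINT k. cmod (f k)) * (LBINT k. cmod (f k) * (cmod (D k))\<^sup>2)"
proof -
  have [measurable]: "f \<in> borel_measurable lborel" using f by auto
  define u where "u k = (if f k = 0 then 0 else f k / of_real (sqrt (cmod (f k))))" for k
  define v where "v k = of_real (sqrt (cmod (f k))) * D k" for k
  have i: "integrable lborel (\<lambda>k. cmod (f k) * (cmod (D k))\<^sup>2)"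
  proof (rule Bochner_Integration.integrable_bound[of _ "\<lambda>k. B\<^sup>2 * cmod (f k)"])
    show "integrable lborel (\<lambda>k. B\<^sup>2 * cmod (f k))" by (intro integrable_mult_right integrable_norm f)
    show "AE k in lborel. norm (cmod (f k) * (cmod (D k))\<^sup>2) \<le> norm (B\<^sup>2 * cmod (f k))"
    proof (rule AE_I2)
      fix k
      have "cmod (f k) * (cmod (D k))\<^sup>2 \<le> cmod (f k) * B\<^sup>2"
        by (intro mult_left_mono power_mono B) auto
      then show "norm (cmod (f k) * (cmod (D k))\<^sup>2) \<le> norm (B\<^sup>2 * cmod (f k))"
        by (simp add: abs_mult mult.commute)
    qed
  qed measurable
  have one: "1 + k\<^sup>2 \<noteq> 0" for k :: real by (simp add: add_nonneg_eq_0_iff)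
  have u2: "(cmod (u k))\<^sup>2 = cmod (f k)" for k
    by (simp add: u_def norm_divide power_divide) (simp add: power2_eq_square)
  have v2: "(cmod (v k))\<^sup>2 = cmod (f k) * (cmod (D k))\<^sup>2" for k
    by (simp add: v_def norm_mult power_mult_distrib)
  have uv: "u k * v k = f k * D k" for k by (simp add: u_def v_def)
  have [measurable]: "u \<in> borel_measurable lborel" "v \<in> borel_measurable lborel"
    unfolding u_def v_def by measurable
  have uW: "u \<in> weighted_L2 0" and vW: "v \<in> weighted_L2 (- 0)"
    using integrable_norm[OF f] i by (simp_all add: weighted_L2_def one u2 v2)
  have "(cmod (LBINT k. u k * v k))\<^sup>2 \<le> (weighted_norm 0 u * weighted_norm (- 0) v)\<^sup>2"
    by (intro power_mono weighted_L2_pairing uW vW) simp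
  then show ?thesis
    by (simp add: uv power_mult_distrib weighted_norm_square one u2 v2)
qed

text \<open>Peetre's inequality: it moves a weight in \<open>\<tau>\<close> onto p, which is bounded
  at low frequencies, and onto the difference \<open>\<tau> - p\<close>, the argument of the
  transformed cutoff.\<close>

lemma peetre_inequality: "1 + (\<tau>::real)\<^sup>2 \<le> 2 * (1 + p\<^sup>2) * (1 + (\<tau> - p)\<^sup>2)"
proof -
  have "2 * (1 + p\<^sup>2) * (1 + (\<tau> - p)\<^sup>2) - (1 + \<tau>\<^sup>2) = 1 + (\<tau> - 2 * p)\<^sup>2 + 2 * (p * (\<tau> - p))\<^sup>2"
    by (simp add: power2_eq_square algebra_simps)
  moreover have "0 \<le> 1 + (\<tau> - 2 * p)\<^sup>2 + 2 * (p * (\<tau> - p))\<^sup>2" by simp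
  ultimately show ?thesis by linarith
qed

text \<open>The norm is estimated by Cauchy--Schwarz in \<open>k\<close>, followed by Tonelli; a bound that is uniform in \<open>k\<close>
  for each fixed \<open>\<tau>\<close> would cost another factor \<open>T powr (1 / 2)\<close>.\<close>

lemma
  fixes \<theta> :: "real \<Rightarrow> complex" and p :: "real \<Rightarrow> real"
  assumes \<theta>: "integrable lborel \<theta>" and D[measurable]: "fourier \<theta> \<in> borel_measurable borel"
    and iD: "integrable lborel (\<lambda>u. (1 + u\<^sup>2) ^ m * (cmod (fourier \<theta> u))\<^sup>2)"
    and A: "(LBINT u. (1 + u\<^sup>2) ^ m * (cmod (fourier \<theta> u))\<^sup>2) \<le> A"
    and g: "integrable lborel g" and p[measurable]: "p \<in> borel_measurable borel"
    and P: "\<And>k. g k \<noteq> 0 \<Longrightarrow> \<bar>p k\<bar> \<le> P" and m: "\<sigma> \<le> real m"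
  defines "h \<equiv> \<lambda>\<tau>. 1 / (2 * of_real pi) * (LBINT k. g k * fourier \<theta> (\<tau> - p k))"
  shows localised_function_weighted_L2: "h \<in> weighted_L2 \<sigma>"
    and localised_function_norm: "weighted_norm \<sigma> h \<le> (LBINT k. cmod (g k)) * sqrt ((2 * (1 + P\<^sup>2)) ^ m * A)"
    and localised_function_inv_fourier:
      "\<psi> \<in> schwartz \<Longrightarrow> (\<And>t. \<psi> t \<noteq> 0 \<Longrightarrow> \<theta> t = 1) \<Longrightarrow>
        inv_fourier h \<psi> = 1 / (2 * of_real pi) * (LBINT k. g k * fourier \<psi> (- p k))"
proof -
  have [measurable]: "g \<in> borel_measurable lborel" "\<theta> \<in> borel_measurable lborel" using g \<theta> by auto
  define D where "D = fourier \<theta>"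
  have [measurable]: "D \<in> borel_measurable borel" unfolding D_def by (rule D)
  have D_le: "cmod (D u) \<le> (LBINT t. cmod (\<theta> t))" for u
    unfolding D_def by (rule cmod_fourier_le[OF \<theta>])
  define G where "G = (LBINT k. cmod (g k))"
  have G: "0 \<le> G" by (simp add: G_def)
  define c where "c = (2 * (1 + P\<^sup>2)) ^ m"
  have c: "0 \<le> c" by (simp add: c_def)
  have A0: "0 \<le> A" by (rule order_trans[OF _ A]) simp
  define w where "w \<tau> = (1 + \<tau>\<^sup>2) powr \<sigma>" for \<tau> :: real
  have [measurable]: "w \<in> borel_measurable borel" unfolding w_def[abs_def] by measurable
  have w0: "0 \<le> w \<tau>" for \<tau> by (simp add: w_def)
  have w: "w \<tau> \<le> c * (1 + (\<tau> - p k)\<^sup>2) ^ m" if "g k \<noteq> 0" for \<tau> k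
  proof -
    have "w \<tau> \<le> (1 + \<tau>\<^sup>2) powr real m" unfolding w_def by (intro powr_mono m) simp
    also have "\<dots> = (1 + \<tau>\<^sup>2) ^ m" by (rule powr_realpow) (simp add: add_pos_nonneg)
    also have "\<dots> \<le> (2 * (1 + (p k)\<^sup>2) * (1 + (\<tau> - p k)\<^sup>2)) ^ m"
      by (intro power_mono peetre_inequality) simp
    also have "\<dots> \<le> (2 * (1 + P\<^sup>2) * (1 + (\<tau> - p k)\<^sup>2)) ^ m"
    proof -
      have "(p k)\<^sup>2 \<le> P\<^sup>2" using power_mono[OF P[OF that], of 2] by simp
      then show ?thesis by (intro power_mono mult_right_mono) auto
    qed
    finally show ?thesis by (simp add: c_def power_mult_distrib)
  qed
  have shift: "integrable lborel (\<lambda>\<tau>. (1 + (\<tau> - x)\<^sup>2) ^ m * (cmod (D (\<tau> - x)))\<^sup>2)"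
    "(LBINT \<tau>. (1 + (\<tau> - x)\<^sup>2) ^ m * (cmod (D (\<tau> - x)))\<^sup>2) \<le> A" for x
  proof -
    show "integrable lborel (\<lambda>\<tau>. (1 + (\<tau> - x)\<^sup>2) ^ m * (cmod (D (\<tau> - x)))\<^sup>2)"
      using lborel_integrable_real_affine[OF iD, of 1 "- x"] by (simp add: D_def)
    have "(LBINT \<tau>. (1 + (\<tau> - x)\<^sup>2) ^ m * (cmod (D (\<tau> - x)))\<^sup>2) = (LBINT u. (1 + u\<^sup>2) ^ m * (cmod (D u))\<^sup>2)"
      by (subst (2) lborel_integral_real_affine[where c = 1 and t = "- x"]) auto
    then show "(LBINT \<tau>. (1 + (\<tau> - x)\<^sup>2) ^ m * (cmod (D (\<tau> - x)))\<^sup>2) \<le> A" using A by (simp add: D_def)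
  qed
  \<comment> \<open>The integrand for Tonelli. Integrated in \<open>\<tau>\<close> first it is at
    most |g k| c A, by Peetre's inequality and translation invariance.\<close>
  define f where "f k \<tau> = cmod (g k) * (w \<tau> * (cmod (D (\<tau> - p k)))\<^sup>2)" for k \<tau>
  have f0: "0 \<le> f k \<tau>" for k \<tau> by (simp add: f_def w0)
  have f_meas: "case_prod f \<in> borel_measurable (lborel \<Otimes>\<^sub>M lborel)"
    unfolding f_def by measurable
  have f_le: "f k \<tau> \<le> cmod (g k) * c * ((1 + (\<tau> - p k)\<^sup>2) ^ m * (cmod (D (\<tau> - p k)))\<^sup>2)" for k \<tau>
  proof (cases "g k = 0")
    case False
    have "f k \<tau> \<le> cmod (g k) * (c * (1 + (\<tau> - p k)\<^sup>2) ^ m * (cmod (D (\<tau> - p k)))\<^sup>2)"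
      unfolding f_def by (intro mult_left_mono mult_right_mono w False) auto
    then show ?thesis by (simp only: mult.assoc)
  qed (simp add: f_def)
  have f_int: "integrable lborel (f k)" for k
  proof (rule Bochner_Integration.integrable_bound[OF integrable_mult_right[OF shift(1)[of "p k"], of "cmod (g k) * c"]])
    show "f k \<in> borel_measurable lborel" unfolding f_def[abs_def] by measurable
    show "AE \<tau> in lborel. norm (f k \<tau>) \<le> norm (cmod (g k) * c * ((1 + (\<tau> - p k)\<^sup>2) ^ m * (cmod (D (\<tau> - p k)))\<^sup>2))"
      using f0[of k] order_trans[OF f_le abs_ge_self] by (intro AE_I2) simp
  qed
  have f_int_le: "(LBINT \<tau>. f k \<tau>) \<le> cmod (g k) * (c * A)" for k
  proof -
    have "(LBINT \<tau>. f k \<tau>) \<le> (LBINT \<tau>. cmod (g k) * c * ((1 + (\<tau> - p k)\<^sup>2) ^ m * (cmod (D (\<tau> - p k)))\<^sup>2))"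
      by (rule integral_mono[OF f_int integrable_mult_right[OF shift(1)] f_le])
    also have "\<dots> = cmod (g k) * c * (LBINT \<tau>. (1 + (\<tau> - p k)\<^sup>2) ^ m * (cmod (D (\<tau> - p k)))\<^sup>2)"
      by (rule integral_mult_right_zero)
    also have "\<dots> \<le> cmod (g k) * c * A" by (intro mult_left_mono shift c mult_nonneg_nonneg) simp
    finally show ?thesis by (simp only: mult.assoc)
  qed
  have f_iint: "integrable lborel (\<lambda>k. LBINT \<tau>. f k \<tau>)"
  proof (rule Bochner_Integration.integrable_bound[OF integrable_mult_left[OF integrable_norm[OF g], of "c * A"]])
    show "(\<lambda>k. LBINT \<tau>. f k \<tau>) \<in> borel_measurable lborel"
      by (rule lborel.borel_measurable_lebesgue_integral[OF f_meas])
    show "AE k in lborel. norm (LBINT \<tau>. f k \<tau>) \<le> norm (cmod (g k) * (c * A))"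
      using f0 order_trans[OF f_int_le abs_ge_self] by (intro AE_I2) simp
  qed
  have pair: "integrable (lborel \<Otimes>\<^sub>M lborel) (case_prod f)"
    by (rule lborel_pair.Fubini_integrable[OF f_meas]) (use f_iint f_int f0 in simp_all)
  have fubini: "integrable lborel (\<lambda>\<tau>. LBINT k. f k \<tau>)" "(LBINT \<tau>. LBINT k. f k \<tau>) \<le> G * (c * A)"
  proof -
    show "integrable lborel (\<lambda>\<tau>. LBINT k. f k \<tau>)" by (rule lborel_pair.integrable_snd[OF pair])
    have "(LBINT \<tau>. LBINT k. f k \<tau>) = (LBINT k. LBINT \<tau>. f k \<tau>)" by (rule lborel_pair.Fubini_integral[OF pair])
    also have "\<dots> \<le> (LBINT k. cmod (g k) * (c * A))"
      by (rule integral_mono[OF f_iint integrable_mult_left[OF integrable_norm[OF g]] f_int_le])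
    finally show "(LBINT \<tau>. LBINT k. f k \<tau>) \<le> G * (c * A)" by (simp add: G_def)
  qed
  have h: "h \<tau> = 1 / (2 * of_real pi) * (LBINT k. g k * D (\<tau> - p k))" for \<tau> by (simp add: h_def D_def)
  have h_meas: "h \<in> borel_measurable lborel"
    unfolding h[abs_def] by measurable
  have le: "w \<tau> * (cmod (h \<tau>))\<^sup>2 \<le> G * (LBINT k. f k \<tau>)" for \<tau>
  proof -
    have pi: "cmod (1 / (2 * of_real pi)) \<le> 1"
    proof -
      have "1 \<le> 2 * pi" using pi_gt3 by simp
      then show ?thesis by (simp add: norm_divide norm_mult)
    qed
    have "cmod (h \<tau>) \<le> 1 * cmod (LBINT k. g k * D (\<tau> - p k))"
      unfolding h norm_mult by (intro mult_right_mono pi) simp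
    then have "w \<tau> * (cmod (h \<tau>))\<^sup>2 \<le> w \<tau> * (cmod (LBINT k. g k * D (\<tau> - p k)))\<^sup>2"
      by (intro mult_left_mono power_mono w0) auto
    also have "\<dots> \<le> w \<tau> * (G * (LBINT k. cmod (g k) * (cmod (D (\<tau> - p k)))\<^sup>2))"
      unfolding G_def by (intro mult_left_mono integral_mult_square_le[OF g _ D_le] w0) measurable
    also have "\<dots> = G * (LBINT k. w \<tau> * (cmod (g k) * (cmod (D (\<tau> - p k)))\<^sup>2))"
      unfolding integral_mult_right_zero by (simp only: mult.left_commute)
    also have "\<dots> = G * (LBINT k. f k \<tau>)" unfolding f_def by (simp only: mult.left_commute)
    finally show ?thesis .
  qed
  have i: "integrable lborel (\<lambda>\<tau>. G * (LBINT k. f k \<tau>))" by (rule integrable_mult_right[OF fubini(1)])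
  have i': "integrable lborel (\<lambda>\<tau>. w \<tau> * (cmod (h \<tau>))\<^sup>2)"
  proof (rule Bochner_Integration.integrable_bound[OF i])
    show "(\<lambda>\<tau>. w \<tau> * (cmod (h \<tau>))\<^sup>2) \<in> borel_measurable lborel" using h_meas by measurable
    show "AE \<tau> in lborel. norm (w \<tau> * (cmod (h \<tau>))\<^sup>2) \<le> norm (G * (LBINT k. f k \<tau>))"
      using w0 order_trans[OF le abs_ge_self] by (intro AE_I2) (simp add: abs_mult)
  qed
  show hW: "h \<in> weighted_L2 \<sigma>" using i' h_meas by (simp add: weighted_L2_def w_def)
  have "(weighted_norm \<sigma> h)\<^sup>2 \<le> (LBINT \<tau>. G * (LBINT k. f k \<tau>))"
    unfolding weighted_norm_square using integral_mono[OF i' i le] by (simp add: w_def)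
  also have "\<dots> \<le> G * (G * (c * A))"
    unfolding integral_mult_right_zero by (intro mult_left_mono fubini G)
  also have "\<dots> = (G * sqrt (c * A))\<^sup>2" using c A0 by (simp add: power_mult_distrib power2_eq_square)
  finally have "weighted_norm \<sigma> h \<le> G * sqrt (c * A)"
    by (rule power2_le_imp_le) (simp add: G c A0)
  then show "weighted_norm \<sigma> h \<le> (LBINT k. cmod (g k)) * sqrt ((2 * (1 + P\<^sup>2)) ^ m * A)"
    by (simp add: G_def c_def)
  fix \<psi> assume \<psi>: "\<psi> \<in> schwartz" and \<theta>1: "\<And>t. \<psi> t \<noteq> 0 \<Longrightarrow> \<theta> t = 1"
  define F where "F \<tau> = fourier \<psi> (- \<tau>)" for \<tau>
  have F: "integrable lborel F"
    using lborel_integrable_real_affine[OF schwartz_integrable[OF fourier_schwartz[OF \<psi>]], of "-1" 0]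
    by (simp add: F_def[abs_def])
  then have [measurable]: "F \<in> borel_measurable lborel" by auto
  have F_inv: "(LBINT \<tau>. iexp (- t * \<tau>) * F \<tau>) = 2 * of_real pi * \<psi> t" for t
  proof -
    have "(LBINT \<tau>. iexp (- t * \<tau>) * F \<tau>) = (LBINT k. iexp (k * t) * fourier \<psi> k)"
      by (subst (2) lborel_integral_real_affine[where c = "-1" and t = 0]) (auto simp: F_def mult.commute)
    then show ?thesis using fourier_inversion[OF \<psi>] by simp
  qed
  \<comment> \<open>The integral in \<open>\<tau>\<close> recovers \<open>\<psi>\<close> by
    inversion, and the cutoff drops out because it is 1 wherever \<open>\<psi>\<close> is
    nonzero.\<close>
  have key: "(LBINT \<tau>. D (\<tau> - x) * F \<tau>) = 2 * of_real pi * fourier \<psi> (- x)" for x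
  proof -
    have "(LBINT \<tau>. D (\<tau> - x) * F \<tau>) = (LBINT \<tau>. LBINT t. iexp (- t * (\<tau> - x)) * \<theta> t * F \<tau>)"
      unfolding D_def fourier_iexp integral_mult_left_zero ..
    also have "\<dots> = (LBINT t. LBINT \<tau>. iexp (- t * (\<tau> - x)) * \<theta> t * F \<tau>)"
    proof (rule Fubini_of_product_bound[OF _ integrable_norm[OF \<theta>] integrable_norm[OF F]])
      show "(\<lambda>(t, \<tau>). iexp (- t * (\<tau> - x)) * \<theta> t * F \<tau>) \<in> borel_measurable (lborel \<Otimes>\<^sub>M lborel)" by measurable
      show "norm (iexp (- t * (\<tau> - x)) * \<theta> t * F \<tau>) \<le> cmod (\<theta> t) * cmod (F \<tau>)" for t \<tau>
        unfolding norm_mult norm_iexp by simp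
    qed
    also have "\<dots> = (LBINT t. 2 * of_real pi * (iexp (- t * - x) * \<psi> t))"
    proof (rule Bochner_Integration.integral_cong)
      fix t
      have "(LBINT \<tau>. iexp (- t * (\<tau> - x)) * \<theta> t * F \<tau>) = (LBINT \<tau>. iexp (- t * - x) * \<theta> t * (iexp (- t * \<tau>) * F \<tau>))"
      proof (rule Bochner_Integration.integral_cong)
        fix \<tau>
        have "iexp (- t * (\<tau> - x)) = iexp (- t * - x) * iexp (- t * \<tau>)"
          unfolding iexp_add[symmetric] by (simp add: algebra_simps)
        then show "iexp (- t * (\<tau> - x)) * \<theta> t * F \<tau> = iexp (- t * - x) * \<theta> t * (iexp (- t * \<tau>) * F \<tau>)"
          by (simp only: mult_ac)
      qed simp
      also have "\<dots> = iexp (- t * - x) * \<theta> t * (2 * of_real pi * \<psi> t)"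
        unfolding integral_mult_right_zero F_inv ..
      also have "\<dots> = 2 * of_real pi * (iexp (- t * - x) * \<psi> t)"
        using \<theta>1[of t] by (cases "\<psi> t = 0") auto
      finally show "(LBINT \<tau>. iexp (- t * (\<tau> - x)) * \<theta> t * F \<tau>) = 2 * of_real pi * (iexp (- t * - x) * \<psi> t)" .
    qed simp
    also have "\<dots> = 2 * of_real pi * fourier \<psi> (- x)" unfolding integral_mult_right_zero fourier_iexp ..
    finally show ?thesis .
  qed
  have "(LBINT \<tau>. h \<tau> * F \<tau>) = (LBINT \<tau>. 1 / (2 * of_real pi) * (LBINT k. g k * D (\<tau> - p k) * F \<tau>))"
    unfolding h integral_mult_left_zero by (simp only: mult.assoc)
  also have "\<dots> = 1 / (2 * of_real pi) * (LBINT \<tau>. LBINT k. g k * D (\<tau> - p k) * F \<tau>)"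
    by (rule integral_mult_right_zero)
  also have "(LBINT \<tau>. LBINT k. g k * D (\<tau> - p k) * F \<tau>) = (LBINT k. LBINT \<tau>. g k * D (\<tau> - p k) * F \<tau>)"
  proof (rule Fubini_of_product_bound[OF _ integrable_norm[OF g] integrable_mult_right[OF integrable_norm[OF F]]])
    show "(\<lambda>(k, \<tau>). g k * D (\<tau> - p k) * F \<tau>) \<in> borel_measurable (lborel \<Otimes>\<^sub>M lborel)" by measurable
    show "norm (g k * D (\<tau> - p k) * F \<tau>) \<le> cmod (g k) * ((LBINT t. cmod (\<theta> t)) * cmod (F \<tau>))" for k \<tau>
      unfolding norm_mult mult.assoc by (intro mult_left_mono mult_right_mono D_le) auto
  qed
  also have "\<dots> = (LBINT k. 2 * of_real pi * (g k * fourier \<psi> (- p k)))"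
  proof (rule Bochner_Integration.integral_cong)
    fix k
    have "(LBINT \<tau>. g k * D (\<tau> - p k) * F \<tau>) = g k * (LBINT \<tau>. D (\<tau> - p k) * F \<tau>)"
      by (simp only: mult.assoc integral_mult_right_zero)
    then show "(LBINT \<tau>. g k * D (\<tau> - p k) * F \<tau>) = 2 * of_real pi * (g k * fourier \<psi> (- p k))"
      unfolding key by (simp only: mult_ac)
  qed simp
  also have "\<dots> = 2 * of_real pi * (LBINT k. g k * fourier \<psi> (- p k))" by (rule integral_mult_right_zero)
  finally show "inv_fourier h \<psi> = 1 / (2 * of_real pi) * (LBINT k. g k * fourier \<psi> (- p k))"
    by (simp add: inv_fourier_def F_def)
qed

section \<open>Traces in time\<close>

text \<open>The distribution (1 / 2 pi) int exp(i p(k) t) g(k) dk in t; the position x enters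
  through a factor exp(i k x) contained in \<open>g\<close>. The formula makes no reference to T, so
  one family serves all intervals.\<close>

definition time_trace :: "real \<Rightarrow> real \<Rightarrow> real \<Rightarrow> (real \<Rightarrow> complex) \<Rightarrow> functional" where
  "time_trace \<alpha> \<beta> \<delta> g \<psi> = 1 / (2 * of_real pi) * (LBINT k. g k * fourier \<psi> (- phase \<alpha> \<beta> \<delta> k))"

text \<open>1 + p^2 dominates a multiple of 1 + k^2, so decay in the phase is decay in the
  frequency.\<close>

lemma integrable_quotient_phase:
  assumes "\<beta> > 0" and g: "g \<in> weighted_L2 s" and n: "- s + 1 \<le> 2 * real n"
  shows "integrable lborel (\<lambda>k. cmod (g k) / (1 + (phase \<alpha> \<beta> \<delta> k)\<^sup>2) ^ n)"
proof -
  obtain c where c: "0 < c" "\<And>k. c * (1 + k\<^sup>2) ^ 3 \<le> 1 + (phase \<alpha> \<beta> \<delta> k)\<^sup>2"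
    using phase_square_lower_bound[OF assms(1)] by blast
  have [measurable]: "g \<in> borel_measurable lborel" by (rule weighted_L2_measurable[OF g])
  show ?thesis
  proof (rule Bochner_Integration.integrable_bound[OF integrable_mult_right[OF weighted_L2_integrable_quotient[OF g n], of "1 / c ^ n"]])
    show "AE k in lborel. norm (cmod (g k) / (1 + (phase \<alpha> \<beta> \<delta> k)\<^sup>2) ^ n) \<le> norm (1 / c ^ n * (cmod (g k) / (1 + k\<^sup>2) ^ n))"
    proof (rule AE_I2)
      fix k :: real
      have pos: "0 < 1 + k\<^sup>2" by (simp add: add_pos_nonneg)
      have "c * (1 + k\<^sup>2) ^ 1 \<le> c * (1 + k\<^sup>2) ^ 3"
        using c(1) by (intro mult_left_mono power_increasing) auto
      with c(2)[of k] have "c * (1 + k\<^sup>2) \<le> 1 + (phase \<alpha> \<beta> \<delta> k)\<^sup>2" by simp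
      then have "(c * (1 + k\<^sup>2)) ^ n \<le> (1 + (phase \<alpha> \<beta> \<delta> k)\<^sup>2) ^ n"
        using c(1) pos by (intro power_mono) auto
      then have "cmod (g k) / (1 + (phase \<alpha> \<beta> \<delta> k)\<^sup>2) ^ n \<le> cmod (g k) / (c * (1 + k\<^sup>2)) ^ n"
        using c(1) pos by (intro divide_left_mono mult_pos_pos zero_less_power) (auto simp: add_pos_nonneg)
      then show "norm (cmod (g k) / (1 + (phase \<alpha> \<beta> \<delta> k)\<^sup>2) ^ n) \<le> norm (1 / c ^ n * (cmod (g k) / (1 + k\<^sup>2) ^ n))"
        using c(1) pos by (simp add: power_mult_distrib)
    qed
  qed measurable
qed

lemma time_trace_integrable:
  assumes "\<beta> > 0" and g: "g \<in> weighted_L2 s" and \<psi>: "\<psi> \<in> schwartz"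
  shows "integrable lborel (\<lambda>k. g k * fourier \<psi> (- phase \<alpha> \<beta> \<delta> k))"
proof -
  obtain n where n: "- s + 1 \<le> 2 * real n" by (rule exists_exponent)
  have [measurable]: "g \<in> borel_measurable lborel" by (rule weighted_L2_measurable[OF g])
  have [measurable]: "fourier \<psi> \<in> borel_measurable borel"
    using schwartz_measurable[OF fourier_schwartz[OF \<psi>]] by simp
  define K where "K = 2 ^ n * 4 * pi * schwartz_seminorm (2 * n + 2) \<psi>"
  show ?thesis
  proof (rule Bochner_Integration.integrable_bound[OF integrable_mult_right[OF integrable_quotient_phase[OF assms(1) g n], of K]])
    show "AE k in lborel. norm (g k * fourier \<psi> (- phase \<alpha> \<beta> \<delta> k)) \<le> norm (K * (cmod (g k) / (1 + (phase \<alpha> \<beta> \<delta> k)\<^sup>2) ^ n))"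
    proof (rule AE_I2)
      fix k
      have pos: "0 < (1 + (phase \<alpha> \<beta> \<delta> k)\<^sup>2) ^ n" by (intro zero_less_power) (simp add: add_pos_nonneg)
      have "cmod (fourier \<psi> (- phase \<alpha> \<beta> \<delta> k)) \<le> K / (1 + (phase \<alpha> \<beta> \<delta> k)\<^sup>2) ^ n"
        using fourier_decay_seminorm[OF \<psi>, of "- phase \<alpha> \<beta> \<delta> k" n] pos
        by (simp add: pos_le_divide_eq K_def mult.commute)
      then have "norm (g k * fourier \<psi> (- phase \<alpha> \<beta> \<delta> k)) \<le> cmod (g k) * (K / (1 + (phase \<alpha> \<beta> \<delta> k)\<^sup>2) ^ n)"
        unfolding norm_mult by (rule mult_left_mono) simp
      also have "\<dots> = K * (cmod (g k) / (1 + (phase \<alpha> \<beta> \<delta> k)\<^sup>2) ^ n)" by simp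
      also note abs_ge_self
      finally show "norm (g k * fourier \<psi> (- phase \<alpha> \<beta> \<delta> k)) \<le> norm (K * (cmod (g k) / (1 + (phase \<alpha> \<beta> \<delta> k)\<^sup>2) ^ n))"
        by simp
    qed
  qed measurable
qed

lemma time_trace_diff:
  assumes "\<beta> > 0" "g \<in> weighted_L2 s" "h \<in> weighted_L2 s" "\<psi> \<in> schwartz"
  shows "time_trace \<alpha> \<beta> \<delta> (\<lambda>k. g k - h k) \<psi> = time_trace \<alpha> \<beta> \<delta> g \<psi> - time_trace \<alpha> \<beta> \<delta> h \<psi>"
  unfolding time_trace_def left_diff_distrib
  using time_trace_integrable[OF assms(1,2,4)] time_trace_integrable[OF assms(1,3,4)]
  by (simp add: right_diff_distrib)

text \<open>Exchanging the coordinates of \<open>\<Phi>\<close> exchanges the two frequencies in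
  \<open>fourier2\<close>, so both families lead to the same integral over k.\<close>

lemma time_traces_time_trace:
  assumes "\<beta> > 0" "y0 \<in> sobolev s"
  shows "time_traces (solution_op \<alpha> \<beta> \<delta> y0) (\<lambda>x. time_trace \<alpha> \<beta> \<delta> (\<lambda>k. iexp (k * x) * dist_fourier y0 k))"
  unfolding time_traces_def
proof (intro ballI conjI)
  fix \<Phi> :: "real \<times> real \<Rightarrow> complex" assume \<Phi>: "\<Phi> \<in> test_functions UNIV"
  note g = sobolev_dist_fourier(2)[OF assms(2)]
  obtain n where n: "- s + 1 \<le> 2 * real n" by (rule exists_exponent)
  note Y = integrable_quotient_phase[OF assms(1) g n, of \<alpha> \<delta>]
  note \<Phi>' = test_functions_swap(1)[OF \<Phi>]
  note slices = oscillatory_slices_integrable[OF \<Phi>' _ _ weighted_L2_measurable[OF g] Y, where a = "\<lambda>k. k"]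
    oscillatory_slices_integral[OF \<Phi>' _ _ weighted_L2_measurable[OF g] Y, where a = "\<lambda>k. k"]
  show "integrable lborel (\<lambda>t. solution_op \<alpha> \<beta> \<delta> y0 t (\<lambda>x. \<Phi> (x, t)))"
    by (rule inv_fourier_slices_integrable[OF g \<Phi> solution_op_eq])
  show "integrable lborel (\<lambda>x. time_trace \<alpha> \<beta> \<delta> (\<lambda>k. iexp (k * x) * dist_fourier y0 k) (\<lambda>t. \<Phi> (x, t)))"
    unfolding time_trace_def by (rule integrable_mult_right) (use slices(1) in simp)
  have "(LBINT x. time_trace \<alpha> \<beta> \<delta> (\<lambda>k. iexp (k * x) * dist_fourier y0 k) (\<lambda>t. \<Phi> (x, t))) =
     1 / (2 * of_real pi) * (LBINT k. dist_fourier y0 k * fourier2 (phase \<alpha> \<beta> \<delta> k) k \<Phi>)"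
    unfolding time_trace_def integral_mult_right_zero using slices(2) by (simp add: fourier2_swap[OF \<Phi>])
  then show "(LBINT x. time_trace \<alpha> \<beta> \<delta> (\<lambda>k. iexp (k * x) * dist_fourier y0 k) (\<lambda>t. \<Phi> (x, t))) =
     (LBINT t. solution_op \<alpha> \<beta> \<delta> y0 t (\<lambda>x. \<Phi> (x, t)))"
    by (simp only: inv_fourier_slices_integral[OF g \<Phi> solution_op_eq])
qed

text \<open>The order of choices matters: R, the bound on the phase over [-R, R], the power m and
  the cutoff constant are fixed before T and \<open>g\<close>. The extension of the high-frequency
  part is valid on the whole time axis, so T enters only through the cutoff.\<close>

lemma time_trace_local_extension:
  assumes "\<beta> > 0"
  obtains c where "0 \<le> c" "\<And>T g. 0 < T \<Longrightarrow> g \<in> weighted_L2 s \<Longrightarrow>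
    \<exists>h\<in>weighted_L2 ((s + 1) / 3). weighted_norm ((s + 1) / 3) h \<le> c * (1 + T powr (1 / 2)) * weighted_norm s g \<and>
      (\<forall>\<psi>\<in>test_functions {-T<..<T}. inv_fourier h \<psi> = time_trace \<alpha> \<beta> \<delta> g \<psi>)"
proof -
  define \<sigma> where "\<sigma> = (s + 1) / 3"
  let ?p = "phase \<alpha> \<beta> \<delta>"
  obtain R where R: "1 \<le> R" "\<And>k. R \<le> \<bar>k\<bar> \<Longrightarrow> \<beta> * (1 + k\<^sup>2) \<le> phase' \<alpha> \<beta> \<delta> k" "?p (- R) < ?p R"
    using phase_high_frequency[OF assms] by metis
  obtain C1 where C1: "0 \<le> C1" "\<And>g. g \<in> weighted_L2 s \<Longrightarrow> (\<And>k. \<bar>k\<bar> \<le> R \<Longrightarrow> g k = 0) \<Longrightarrow>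
    \<exists>h\<in>weighted_L2 \<sigma>. weighted_norm \<sigma> h \<le> C1 * weighted_norm s g \<and>
      (\<forall>\<psi>\<in>borel_measurable borel. (LBINT \<tau>. h \<tau> * \<psi> \<tau>) = (LBINT k. g k * \<psi> (?p k)))"
    using transport_by_phase_high[OF assms R, of s] unfolding \<sigma>_def by blast
  obtain m :: nat where m: "\<sigma> \<le> real m" using real_arch_simple by blast
  obtain P where P: "\<And>k. k \<in> {-R..R} \<Longrightarrow> norm (?p k) \<le> P"
    using continuous_bounded_on_interval[OF continuous_on_phase] by blast
  obtain C2 where C2: "0 \<le> C2" "\<And>a. 0 < a \<Longrightarrow> \<exists>\<theta>. integrable lborel \<theta> \<and> (\<forall>t. \<bar>t\<bar> \<le> a - 1 \<longrightarrow> \<theta> t = 1) \<and>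
    fourier \<theta> \<in> borel_measurable borel \<and>
    integrable lborel (\<lambda>u. (1 + u\<^sup>2) ^ m * (cmod (fourier \<theta> u))\<^sup>2) \<and>
    (LBINT u. (1 + u\<^sup>2) ^ m * (cmod (fourier \<theta> u))\<^sup>2) \<le> C2 * a"
    using time_cutoff[of m] by blast
  \<comment> \<open>Pairing with this indicator turns the L^1 norm of the low-frequency part, which
    the localised estimate produces, into its weighted norm.\<close>
  define I where "I k = complex_of_real (indicator {-R..R} k)" for k
  have I: "I \<in> weighted_L2 (- s)"
  proof -
    obtain n where n: "- s + 1 \<le> 2 * real n" by (rule exists_exponent)
    show ?thesis
    proof (rule weighted_L2_of_decay(1)[OF _ _ n])
      show "I \<in> borel_measurable lborel" unfolding I_def by measurable
      show "(1 + k\<^sup>2) ^ n * cmod (I k) \<le> (1 + R\<^sup>2) ^ n" for k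
      proof (cases "k \<in> {-R..R}")
        case True
        then have "\<bar>k\<bar> \<le> \<bar>R\<bar>" by auto
        then have "k\<^sup>2 \<le> R\<^sup>2" by (simp only: abs_le_square_iff)
        with True show ?thesis by (auto simp: I_def intro!: power_mono)
      qed (simp add: I_def)
    qed simp
  qed
  define L where "L = weighted_norm (- s) I"
  define c where "c = C1 + L * sqrt ((2 * (1 + P\<^sup>2)) ^ m * C2)"
  have L0: "0 \<le> L" by (simp add: L_def weighted_norm_nonneg)
  have c0: "0 \<le> c" unfolding c_def using C1(1) C2(1) L0 by (intro add_nonneg_nonneg mult_nonneg_nonneg) auto
  show ?thesis
  proof (rule that[OF c0])
    fix T :: real and g assume T: "0 < T" and g: "g \<in> weighted_L2 s"
    have [measurable]: "g \<in> borel_measurable lborel" by (rule weighted_L2_measurable[OF g])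
    define g1 where "g1 k = (if \<bar>k\<bar> \<le> R then 0 else g k)" for k
    define g2 where "g2 k = (if \<bar>k\<bar> \<le> R then g k else 0)" for k
    have [measurable]: "g1 \<in> borel_measurable lborel" "g2 \<in> borel_measurable lborel"
      unfolding g1_def g2_def by measurable
    have g1: "g1 \<in> weighted_L2 s" "weighted_norm s g1 \<le> weighted_norm s g"
      using weighted_L2_dominated[OF g, of g1] by (auto simp: g1_def)
    have g2: "g2 \<in> weighted_L2 s" "weighted_norm s g2 \<le> weighted_norm s g"
      using weighted_L2_dominated[OF g, of g2] by (auto simp: g2_def)
    have g2I: "g2 k * I k = g2 k" for k by (auto simp: g2_def I_def indicator_def abs_le_iff)
    have g2i: "integrable lborel g2" and g2n: "(LBINT k. cmod (g2 k)) \<le> weighted_norm s g * L"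
    proof -
      show "integrable lborel g2" using weighted_L2_pairing_integrable[OF g2(1) I] by (simp add: g2I)
      have "(LBINT k. cmod (g2 k)) \<le> weighted_norm s g2 * L"
        using weighted_L2_pairing_bound[OF g2(1) I] by (simp add: g2I L_def)
      also have "\<dots> \<le> weighted_norm s g * L" by (intro mult_right_mono g2 L0)
      finally show "(LBINT k. cmod (g2 k)) \<le> weighted_norm s g * L" .
    qed
    obtain h1 where h1: "h1 \<in> weighted_L2 \<sigma>" "weighted_norm \<sigma> h1 \<le> C1 * weighted_norm s g1"
      "\<And>\<psi>. \<psi> \<in> borel_measurable borel \<Longrightarrow> (LBINT \<tau>. h1 \<tau> * \<psi> \<tau>) = (LBINT k. g1 k * \<psi> (?p k))"
      using C1(2)[OF g1(1)] by (auto simp: g1_def)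
    \<comment> \<open>The cutoff is 1 for |t| \<le> a - 1, so a = T + 1 covers [-T, T].\<close>
    have "0 < T + 1" using T by simp
    from C2(2)[OF this] obtain \<theta> where \<theta>: "integrable lborel \<theta>" "\<And>t. \<bar>t\<bar> \<le> T \<Longrightarrow> \<theta> t = 1"
      "fourier \<theta> \<in> borel_measurable borel" "integrable lborel (\<lambda>u. (1 + u\<^sup>2) ^ m * (cmod (fourier \<theta> u))\<^sup>2)"
      "(LBINT u. (1 + u\<^sup>2) ^ m * (cmod (fourier \<theta> u))\<^sup>2) \<le> C2 * (T + 1)" by auto
    have g2P: "\<bar>?p k\<bar> \<le> P" if "g2 k \<noteq> 0" for k
      using P[of k] that by (auto simp: g2_def abs_le_iff split: if_splits)
    define h2 where "h2 \<tau> = 1 / (2 * of_real pi) * (LBINT k. g2 k * fourier \<theta> (\<tau> - ?p k))" for \<tau>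
    have h2: "h2 \<in> weighted_L2 \<sigma>"
      unfolding h2_def[abs_def]
      by (rule localised_function_weighted_L2[OF \<theta>(1,3,4,5) g2i phase_measurable _ m]) (rule g2P)
    have h2n: "weighted_norm \<sigma> h2 \<le> (LBINT k. cmod (g2 k)) * sqrt ((2 * (1 + P\<^sup>2)) ^ m * (C2 * (T + 1)))"
      unfolding h2_def[abs_def]
      by (rule localised_function_norm[OF \<theta>(1,3,4,5) g2i phase_measurable _ m]) (rule g2P)
    have h2\<psi>: "inv_fourier h2 \<psi> = time_trace \<alpha> \<beta> \<delta> g2 \<psi>"
      if "\<psi> \<in> schwartz" "\<And>t. \<psi> t \<noteq> 0 \<Longrightarrow> \<theta> t = 1" for \<psi>
      unfolding h2_def[abs_def] time_trace_def
      by (rule localised_function_inv_fourier[OF \<theta>(1,3,4,5) g2i phase_measurable _ m that(1)])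
        (rule g2P that(2), assumption)+
    define h where "h \<tau> = h1 \<tau> + h2 \<tau>" for \<tau>
    have hW: "h \<in> weighted_L2 \<sigma>" unfolding h_def[abs_def] by (rule weighted_L2_add[OF h1(1) h2])
    have root: "sqrt (T + 1) \<le> 1 + T powr (1 / 2)"
      using sqrt_add_le_add_sqrt[of T 1] T by (simp add: powr_half_sqrt)
    have Tp: "1 \<le> 1 + T powr (1 / 2)" by simp
    have "weighted_norm \<sigma> h2 \<le> (weighted_norm s g * L) * sqrt ((2 * (1 + P\<^sup>2)) ^ m * (C2 * (T + 1)))"
      using C2(1) T by (intro order_trans[OF h2n] mult_right_mono g2n) auto
    also have "\<dots> = weighted_norm s g * (L * sqrt ((2 * (1 + P\<^sup>2)) ^ m * C2)) * sqrt (T + 1)"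
      by (simp add: real_sqrt_mult)
    also have "\<dots> \<le> weighted_norm s g * (L * sqrt ((2 * (1 + P\<^sup>2)) ^ m * C2)) * (1 + T powr (1 / 2))"
      using C2(1) L0 by (intro mult_left_mono root mult_nonneg_nonneg weighted_norm_nonneg) auto
    finally have n2: "weighted_norm \<sigma> h2 \<le> weighted_norm s g * (L * sqrt ((2 * (1 + P\<^sup>2)) ^ m * C2)) * (1 + T powr (1 / 2))" .
    have "weighted_norm \<sigma> h1 \<le> C1 * weighted_norm s g"
      using h1(2) mult_left_mono[OF g1(2) C1(1)] by simp
    also have "\<dots> = weighted_norm s g * C1 * 1" by simp
    also have "\<dots> \<le> weighted_norm s g * C1 * (1 + T powr (1 / 2))"
      by (intro mult_left_mono Tp mult_nonneg_nonneg C1 weighted_norm_nonneg)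
    finally have "weighted_norm \<sigma> h1 \<le> weighted_norm s g * C1 * (1 + T powr (1 / 2))" .
    with n2 have "weighted_norm \<sigma> h1 + weighted_norm \<sigma> h2 \<le> c * (1 + T powr (1 / 2)) * weighted_norm s g"
      by (simp add: c_def algebra_simps)
    then have norm: "weighted_norm \<sigma> h \<le> c * (1 + T powr (1 / 2)) * weighted_norm s g"
      using order_trans[OF weighted_norm_triangle[OF h1(1) h2]] unfolding h_def[abs_def] by blast
    have ext: "inv_fourier h \<psi> = time_trace \<alpha> \<beta> \<delta> g \<psi>" if \<psi>: "\<psi> \<in> test_functions {-T<..<T}" for \<psi>
    proof -
      note \<psi>S = test_functions_schwartz[OF \<psi>]
      obtain K where K: "K \<subseteq> {-T<..<T}" "\<And>t. t \<notin> K \<Longrightarrow> \<psi> t = 0"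
        using test_functionsD(2)[OF \<psi>] by blast
      have \<theta>1: "\<theta> t = 1" if "\<psi> t \<noteq> 0" for t
      proof -
        have "t \<in> {-T<..<T}" using that K by blast
        then show ?thesis by (intro \<theta>) auto
      qed
      have "(\<lambda>\<tau>. fourier \<psi> (- \<tau>)) \<in> borel_measurable borel"
        using schwartz_measurable[OF fourier_schwartz[OF \<psi>S]] by measurable
      from h1(3)[OF this] have e1: "inv_fourier h1 \<psi> = time_trace \<alpha> \<beta> \<delta> g1 \<psi>"
        by (simp add: inv_fourier_def time_trace_def)
      have e2: "inv_fourier h2 \<psi> = time_trace \<alpha> \<beta> \<delta> g2 \<psi>"
        by (rule h2\<psi>[OF \<psi>S \<theta>1])
      have "inv_fourier h \<psi> = inv_fourier h1 \<psi> + inv_fourier h2 \<psi>"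
        unfolding inv_fourier_def h_def distrib_right
        using inv_fourier_integrable[OF h1(1) \<psi>S] inv_fourier_integrable[OF h2 \<psi>S] by (simp add: distrib_left)
      moreover have "time_trace \<alpha> \<beta> \<delta> g \<psi> = time_trace \<alpha> \<beta> \<delta> g1 \<psi> + time_trace \<alpha> \<beta> \<delta> g2 \<psi>"
      proof -
        have "(\<lambda>k. g k - g1 k) = g2" by (auto simp: g1_def g2_def)
        then show ?thesis using time_trace_diff[OF assms g g1(1) \<psi>S, of \<alpha> \<delta>] by simp
      qed
      ultimately show ?thesis using e1 e2 by simp
    qed
    from hW norm ext show "\<exists>h\<in>weighted_L2 ((s + 1) / 3). weighted_norm ((s + 1) / 3) h \<le> c * (1 + T powr (1 / 2)) * weighted_norm s g \<and>
      (\<forall>\<psi>\<in>test_functions {-T<..<T}. inv_fourier h \<psi> = time_trace \<alpha> \<beta> \<delta> g \<psi>)"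
      unfolding \<sigma>_def by blast
  qed
qed

section \<open>From weighted norms back to Sobolev norms of functionals\<close>

lemma sobolev_norm_nonneg: "0 \<le> sobolev_norm s u"
  by (simp add: sobolev_norm_def)

text \<open>An infimum of reals is controlled only over a nonempty set that is bounded below:
  \<open>F\<close> provides the first, nonnegativity of norms the second.\<close>

lemma sobolev_on_norm_bounds:
  assumes "F \<in> sobolev_extensions U s f"
  shows "0 \<le> sobolev_on_norm U s f" "sobolev_on_norm U s f \<le> sobolev_norm s F"
proof -
  show "0 \<le> sobolev_on_norm U s f"
    unfolding sobolev_on_norm_def using assms by (intro cINF_greatest sobolev_norm_nonneg) auto
  show "sobolev_on_norm U s f \<le> sobolev_norm s F"
    unfolding sobolev_on_norm_def
    by (intro cINF_lower assms bdd_belowI2[where m = 0] sobolev_norm_nonneg)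
qed

text \<open>Functionals are meaningful on Schwartz functions only, so membership and norm are
  transferred to whatever agrees there with an inverse transform.\<close>

lemma sobolev_cong:
  assumes eq: "\<And>\<phi>. \<phi> \<in> schwartz \<Longrightarrow> u \<phi> = inv_fourier h \<phi>" and h: "h \<in> weighted_L2 s"
  shows "u \<in> sobolev s" "sobolev_norm s u = weighted_norm s h"
proof -
  have hf: "has_fourier u h"
    using has_fourier_inv_fourier[OF h] eq fourier_schwartz by (simp add: has_fourier_def)
  have "tempered u"
    using tempered_inv_fourier[OF h] eq schwartz_add schwartz_cmult unfolding tempered_def by simp
  with hf h show "u \<in> sobolev s"
    unfolding sobolev_def using weighted_L2_integrable by blast
  show "sobolev_norm s u = weighted_norm s h" by (rule sobolev_norm_eq[OF hf])
qed

theorem theorem2p1: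
  fixes \<alpha> \<beta> \<delta> s :: real
  assumes "\<beta> > 0"
  shows
    "(\<forall>y0\<in>sobolev s.
        cauchy_solution \<alpha> \<beta> \<delta> y0 (solution_op \<alpha> \<beta> \<delta> y0) \<and>
        (\<forall>z. cauchy_solution \<alpha> \<beta> \<delta> y0 z \<longrightarrow>
           (\<forall>t. \<forall>\<phi>\<in>schwartz. z t \<phi> = solution_op \<alpha> \<beta> \<delta> y0 t \<phi>)) \<and>
        continuous_into (sobolev s) (sobolev_norm s) (solution_op \<alpha> \<beta> \<delta> y0) \<and>
        (\<forall>t. sobolev_norm s (solution_op \<alpha> \<beta> \<delta> y0 t) = sobolev_norm s y0)) \<and>
     (\<alpha>\<^sup>2 + 3 * \<beta> * \<delta> \<ge> 0 \<longrightarrow>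
        (\<exists>c\<ge>0. \<forall>y0\<in>sobolev s. \<exists>Y. time_traces (solution_op \<alpha> \<beta> \<delta> y0) Y \<and>
           (\<forall>T>0.
              continuous_into (sobolev_on {-T<..<T} ((s + 1) / 3))
                (sobolev_on_norm {-T<..<T} ((s + 1) / 3)) Y \<and>
              (SUP x. ennreal (sobolev_on_norm {-T<..<T} ((s + 1) / 3) (Y x)))
                \<le> ennreal (c * (1 + T powr (1 / 2)) * sobolev_norm s y0)))) \<and>
     (\<alpha>\<^sup>2 + 3 * \<beta> * \<delta> < 0 \<longrightarrow>
        (\<exists>c\<ge>0. \<forall>y0\<in>sobolev s. \<exists>Y. time_traces (solution_op \<alpha> \<beta> \<delta> y0) Y \<and>
           continuous_into (sobolev ((s + 1) / 3)) (sobolev_norm ((s + 1) / 3)) Y \<and>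
           (SUP x. ennreal (sobolev_norm ((s + 1) / 3) (Y x)))
             \<le> ennreal (c * sobolev_norm s y0)))"
proof (intro conjI impI ballI)
  fix y0 assume y0: "y0 \<in> sobolev s"
  show "cauchy_solution \<alpha> \<beta> \<delta> y0 (solution_op \<alpha> \<beta> \<delta> y0)"
    by (rule solution_op_cauchy_solution[OF y0])
  show "\<forall>z. cauchy_solution \<alpha> \<beta> \<delta> y0 z \<longrightarrow>
           (\<forall>t. \<forall>\<phi>\<in>schwartz. z t \<phi> = solution_op \<alpha> \<beta> \<delta> y0 t \<phi>)"
    using cauchy_solution_unique[OF y0] by blast
  show "continuous_into (sobolev s) (sobolev_norm s) (solution_op \<alpha> \<beta> \<delta> y0)"
    by (rule solution_op_continuous[OF y0])
  show "\<forall>t. sobolev_norm s (solution_op \<alpha> \<beta> \<delta> y0 t) = sobolev_norm s y0"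
    using solution_op_norm[OF y0] by blast
next
  define \<sigma> where "\<sigma> = (s + 1) / 3"
  define Y where "Y y0 x = time_trace \<alpha> \<beta> \<delta> (\<lambda>k. iexp (k * x) * dist_fourier y0 k)" for y0 x
  have W: "(\<lambda>k. iexp (k * x) * dist_fourier y0 k) \<in> weighted_L2 s"
    "weighted_norm s (\<lambda>k. iexp (k * x) * dist_fourier y0 k) = sobolev_norm s y0"
    if "y0 \<in> sobolev s" for x y0
    using weighted_L2_iexp[OF sobolev_dist_fourier(2)[OF that], of "\<lambda>k. k * x"]
      weighted_norm_iexp[OF sobolev_dist_fourier(2)[OF that], of "\<lambda>k. k * x"]
      sobolev_norm_eq[OF sobolev_dist_fourier(1)[OF that]]
    by simp_all
  \<comment> \<open>The trace is linear in the data on Schwartz functions, where its integrals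
    converge; continuity in x then follows from the estimates applied to the difference of the
    data.\<close>
  have Ydiff: "Y y0 b \<psi> - Y y0 a \<psi> = time_trace \<alpha> \<beta> \<delta> (\<lambda>k. iexp (k * b) * dist_fourier y0 k - iexp (k * a) * dist_fourier y0 k) \<psi>"
    if "y0 \<in> sobolev s" "\<psi> \<in> schwartz" for y0 a b \<psi>
    unfolding Y_def by (rule time_trace_diff[OF assms W(1)[OF that(1)] W(1)[OF that(1)] that(2), symmetric])
  have traces: "time_traces (solution_op \<alpha> \<beta> \<delta> y0) (Y y0)" if "y0 \<in> sobolev s" for y0
    unfolding Y_def[abs_def] by (rule time_traces_time_trace[OF assms that])
  have lim: "((\<lambda>b. weighted_norm s (\<lambda>k. iexp (k * b) * dist_fourier y0 k - iexp (k * a) * dist_fourier y0 k)) \<longlongrightarrow> 0) (at a)"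
    if "y0 \<in> sobolev s" for y0 a
    using weighted_norm_iexp_diff_tendsto[OF sobolev_dist_fourier(2)[OF that], of "\<lambda>k. k"] by simp
  {
    obtain c where c: "0 \<le> c" and ex: "\<And>T g. 0 < T \<Longrightarrow> g \<in> weighted_L2 s \<Longrightarrow>
      \<exists>h\<in>weighted_L2 \<sigma>. weighted_norm \<sigma> h \<le> c * (1 + T powr (1 / 2)) * weighted_norm s g \<and>
        (\<forall>\<psi>\<in>test_functions {-T<..<T}. inv_fourier h \<psi> = time_trace \<alpha> \<beta> \<delta> g \<psi>)"
      using time_trace_local_extension[OF assms, of s] unfolding \<sigma>_def by metis
    \<comment> \<open>Stated for any \<open>f\<close> that agrees with a trace on Schwartz
      functions, so that it covers the values of \<open>Y y0\<close> and their differences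
      alike.\<close>
    have ext: "\<exists>F\<in>sobolev_extensions {-T<..<T} \<sigma> f. sobolev_norm \<sigma> F \<le> c * (1 + T powr (1 / 2)) * weighted_norm s g"
      if T: "0 < T" and g: "g \<in> weighted_L2 s"
        and f: "\<And>\<psi>. \<psi> \<in> schwartz \<Longrightarrow> f \<psi> = time_trace \<alpha> \<beta> \<delta> g \<psi>" for T g f
    proof -
      obtain h where h: "h \<in> weighted_L2 \<sigma>" "weighted_norm \<sigma> h \<le> c * (1 + T powr (1 / 2)) * weighted_norm s g"
        "\<And>\<psi>. \<psi> \<in> test_functions {-T<..<T} \<Longrightarrow> inv_fourier h \<psi> = time_trace \<alpha> \<beta> \<delta> g \<psi>"
        using ex[OF T g] by blast
      have "inv_fourier h \<in> sobolev_extensions {-T<..<T} \<sigma> f"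
        using inv_fourier_sobolev[OF h(1)] h(3) f test_functions_schwartz
        by (simp add: sobolev_extensions_def)
      moreover have "sobolev_norm \<sigma> (inv_fourier h) \<le> c * (1 + T powr (1 / 2)) * weighted_norm s g"
        unfolding sobolev_norm_inv_fourier[OF h(1)] by (rule h(2))
      ultimately show ?thesis by (intro bexI[of _ "inv_fourier h"])
    qed
    have cont: "continuous_into (sobolev_on {-T<..<T} \<sigma>) (sobolev_on_norm {-T<..<T} \<sigma>) (Y y0)"
      if T: "0 < T" and y0: "y0 \<in> sobolev s" for T y0
      unfolding continuous_into_def
    proof (intro conjI allI)
      show "Y y0 x \<in> sobolev_on {-T<..<T} \<sigma>" for x
        using ext[OF T W(1)[OF y0], of "Y y0 x" x] by (auto simp: sobolev_on_def Y_def)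
      fix a
      have "((\<lambda>b. c * (1 + T powr (1 / 2)) * weighted_norm s (\<lambda>k. iexp (k * b) * dist_fourier y0 k - iexp (k * a) * dist_fourier y0 k)) \<longlongrightarrow> 0) (at a)"
        by (rule tendsto_mult_right_zero[OF lim[OF y0]])
      then show "((\<lambda>b. sobolev_on_norm {-T<..<T} \<sigma> (\<lambda>\<phi>. Y y0 b \<phi> - Y y0 a \<phi>)) \<longlongrightarrow> 0) (at a)"
      proof (rule Lim_null_comparison[rotated], intro always_eventually allI)
        fix b
        obtain F where "F \<in> sobolev_extensions {-T<..<T} \<sigma> (\<lambda>\<phi>. Y y0 b \<phi> - Y y0 a \<phi>)"
          "sobolev_norm \<sigma> F \<le> c * (1 + T powr (1 / 2)) * weighted_norm s (\<lambda>k. iexp (k * b) * dist_fourier y0 k - iexp (k * a) * dist_fourier y0 k)"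
          using ext[OF T weighted_L2_diff[OF W(1)[OF y0] W(1)[OF y0]] Ydiff[OF y0]] by blast
        then show "norm (sobolev_on_norm {-T<..<T} \<sigma> (\<lambda>\<phi>. Y y0 b \<phi> - Y y0 a \<phi>))
          \<le> c * (1 + T powr (1 / 2)) * weighted_norm s (\<lambda>k. iexp (k * b) * dist_fourier y0 k - iexp (k * a) * dist_fourier y0 k)"
          using sobolev_on_norm_bounds[of F "{-T<..<T}" \<sigma>] by fastforce
      qed
    qed
    have sup: "(SUP x. ennreal (sobolev_on_norm {-T<..<T} \<sigma> (Y y0 x))) \<le> ennreal (c * (1 + T powr (1 / 2)) * sobolev_norm s y0)"
      if T: "0 < T" and y0: "y0 \<in> sobolev s" for T y0
    proof (intro SUP_least ennreal_leI)
      fix x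
      obtain F where "F \<in> sobolev_extensions {-T<..<T} \<sigma> (Y y0 x)"
        "sobolev_norm \<sigma> F \<le> c * (1 + T powr (1 / 2)) * sobolev_norm s y0"
        using ext[OF T W(1)[OF y0], of "Y y0 x" x] W(2)[OF y0, of x] by (auto simp: Y_def)
      then show "sobolev_on_norm {-T<..<T} \<sigma> (Y y0 x) \<le> c * (1 + T powr (1 / 2)) * sobolev_norm s y0"
        using sobolev_on_norm_bounds(2) order_trans by blast
    qed
    show "\<exists>c\<ge>0. \<forall>y0\<in>sobolev s. \<exists>Y. time_traces (solution_op \<alpha> \<beta> \<delta> y0) Y \<and>
           (\<forall>T>0.
              continuous_into (sobolev_on {-T<..<T} ((s + 1) / 3))
                (sobolev_on_norm {-T<..<T} ((s + 1) / 3)) Y \<and>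
              (SUP x. ennreal (sobolev_on_norm {-T<..<T} ((s + 1) / 3) (Y x)))
                \<le> ennreal (c * (1 + T powr (1 / 2)) * sobolev_norm s y0))"
      unfolding \<sigma>_def[symmetric]
    proof (intro exI[of _ c] conjI c ballI)
      fix y0 assume y0: "y0 \<in> sobolev s"
      show "\<exists>Y. time_traces (solution_op \<alpha> \<beta> \<delta> y0) Y \<and>
           (\<forall>T>0. continuous_into (sobolev_on {-T<..<T} \<sigma>) (sobolev_on_norm {-T<..<T} \<sigma>) Y \<and>
              (SUP x. ennreal (sobolev_on_norm {-T<..<T} \<sigma> (Y x))) \<le> ennreal (c * (1 + T powr (1 / 2)) * sobolev_norm s y0))"
        by (intro exI[of _ "Y y0"] conjI allI impI cont[OF _ y0] sup[OF _ y0])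
          (rule traces[OF y0])
    qed
  next
    assume neg: "\<alpha>\<^sup>2 + 3 * \<beta> * \<delta> < 0"
    obtain c where c: "0 \<le> c" and ex: "\<And>g. g \<in> weighted_L2 s \<Longrightarrow>
      \<exists>h\<in>weighted_L2 \<sigma>. weighted_norm \<sigma> h \<le> c * weighted_norm s g \<and>
        (\<forall>\<psi>\<in>borel_measurable borel. (LBINT \<tau>. h \<tau> * \<psi> \<tau>) = (LBINT k. g k * \<psi> (phase \<alpha> \<beta> \<delta> k)))"
      unfolding \<sigma>_def by (rule transport_by_phase_elliptic[OF assms neg, of s]) (rule that[unfolded \<sigma>_def], assumption+)
    have mem: "f \<in> sobolev \<sigma>" "sobolev_norm \<sigma> f \<le> c * weighted_norm s g"
      if g: "g \<in> weighted_L2 s" and f: "\<And>\<psi>. \<psi> \<in> schwartz \<Longrightarrow> f \<psi> = time_trace \<alpha> \<beta> \<delta> g \<psi>" for g f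
    proof -
      obtain h where h: "h \<in> weighted_L2 \<sigma>" "weighted_norm \<sigma> h \<le> c * weighted_norm s g"
        "\<And>\<psi>. \<psi> \<in> borel_measurable borel \<Longrightarrow> (LBINT \<tau>. h \<tau> * \<psi> \<tau>) = (LBINT k. g k * \<psi> (phase \<alpha> \<beta> \<delta> k))"
        using ex[OF g] by blast
      have "f \<psi> = inv_fourier h \<psi>" if \<psi>: "\<psi> \<in> schwartz" for \<psi>
      proof -
        have "(\<lambda>\<tau>. fourier \<psi> (- \<tau>)) \<in> borel_measurable borel"
          using schwartz_measurable[OF fourier_schwartz[OF \<psi>]] by measurable
        from h(3)[OF this] show ?thesis by (simp add: f[OF \<psi>] inv_fourier_def time_trace_def)
      qed
      from sobolev_cong[OF this h(1)] h(2) show "f \<in> sobolev \<sigma>" "sobolev_norm \<sigma> f \<le> c * weighted_norm s g"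
        by auto
    qed
    show "\<exists>c\<ge>0. \<forall>y0\<in>sobolev s. \<exists>Y. time_traces (solution_op \<alpha> \<beta> \<delta> y0) Y \<and>
           continuous_into (sobolev ((s + 1) / 3)) (sobolev_norm ((s + 1) / 3)) Y \<and>
           (SUP x. ennreal (sobolev_norm ((s + 1) / 3) (Y x)))
             \<le> ennreal (c * sobolev_norm s y0)"
      unfolding \<sigma>_def[symmetric]
    proof (intro exI[of _ c] conjI c ballI)
      fix y0 assume y0: "y0 \<in> sobolev s"
      have Ymem: "Y y0 x \<in> sobolev \<sigma>" "sobolev_norm \<sigma> (Y y0 x) \<le> c * sobolev_norm s y0" for x
        using mem[OF W(1)[OF y0], of "Y y0 x" x] W(2)[OF y0, of x] by (auto simp: Y_def)
      have "((\<lambda>b. sobolev_norm \<sigma> (\<lambda>\<phi>. Y y0 b \<phi> - Y y0 a \<phi>)) \<longlongrightarrow> 0) (at a)" for a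
      proof (rule Lim_null_comparison[OF always_eventually tendsto_mult_right_zero[OF lim[OF y0]]], intro allI)
        show "norm (sobolev_norm \<sigma> (\<lambda>\<phi>. Y y0 b \<phi> - Y y0 a \<phi>))
          \<le> c * weighted_norm s (\<lambda>k. iexp (k * b) * dist_fourier y0 k - iexp (k * a) * dist_fourier y0 k)" for b
          using mem(2)[OF weighted_L2_diff[OF W(1)[OF y0] W(1)[OF y0]] Ydiff[OF y0]] by (simp add: sobolev_norm_nonneg)
      qed
      with Ymem(1) have "continuous_into (sobolev \<sigma>) (sobolev_norm \<sigma>) (Y y0)"
        by (simp add: continuous_into_def)
      moreover have "(SUP x. ennreal (sobolev_norm \<sigma> (Y y0 x))) \<le> ennreal (c * sobolev_norm s y0)"
        by (intro SUP_least ennreal_leI Ymem)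
      ultimately show "\<exists>Y. time_traces (solution_op \<alpha> \<beta> \<delta> y0) Y \<and>
           continuous_into (sobolev \<sigma>) (sobolev_norm \<sigma>) Y \<and>
           (SUP x. ennreal (sobolev_norm \<sigma> (Y x))) \<le> ennreal (c * sobolev_norm s y0)"
        using traces[OF y0] by (intro exI[of _ "Y y0"] conjI)
    qed
  }
qed

end
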